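(* Let $m\geq n\geq 4$ both be even. Then the $m$-linear $SO(n,\mathbb C)$-invariant $\tilde f=\tilde f_{n\times m}$ is indecomposable in the ring $R^{SO(n,\mathbb C)}(\mathbb Z)$.
   Context: Write $n=2\nu$ and $m=2\mu$. **Groups.** Coordinates on $\mathbb C^n$ are $x_1,y_1,\dots,x_\nu,y_\nu$, and $q=x_1y_1+\dots+x_\nu y_\nu$. $O(n,\mathbb C)$ is the group of linear automorphisms of $\mathbb C^n$ preserving $q$, and $SO(n,\mathbb C)$ is its component containing the identity. **Invariants.** $R=R_{n\times m}$ is the $\mathbb C$-algebra of polynomials in the coordinates $x_r^{(i)},y_r^{(i)}$ of indeterminate $n$-dimensional vectors $v^{(1)},\dots,v^{(m)}$, and $R(\mathbb Z)$ is its subring of polynomials with integer coefficients. For $G=SO(n,\mathbb C)$, $R^G$ is the subalgebra of polynomials invariant under the simultaneous action of $G$ on $m$-tuples of vectors, and $R^G(\mathbb Z)=R^G\cap R(\mathbb Z)$. A polynomial is $m$-linear if it is multilinear in $v^{(1)},\dots,v^{(m)}$. An element of $R^G(\mathbb Z)$ is indecomposable if it is not contained in the subring of $R^G(\mathbb Z)$ generated by the elements of $R^G(\mathbb Z)$ of lower degree (i.e. of total degree strictly less than that of the given element). **The polynomial $\tilde f$.** Let $B^{(ij)}=\sum_{r=1}^\nu(x_r^{(i)}y_r^{(j)}+y_r^{(i)}x_r^{(j)})$ for $1\le i,j\le m$; let $D^{(i_1,\dots,i_n)}=\det[v^{(i_1)},\dots,v^{(i_n)}]$ be the determinant of the matrix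 with the given columns (coordinates in the order $x_1,y_1,\dots,x_\nu,y_\nu$); and let $\mathrm{Pf}^{(i_1,\dots,i_{2\lambda})}$ be the Pfaffian of the $2\lambda\times2\lambda$ skew-symmetric matrix whose $(k,l)$ entry for $k<l$ is $B^{(i_ki_l)}$ (normalized so that the Pfaffian of $\begin{pmatrix}0&a\\-a&0\end{pmatrix}$ is $a$; the empty Pfaffian is $1$). Put $$\tilde f=\frac{1}{2^{\mu-\nu+1}}\left(\mathrm{Pf}^{(1,\dots,2\mu)}-\sum_\pi \mathrm{sgn}\,\pi\cdot D^{(\pi(1),\dots,\pi(n))}\mathrm{Pf}^{(\pi(n+1),\dots,\pi(m))}\right),$$ the sum being over permutations $\pi\in\mathfrak S_m$ with $\pi(1)<\dots<\pi(n)$ and $\pi(n+1)<\dots<\pi(m)$. It is an $SO(n,\mathbb C)$-invariant with integer coefficients. *)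

theory Defs
  imports
    "HOL-Analysis.Function_Topology"
    "HOL-Library.Poly_Mapping"
    "HOL-Algebra.Generated_Rings"
    "Jordan_Normal_Form.VS_Connect"
    "Jordan_Normal_Form.Determinant"
begin

text \<open>
  Everything is indexed from 0: the vectors are numbered by \<open>i < m\<close>, the coordinates by \<open>k < n\<close>.
  Coordinates are ordered \<open>x\<^sub>0, y\<^sub>0, x\<^sub>1, y\<^sub>1, \<dots>\<close>, so that coordinate \<open>2 * r\<close> is \<open>x\<^sub>r\<close> and
  coordinate \<open>2 * r + 1\<close> is \<open>y\<^sub>r\<close>. Vectors of \<open>\<complex>\<^sup>n\<close> are elements of \<open>carrier_vec n\<close>.
\<close>

definition quad_form :: "nat \<Rightarrow> complex vec \<Rightarrow> complex" where
  "quad_form n v = (\<Sum>r<n div 2. vec_index v (2 * r) * vec_index v (2 * r + 1))"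

definition orthogonal_group :: "nat \<Rightarrow> complex mat set" where
  "orthogonal_group n =
     {A \<in> carrier_mat n n. invertible_mat A \<and>
        (\<forall>v\<in>carrier_vec n. quad_form n (A *\<^sub>v v) = quad_form n v)}"

text \<open>The topology of \<open>\<complex>\<^bsup>n\<times>n\<^esup>\<close>, transported to \<open>carrier_mat n n\<close> along the matrix entries.\<close>

definition mat_topology :: "nat \<Rightarrow> complex mat topology" where
  "mat_topology n =
     pullback_topology (carrier_mat n n)
       (\<lambda>A. restrict (\<lambda>p. A $$ p) ({..<n} \<times> {..<n}))
       (product_topology (\<lambda>_. euclidean) ({..<n} \<times> {..<n}))"

definition special_orthogonal_group :: "nat \<Rightarrow> complex mat set" where
  "special_orthogonal_group n =
     connected_component_of_set (subtopology (mat_topology n) (orthogonal_group n)) (1\<^sub>m n)"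

text \<open>The indeterminate \<open>(i, k)\<close> is the \<open>k\<close>-th coordinate of the \<open>i\<close>-th vector.\<close>

type_synonym mpol = "(nat \<times> nat \<Rightarrow>\<^sub>0 nat) \<Rightarrow>\<^sub>0 complex"

definition coord :: "nat \<Rightarrow> nat \<Rightarrow> mpol" where
  "coord i k = Poly_Mapping.single (Poly_Mapping.single (i, k) 1) 1"

definition const_pol :: "complex \<Rightarrow> mpol" where
  "const_pol c = Poly_Mapping.single 0 c"

definition poly_ring :: "nat \<Rightarrow> nat \<Rightarrow> mpol set" where
  "poly_ring n m =
     {f. \<forall>a\<in>Poly_Mapping.keys f. Poly_Mapping.keys a \<subseteq> {..<m} \<times> {..<n}}"

definition int_poly_ring :: "nat \<Rightarrow> nat \<Rightarrow> mpol set" where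
  "int_poly_ring n m = {f \<in> poly_ring n m. \<forall>a. Poly_Mapping.lookup f a \<in> \<int>}"

definition total_degree :: "mpol \<Rightarrow> nat" where
  "total_degree f =
     Max (insert 0 ((\<lambda>a. \<Sum>p\<in>Poly_Mapping.keys a. Poly_Mapping.lookup a p) ` Poly_Mapping.keys f))"

definition eval_pol :: "mpol \<Rightarrow> (nat \<Rightarrow> complex vec) \<Rightarrow> complex" where
  "eval_pol f v =
     (\<Sum>a\<in>Poly_Mapping.keys f. Poly_Mapping.lookup f a *
        (\<Prod>(i, k)\<in>Poly_Mapping.keys a. vec_index (v i) k ^ Poly_Mapping.lookup a (i, k)))"

definition multilinear_pol :: "nat \<Rightarrow> nat \<Rightarrow> mpol \<Rightarrow> bool" where
  "multilinear_pol n m f \<longleftrightarrow>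
     (\<forall>i<m. \<forall>v\<in>{..<m} \<rightarrow> carrier_vec n. \<forall>u\<in>carrier_vec n. \<forall>w\<in>carrier_vec n. \<forall>c d.
        eval_pol f (v(i := c \<cdot>\<^sub>v u + d \<cdot>\<^sub>v w)) =
          c * eval_pol f (v(i := u)) + d * eval_pol f (v(i := w)))"

definition invariants :: "nat \<Rightarrow> nat \<Rightarrow> mpol set" where
  "invariants n m =
     {f \<in> poly_ring n m. \<forall>A\<in>special_orthogonal_group n. \<forall>v\<in>{..<m} \<rightarrow> carrier_vec n.
        eval_pol f (\<lambda>i. A *\<^sub>v v i) = eval_pol f v}"

definition int_invariants :: "nat \<Rightarrow> nat \<Rightarrow> mpol set" where
  "int_invariants n m = invariants n m \<inter> int_poly_ring n m"

text \<open>\<open>class_ring\<close> is the type-class ring structure on \<^typ>\<open>mpol\<close>, seen as a ring record.\<close>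

definition indecomposable :: "nat \<Rightarrow> nat \<Rightarrow> mpol \<Rightarrow> bool" where
  "indecomposable n m f \<longleftrightarrow>
     f \<in> int_invariants n m \<and>
     f \<notin> generate_ring class_ring {g \<in> int_invariants n m. total_degree g < total_degree f}"

text \<open>The Pfaffian of a skew-symmetric \<open>2l \<times> 2l\<close> matrix, as the signed sum over the perfect
  matchings of \<open>{..<2 * l}\<close>; a matching is represented by the permutation listing its pairs
  \<open>(p 0, p 1), (p 2, p 3), \<dots>\<close>, each increasing, in the order of their first elements.\<close>

definition pfaffian :: "'a::comm_ring_1 mat \<Rightarrow> 'a" where
  "pfaffian M = (let l = dim_row M div 2 in
     \<Sum>p | p permutes {..<2 * l} \<and> (\<forall>k<l. p (2 * k) < p (2 * k + 1)) \<and>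
           strict_mono_on {..<l} (\<lambda>k. p (2 * k)).
       of_int (sign p) * (\<Prod>k<l. M $$ (p (2 * k), p (2 * k + 1))))"

definition bilin_pol :: "nat \<Rightarrow> nat \<Rightarrow> nat \<Rightarrow> mpol" where
  "bilin_pol n i j =
     (\<Sum>r<n div 2. coord i (2 * r) * coord j (2 * r + 1) + coord i (2 * r + 1) * coord j (2 * r))"

definition det_pol :: "nat \<Rightarrow> nat list \<Rightarrow> mpol" where
  "det_pol n js = Determinant.det (mat n n (\<lambda>(r, c). coord (js ! c) r))"

definition pf_pol :: "nat \<Rightarrow> nat list \<Rightarrow> mpol" where
  "pf_pol n js = pfaffian (mat (length js) (length js)
     (\<lambda>(k, l). if k < l then bilin_pol n (js ! k) (js ! l)
               else if l < k then - bilin_pol n (js ! l) (js ! k)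
               else 0))"

definition f_tilde :: "nat \<Rightarrow> nat \<Rightarrow> mpol" where
  "f_tilde n m =
     const_pol (1 / 2 ^ (m div 2 - n div 2 + 1)) *
     (pf_pol n [0..<m] -
      (\<Sum>p | p permutes {..<m} \<and> strict_mono_on {..<n} p \<and> strict_mono_on {n..<m} p.
         of_int (sign p) * det_pol n (map p [0..<n]) * pf_pol n (map p [n..<m])))"

end

theory Submission
  imports Defs
begin

text \<open>
  Write \<open>n = 2\<nu>\<close>, let \<open>B\<close> be the polar form of the quadratic form, and let \<open>x\<^sub>r, y\<^sub>r\<close> also denote the basis
  vectors. The value \<open>F\<close> of \<open>f_tilde\<close> at a list of vectors, extended to lists of any even length,
  satisfies the relation of the Clifford algebra,

  \<open>F(\<dots>, a, b, \<dots>) + F(\<dots>, b, a, \<dots>) = B(a, b) F(\<dots>, \<dots>)\<close>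

  (lemma \<open>half_spin_swap\<close>); in fact \<open>F\<close> is the trace of the product of the vectors on a half-spin
  module. The relation holds for the Pfaffian and for the alternating sum of products of determinants
  and Pfaffians separately, since both are sums over all permutations of the same shape, \<open>wick\<close>.

  \<^emph>\<open>Integrality.\<close> The coefficients of \<open>f_tilde\<close> are the values of \<open>F\<close> on basis vectors. By the relation
  these can be sorted modulo integers, and on sorted lists \<open>F\<close> is easily computed
  (lemma \<open>half_spin_integral\<close>).

  \<^emph>\<open>Indecomposability.\<close> Choose vectors \<open>u\<^sub>r = x\<^sub>r + y\<^sub>r\<close> such that each \<open>r < \<nu>\<close> occurs. For \<open>r \<noteq> s\<close> the
  simultaneous exchange of \<open>x\<^sub>r\<close> with \<open>y\<^sub>r\<close> and of \<open>x\<^sub>s\<close> with \<open>y\<^sub>s\<close> lies in the component of the identity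
  (lemma \<open>swap_pairs_special_orthogonal\<close>). The value of a multilinear integer invariant at these
  vectors is a sum of coefficients over words in the letters \<open>x\<^sub>r, y\<^sub>r\<close>; the exchanges permute the words
  freely and preserve the coefficients, so the value is divisible by a power of 2
  (lemma \<open>word_sum_dvd\<close>). For a product of two invariants of complementary nonempty sets of these
  vectors, the exponents add up to at least \<open>\<nu>\<close>, because \<open>\<nu> \<ge> 2\<close>. Hence \<open>2\<^sup>\<nu>\<close> divides the value of the
  multilinear part of anything generated by invariants of lower degree
  (lemma \<open>generated_word_sum\<close>). The value of \<open>f_tilde\<close>, however, is only \<open>2\<^bsup>\<nu> - 1\<^esup>\<close>: by the Clifford
  relation equal neighbours \<open>u\<^sub>r, u\<^sub>r\<close> cancel, which leaves the value of \<open>F\<close> at the empty list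
  (lemma \<open>word_sum_f_tilde\<close>).
\<close>

section \<open>Involutions and sorting permutations\<close>

text \<open>If \<open>k\<close> involutions preserve the summand and the \<open>r\<close>-th one flips the \<open>r\<close>-th of \<open>k\<close> bits
  only, then each of the \<open>2\<^sup>k\<close> bit patterns contributes the same amount. This yields both the factor
  between a sum over matchings and a sum over permutations, and the powers of two that divide the
  values of integer invariants.\<close>

lemma sum_halving:
  fixes t :: "'w \<Rightarrow> 'a::comm_ring_1" and \<tau> :: "'r \<Rightarrow> 'w \<Rightarrow> 'w" and b :: "'r \<Rightarrow> 'w \<Rightarrow> bool"
  assumes "finite R" and "finite W"
    and into: "\<And>r w. r \<in> R \<Longrightarrow> w \<in> W \<Longrightarrow> \<tau> r w \<in> W"
    and invol: "\<And>r w. r \<in> R \<Longrightarrow> w \<in> W \<Longrightarrow> \<tau> r (\<tau> r w) = w"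
    and t: "\<And>r w. r \<in> R \<Longrightarrow> w \<in> W \<Longrightarrow> t (\<tau> r w) = t w"
    and flip: "\<And>r w. r \<in> R \<Longrightarrow> w \<in> W \<Longrightarrow> b r (\<tau> r w) \<longleftrightarrow> \<not> b r w"
    and keep: "\<And>r s w. r \<in> R \<Longrightarrow> s \<in> R \<Longrightarrow> r \<noteq> s \<Longrightarrow> w \<in> W \<Longrightarrow> b s (\<tau> r w) \<longleftrightarrow> b s w"
  shows "(\<Sum>w\<in>W. t w) = 2 ^ card R * (\<Sum>w | w \<in> W \<and> (\<forall>r\<in>R. b r w). t w)"
  using \<open>finite R\<close> into invol t flip keep
proof (induction R rule: finite_induct)
  case empty
  then show ?case by simp
next
  case (insert x R)
  let ?V = "{w \<in> W. \<forall>r\<in>R. b r w}"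
  have fin: "finite ?V" using \<open>finite W\<close> by simp
  have stab: "\<tau> x w \<in> ?V" if "w \<in> ?V" for w
  proof -
    have "b r (\<tau> x w)" if "r \<in> R" for r
      using that \<open>w \<in> ?V\<close> insert.prems(5)[of x r w] insert.hyps by auto
    then show ?thesis using that insert.prems(1) by auto
  qed
  have "(\<Sum>w\<in>W. t w) = 2 ^ card R * (\<Sum>w\<in>?V. t w)"
    using insert.IH insert.prems by simp
  also have "(\<Sum>w\<in>?V. t w) = (\<Sum>w | w \<in> ?V \<and> b x w. t w) + (\<Sum>w | w \<in> ?V \<and> \<not> b x w. t w)"
  proof -
    have "?V = {w \<in> ?V. b x w} \<union> {w \<in> ?V. \<not> b x w}" by blast
    moreover have "finite {w \<in> ?V. b x w}" "finite {w \<in> ?V. \<not> b x w}"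
      using \<open>finite W\<close> by simp_all
    moreover have "{w \<in> ?V. b x w} \<inter> {w \<in> ?V. \<not> b x w} = {}" by blast
    ultimately show ?thesis by (metis (no_types, lifting) sum.union_disjoint)
  qed
  also have "(\<Sum>w | w \<in> ?V \<and> \<not> b x w. t w) = (\<Sum>w | w \<in> ?V \<and> b x w. t w)"
    by (rule sum.reindex_bij_witness[of _ "\<tau> x" "\<tau> x"])
      (use stab insert.prems in auto)
  also have "{w. w \<in> ?V \<and> b x w} = {w \<in> W. \<forall>r\<in>insert x R. b r w}"
    by auto
  finally show ?case
    using insert.hyps by (simp add: algebra_simps)
qed

lemma strict_mono_on_image_unique:
  fixes f g :: "nat \<Rightarrow> nat"
  assumes f: "strict_mono_on I f" and g: "strict_mono_on I g" and img: "f ` I = g ` I"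
  shows "x \<in> I \<Longrightarrow> f x = g x"
proof (induction x rule: less_induct)
  case (less x)
  have key: "\<not> f x < g x" if f: "strict_mono_on I f" and g: "strict_mono_on I g"
    and img: "f ` I = g ` I" and eq: "\<forall>y. y < x \<longrightarrow> y \<in> I \<longrightarrow> f y = g y" for f g :: "nat \<Rightarrow> nat"
  proof
    assume lt: "f x < g x"
    obtain z where z: "z \<in> I" "f x = g z" using img less.prems by (metis imageE imageI)
    have "z < x"
      using lt z less.prems strict_mono_on_less[OF g] by auto
    then have "f z = f x" using eq z by simp
    then show False
      using strict_mono_on_less[OF f, of z x] z less.prems \<open>z < x\<close> by simp
  qed
  show ?case
    using key[OF f g img] key[OF g f img[symmetric]] less.IH by (metis linorder_neqE_nat)
qed

text \<open>Together with uniqueness below, sorting picks the canonical representative of a coset of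
  permutations: matchings listed in increasing order, and shuffles.\<close>

lemma ex_sorting_permutation:
  fixes g :: "nat \<Rightarrow> nat"
  assumes "finite I" and "inj_on g I"
  obtains \<sigma> where "\<sigma> permutes I" and "strict_mono_on I (g \<circ> \<sigma>)"
proof -
  obtain h1 where h1: "bij_betw h1 {..<card I} I" "strict_mono_on {..<card I} h1"
    using ex_bij_betw_strict_mono_card[OF \<open>finite I\<close>] by blast
  have cg: "card (g ` I) = card I" using assms by (simp add: card_image)
  obtain h2 where h2: "bij_betw h2 {..<card I} (g ` I)" "strict_mono_on {..<card I} h2"
    using ex_bij_betw_strict_mono_card[of "g ` I"] assms cg by auto
  define \<sigma>0 where "\<sigma>0 = inv_into I g \<circ> h2 \<circ> inv_into {..<card I} h1"
  define \<sigma> where "\<sigma> = restrict_id \<sigma>0 I"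
  have b1: "bij_betw (inv_into {..<card I} h1) I {..<card I}"
    using h1(1) by (rule bij_betw_inv_into)
  have b2: "bij_betw (inv_into I g) (g ` I) I"
    using assms by (intro bij_betw_inv_into) (simp add: bij_betw_def)
  have "bij_betw \<sigma>0 I I"
    unfolding \<sigma>0_def using bij_betw_trans[OF b1 bij_betw_trans[OF h2(1) b2]] by (simp add: comp_assoc)
  then have perm: "\<sigma> permutes I"
    unfolding \<sigma>_def by (rule permutes_restrict_id)
  have val: "g (\<sigma> x) = h2 (inv_into {..<card I} h1 x)" if "x \<in> I" for x
  proof -
    have "inv_into {..<card I} h1 x \<in> {..<card I}" using b1 that by (auto simp: bij_betw_def)
    then have "h2 (inv_into {..<card I} h1 x) \<in> g ` I" using h2(1) by (auto simp: bij_betw_def)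
    then show ?thesis
      using that by (simp add: \<sigma>_def \<sigma>0_def restrict_id_def f_inv_into_f)
  qed
  have "strict_mono_on I (g \<circ> \<sigma>)"
  proof (rule strict_mono_onI)
    fix x y assume xy: "x \<in> I" "y \<in> I" "x < y"
    have mem: "inv_into {..<card I} h1 x \<in> {..<card I}" "inv_into {..<card I} h1 y \<in> {..<card I}"
      using b1 xy by (auto simp: bij_betw_def)
    have "h1 (inv_into {..<card I} h1 x) < h1 (inv_into {..<card I} h1 y)"
      using xy h1(1) by (simp add: bij_betw_def f_inv_into_f)
    then have "inv_into {..<card I} h1 x < inv_into {..<card I} h1 y"
      using strict_mono_on_less[OF h1(2)] mem by blast
    then show "(g \<circ> \<sigma>) x < (g \<circ> \<sigma>) y"
      using h2(2) mem xy val by (simp add: strict_mono_on_def)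
  qed
  with perm that show ?thesis by blast
qed

lemma sorting_permutation_unique:
  fixes g :: "nat \<Rightarrow> nat"
  assumes "inj_on g I" and "\<sigma> permutes I" "strict_mono_on I (g \<circ> \<sigma>)"
    and "\<tau> permutes I" "strict_mono_on I (g \<circ> \<tau>)"
  shows "\<sigma> = \<tau>"
proof
  fix x
  have "(g \<circ> \<sigma>) ` I = (g \<circ> \<tau>) ` I"
    using assms by (simp only: image_comp[symmetric] permutes_image)
  then have "x \<in> I \<Longrightarrow> g (\<sigma> x) = g (\<tau> x)"
    using strict_mono_on_image_unique[OF assms(3,5)] by simp
  then show "\<sigma> x = \<tau> x"
    using assms by (cases "x \<in> I") (auto simp: inj_on_def permutes_in_image permutes_not_in)
qed

definition sorting :: "nat set \<Rightarrow> (nat \<Rightarrow> nat) \<Rightarrow> nat \<Rightarrow> nat" where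
  "sorting I g = (SOME \<sigma>. \<sigma> permutes I \<and> strict_mono_on I (g \<circ> \<sigma>))"

lemma sorting:
  assumes "finite I" "inj_on g I"
  shows "sorting I g permutes I" "strict_mono_on I (g \<circ> sorting I g)"
  using ex_sorting_permutation[OF assms] unfolding sorting_def
  by (metis (mono_tags, lifting) someI_ex)+

lemma sorting_eq:
  assumes "finite I" "inj_on g I" "\<sigma> permutes I" "strict_mono_on I (g \<circ> \<sigma>)"
  shows "sorting I g = \<sigma>"
  using sorting_permutation_unique[OF assms(2)] sorting[OF assms(1,2)] assms(3,4) by blast

section \<open>Pfaffians as sums over all permutations\<close>

text \<open>The Pfaffian of \<open>M\<close> is \<open>wick 0 l M C\<close> up to the factor \<open>2\<^sup>l l!\<close>, and so is the alternating sum over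
  shuffles of an \<open>N \<times> N\<close> minor of \<open>C\<close> times a complementary Pfaffian of \<open>M\<close> (lemmas
  \<open>pfaffian_wick\<close> and \<open>wick_shuffle\<close> below). Summing over all permutations, rather than over canonical
  ones, makes the behaviour under a renumbering of the rows and columns evident, and it treats the two
  constituents of \<open>f_tilde\<close> alike.\<close>

definition wick :: "nat \<Rightarrow> nat \<Rightarrow> (nat \<Rightarrow> nat \<Rightarrow> 'a::comm_ring_1) \<Rightarrow> (nat \<Rightarrow> nat \<Rightarrow> 'a) \<Rightarrow> 'a" where
  "wick N l M C = (\<Sum>p | p permutes {..<N + 2 * l}. of_int (sign p) *
     ((\<Prod>i<N. C i (p i)) * (\<Prod>k<l. M (p (N + 2 * k)) (p (N + 2 * k + 1)))))"

lemma permutes_sign_compose: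
  assumes "finite S" "p permutes S" "q permutes S"
  shows "sign (p \<circ> q) = sign p * sign q"
  using assms by (intro sign_compose permutes_imp_permutation)

text \<open>\<open>pair_lift \<sigma>\<close> permutes the pairs \<open>(2k, 2k + 1)\<close> of positions as \<open>\<sigma>\<close> permutes the \<open>k\<close>.\<close>

definition pair_lift :: "(nat \<Rightarrow> nat) \<Rightarrow> nat \<Rightarrow> nat" where
  "pair_lift \<sigma> x = 2 * \<sigma> (x div 2) + x mod 2"

lemma pair_lift_simps [simp]:
  "pair_lift \<sigma> (2 * k) = 2 * \<sigma> k" "pair_lift \<sigma> (Suc (2 * k)) = Suc (2 * \<sigma> k)"
  by (simp_all add: pair_lift_def)

lemma pair_lift_comp: "pair_lift (\<sigma> \<circ> \<tau>) = pair_lift \<sigma> \<circ> pair_lift \<tau>"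
  by (auto simp: pair_lift_def fun_eq_iff)

lemma pair_lift_id: "pair_lift id = id"
  by (auto simp: pair_lift_def fun_eq_iff)

lemma pair_lift_permutes:
  assumes "\<sigma> permutes {..<l}"
  shows "pair_lift \<sigma> permutes {..<2 * l}"
proof -
  have lr: "pair_lift \<sigma> (pair_lift (inv_into UNIV \<sigma>) x) = x" "pair_lift (inv_into UNIV \<sigma>) (pair_lift \<sigma> x) = x" for x
    using permutes_inverses[OF assms] by (auto simp: pair_lift_def)
  show ?thesis
    unfolding permutes_def
  proof (intro conjI allI impI)
    fix x assume "x \<notin> {..<2 * l}"
    then have "x div 2 \<notin> {..<l}" by auto
    then show "pair_lift \<sigma> x = x"
      using permutes_not_in[OF assms] by (simp add: pair_lift_def)
  next
    fix y show "\<exists>!x. pair_lift \<sigma> x = y"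
      using lr by metis
  qed
qed

lemma pair_lift_transpose:
  "a \<noteq> b \<Longrightarrow> pair_lift (transpose a b) =
     transpose (2 * a) (2 * b) \<circ> transpose (Suc (2 * a)) (Suc (2 * b))"
proof
  fix x :: nat assume "a \<noteq> b"
  have "x = 2 * (x div 2) \<or> x = Suc (2 * (x div 2))" by presburger
  then obtain k where "x = 2 * k \<or> x = Suc (2 * k)" by blast
  then show "pair_lift (transpose a b) x =
     (transpose (2 * a) (2 * b) \<circ> transpose (Suc (2 * a)) (Suc (2 * b))) x"
    using \<open>a \<noteq> b\<close> by (auto simp: transpose_def) presburger+
qed

lemma sign_pair_lift:
  assumes "\<sigma> permutes {..<l}"
  shows "sign (pair_lift \<sigma>) = 1"
  using assms finite_lessThan
proof (induction rule: permutes_induct)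
  case id
  then show ?case by (simp only: pair_lift_id sign_id)
next
  case (swap a b p)
  have "sign (pair_lift (transpose a b)) = 1"
    using swap by (simp add: pair_lift_transpose sign_compose permutation_swap_id sign_swap_id)
  moreover have "permutation (pair_lift (transpose a b))" "permutation (pair_lift p)"
    using swap permutes_imp_permutation[OF finite_lessThan pair_lift_permutes]
    by (blast intro: permutes_swap_id)+
  ultimately show ?case
    using swap.IH by (simp only: pair_lift_comp sign_compose)
qed

text \<open>Exchanging the two positions of a pair changes the sign of the permutation and of one entry of the
  skew matrix, and permuting whole pairs is an even permutation; so the summand is constant on the
  cosets of the group generated by both, which has order \<open>2\<^sup>l l!\<close>. The permutations that \<open>pfaffian\<close> sums
  over represent these cosets.\<close>

lemma pfaffian_wick:
  fixes A :: "nat \<Rightarrow> nat \<Rightarrow> 'a::{comm_ring_1, ring_char_0}"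
  assumes skew: "\<And>i j. A j i = - A i j"
  shows "2 ^ l * fact l * pfaffian (mat (2 * l) (2 * l) (\<lambda>(i, j). A i j)) = wick 0 l A C"
proof -
  let ?S = "{p. p permutes {..<2 * l}}"
  let ?U = "{p \<in> ?S. \<forall>k\<in>{..<l}. p (2 * k) < p (2 * k + 1)}"
  let ?K = "{p \<in> ?U. strict_mono_on {..<l} (\<lambda>k. p (2 * k))}"
  define t where "t p = of_int (sign p) * (\<Prod>k<l. A (p (2 * k)) (p (2 * k + 1)))" for p
  have finS: "finite ?S" by (simp add: finite_permutations)
  have "(\<Sum>p\<in>?S. t p) = 2 ^ card {..<l} * (\<Sum>p\<in>?U. t p)"
  proof (rule sum_halving[where \<tau> = "\<lambda>k p. p \<circ> transpose (2 * k) (2 * k + 1)"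
        and b = "\<lambda>k p. p (2 * k) < p (2 * k + 1)", OF finite_lessThan finS])
    fix k p assume k: "k \<in> {..<l}" and p: "p \<in> ?S"
    have tr: "transpose (2 * k) (2 * k + 1) permutes {..<2 * l}"
      using k by (intro permutes_swap_id) auto
    show "p \<circ> transpose (2 * k) (2 * k + 1) \<in> ?S"
      using p tr by (auto intro: permutes_compose)
    show "p \<circ> transpose (2 * k) (2 * k + 1) \<circ> transpose (2 * k) (2 * k + 1) = p"
      by (simp add: comp_assoc)
    have sg: "sign (p \<circ> transpose (2 * k) (2 * k + 1)) = - sign p"
      using p permutes_sign_compose[OF finite_lessThan _ tr] by (simp add: sign_swap_id)
    have other: "2 * j \<noteq> 2 * k + 1" "2 * j + 1 \<noteq> 2 * k" for j by presburger+
    have pr: "(\<Prod>j<l. A ((p \<circ> transpose (2 * k) (2 * k + 1)) (2 * j))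
              ((p \<circ> transpose (2 * k) (2 * k + 1)) (2 * j + 1))) =
          - (\<Prod>j<l. A (p (2 * j)) (p (2 * j + 1)))"
    proof -
      have "(\<Prod>j\<in>{..<l} - {k}. A ((p \<circ> transpose (2 * k) (2 * k + 1)) (2 * j))
              ((p \<circ> transpose (2 * k) (2 * k + 1)) (2 * j + 1))) =
          (\<Prod>j\<in>{..<l} - {k}. A (p (2 * j)) (p (2 * j + 1)))"
        using other by (intro prod.cong) (auto simp: transpose_def)
      then show ?thesis
        unfolding prod.remove[OF finite_lessThan k] using skew[of "p (2 * k + 1)" "p (2 * k)"] by simp
    qed
    show "t (p \<circ> transpose (2 * k) (2 * k + 1)) = t p"
      unfolding t_def sg pr by simp
    have "inj p" using p permutes_inj by blast
    then have "p (2 * k) \<noteq> p (2 * k + 1)" by (simp add: inj_eq)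
    then show "((p \<circ> transpose (2 * k) (2 * k + 1)) (2 * k) <
        (p \<circ> transpose (2 * k) (2 * k + 1)) (2 * k + 1)) = (\<not> p (2 * k) < p (2 * k + 1))"
      by auto
    fix j assume "j \<in> {..<l}" "k \<noteq> j"
    then show "((p \<circ> transpose (2 * k) (2 * k + 1)) (2 * j) <
        (p \<circ> transpose (2 * k) (2 * k + 1)) (2 * j + 1)) = (p (2 * j) < p (2 * j + 1))"
      using other by (simp add: transpose_def)
  qed
  also have "(\<Sum>p\<in>?U. t p) = (\<Sum>(c, \<sigma>)\<in>?K \<times> {\<sigma>. \<sigma> permutes {..<l}}. t c)"
  proof (rule sum.reindex_bij_witness[of _ "\<lambda>(c, \<sigma>). c \<circ> pair_lift \<sigma>"
        "\<lambda>p. (p \<circ> pair_lift (sorting {..<l} (\<lambda>k. p (2 * k))), inv_into UNIV (sorting {..<l} (\<lambda>k. p (2 * k))))"])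
    fix p assume p: "p \<in> ?U"
    define s where "s = sorting {..<l} (\<lambda>k. p (2 * k))"
    have "inj p" using p permutes_inj by blast
    then have inj: "inj_on (\<lambda>k. p (2 * k)) {..<l}" by (intro inj_onI) (simp add: inj_eq)
    have s: "s permutes {..<l}" "strict_mono_on {..<l} ((\<lambda>k. p (2 * k)) \<circ> s)"
      using sorting[OF finite_lessThan inj] by (simp_all add: s_def)
    show "(case (p \<circ> pair_lift (sorting {..<l} (\<lambda>k. p (2 * k))),
        inv_into UNIV (sorting {..<l} (\<lambda>k. p (2 * k)))) of (c, \<sigma>) \<Rightarrow> c \<circ> pair_lift \<sigma>) = p"
      unfolding s_def[symmetric] using permutes_inv_o[OF s(1)]
      by (simp add: comp_assoc pair_lift_comp[symmetric] pair_lift_id)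
    have K: "p \<circ> pair_lift s \<in> ?K"
      using p s permutes_compose[OF pair_lift_permutes[OF s(1)]] permutes_in_image[OF s(1)]
      by (auto simp: comp_def)
    then show "(p \<circ> pair_lift (sorting {..<l} (\<lambda>k. p (2 * k))), inv_into UNIV (sorting {..<l} (\<lambda>k. p (2 * k)))) \<in>
        ?K \<times> {\<sigma>. \<sigma> permutes {..<l}}"
      unfolding s_def[symmetric] using permutes_inv[OF s(1)] by blast
    have "t (p \<circ> pair_lift s) = t p"
      using p permutes_sign_compose[OF finite_lessThan _ pair_lift_permutes[OF s(1)], of p]
        prod.permute[OF s(1), of "\<lambda>k. A (p (2 * k)) (p (2 * k + 1))"]
      by (simp add: t_def sign_pair_lift[OF s(1)] comp_def)
    then show "(case (p \<circ> pair_lift (sorting {..<l} (\<lambda>k. p (2 * k))),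
        inv_into UNIV (sorting {..<l} (\<lambda>k. p (2 * k)))) of (c, \<sigma>) \<Rightarrow> t c) = t p"
      unfolding s_def[symmetric] by simp
  next
    fix x assume "x \<in> ?K \<times> {\<sigma>. \<sigma> permutes {..<l}}"
    then obtain c \<sigma> where x: "x = (c, \<sigma>)" "c \<in> ?K" "\<sigma> permutes {..<l}" by blast
    have "c \<circ> pair_lift \<sigma> \<in> ?U"
      using x permutes_compose[OF pair_lift_permutes[OF x(3)]] permutes_in_image[OF x(3)]
      by (auto simp: comp_def)
    then show "(case x of (c, \<sigma>) \<Rightarrow> c \<circ> pair_lift \<sigma>) \<in> ?U" by (simp add: x)
    then have "inj (c \<circ> pair_lift \<sigma>)" using permutes_inj x by auto
    then have inj: "inj_on (\<lambda>k. (c \<circ> pair_lift \<sigma>) (2 * k)) {..<l}"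
      by (intro inj_onI) (metis (no_types, lifting) injD mult_cancel1 zero_neq_numeral)
    have "sorting {..<l} (\<lambda>k. (c \<circ> pair_lift \<sigma>) (2 * k)) = inv_into UNIV \<sigma>"
    proof (rule sorting_eq[OF finite_lessThan inj permutes_inv[OF x(3)]])
      have "(\<lambda>k. (c \<circ> pair_lift \<sigma>) (2 * k)) \<circ> inv_into UNIV \<sigma> = (\<lambda>k. c (2 * k))"
        using permutes_inverses[OF x(3)] by (auto simp: fun_eq_iff)
      then show "strict_mono_on {..<l} ((\<lambda>k. (c \<circ> pair_lift \<sigma>) (2 * k)) \<circ> inv_into UNIV \<sigma>)"
        using x by simp
    qed
    then show "(\<lambda>p. (p \<circ> pair_lift (sorting {..<l} (\<lambda>k. p (2 * k))), inv_into UNIV (sorting {..<l} (\<lambda>k. p (2 * k)))))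
        (case x of (c, \<sigma>) \<Rightarrow> c \<circ> pair_lift \<sigma>) = x"
      using permutes_inv_o[OF x(3)] permutes_inv_inv[OF x(3)]
      by (simp add: x(1) comp_assoc pair_lift_comp[symmetric] pair_lift_id)
  qed
  also have "\<dots> = fact l * (\<Sum>p\<in>?K. t p)"
    by (subst sum.cartesian_product[symmetric])
      (simp add: card_permutations[OF refl finite_lessThan] sum_distrib_left)
  also have "(\<Sum>p\<in>?K. t p) = pfaffian (mat (2 * l) (2 * l) (\<lambda>(i, j). A i j))"
    unfolding pfaffian_def Let_def t_def
  proof (rule sum.cong)
    show "?K = {p. p permutes {..<2 * (dim_row (mat (2 * l) (2 * l) (\<lambda>(i, j). A i j)) div 2)} \<and>
          (\<forall>k<dim_row (mat (2 * l) (2 * l) (\<lambda>(i, j). A i j)) div 2. p (2 * k) < p (2 * k + 1)) \<and>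
          strict_mono_on {..<dim_row (mat (2 * l) (2 * l) (\<lambda>(i, j). A i j)) div 2} (\<lambda>k. p (2 * k))}"
      by auto
    fix p assume "p \<in> {p. p permutes {..<2 * (dim_row (mat (2 * l) (2 * l) (\<lambda>(i, j). A i j)) div 2)} \<and>
          (\<forall>k<dim_row (mat (2 * l) (2 * l) (\<lambda>(i, j). A i j)) div 2. p (2 * k) < p (2 * k + 1)) \<and>
          strict_mono_on {..<dim_row (mat (2 * l) (2 * l) (\<lambda>(i, j). A i j)) div 2} (\<lambda>k. p (2 * k))}"
    then have p: "p permutes {..<2 * l}" by simp
    have "p (2 * k) < 2 * l" "p (2 * k + 1) < 2 * l" if "k < l" for k
      using permutes_in_image[OF p, of "2 * k"] permutes_in_image[OF p, of "2 * k + 1"] that by auto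
    then show "of_int (sign p) * (\<Prod>k<l. A (p (2 * k)) (p (2 * k + 1))) = of_int (sign p) *
         (\<Prod>k<dim_row (mat (2 * l) (2 * l) (\<lambda>(i, j). A i j)) div 2.
             mat (2 * l) (2 * l) (\<lambda>(i, j). A i j) $$ (p (2 * k), p (2 * k + 1)))"
      by simp
  qed
  finally show ?thesis
    by (simp add: wick_def t_def algebra_simps)
qed

text \<open>Each permutation is uniquely \<open>p \<circ> \<sigma> \<circ> q\<close> with a shuffle \<open>p\<close>, a permutation \<open>\<sigma>\<close> of the positions below \<open>N\<close>
  and a permutation \<open>q\<close> of the others. Summing over \<open>\<sigma>\<close> gives the determinant, summing over \<open>q\<close> the
  Pfaffian.\<close>

lemma wick_shuffle:
  fixes A C :: "nat \<Rightarrow> nat \<Rightarrow> 'a::{comm_ring_1, ring_char_0}"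
  assumes skew: "\<And>i j. A j i = - A i j"
  shows "2 ^ l * fact l * (\<Sum>p | p permutes {..<N + 2 * l} \<and> strict_mono_on {..<N} p \<and>
        strict_mono_on {N..<N + 2 * l} p.
      of_int (sign p) * Determinant.det (mat N N (\<lambda>(r, c). C r (p c))) *
      pfaffian (mat (2 * l) (2 * l) (\<lambda>(i, j). A (p (N + i)) (p (N + j))))) = wick N l A C"
proof -
  define m where "m = N + 2 * l"
  let ?S = "{p. p permutes {..<m}}"
  let ?K = "{p. p permutes {..<m} \<and> strict_mono_on {..<N} p \<and> strict_mono_on {N..<m} p}"
  let ?D = "{\<sigma>. \<sigma> permutes {..<N}}" and ?Q = "{q. q permutes {N..<m}}"
  define t where "t p = of_int (sign p) *
     ((\<Prod>i<N. C i (p i)) * (\<Prod>k<l. A (p (N + 2 * k)) (p (N + 2 * k + 1))))" for p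
  have subN: "\<sigma> permutes {..<m}" if "\<sigma> permutes {..<N}" for \<sigma>
    using that by (rule permutes_subset) (auto simp: m_def)
  have subQ: "q permutes {..<m}" if "q permutes {N..<m}" for q
    using that by (rule permutes_subset) auto
  have split1: "(p \<circ> \<sigma> \<circ> q) i = p (\<sigma> i)"
    if "\<sigma> permutes {..<N}" "q permutes {N..<m}" "i < N" for p :: "nat \<Rightarrow> nat" and \<sigma> q i
    using that permutes_not_in[OF that(2), of i] by simp
  have split2: "(p \<circ> \<sigma> \<circ> q) j = p (q j)"
    if "\<sigma> permutes {..<N}" "q permutes {N..<m}" "N \<le> j" for p :: "nat \<Rightarrow> nat" and \<sigma> q j
  proof -
    have "q j \<ge> N"
      using that permutes_in_image[OF that(2), of j] permutes_not_in[OF that(2), of j]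
      by (cases "j < m") auto
    then show ?thesis
      using permutes_not_in[OF that(1), of "q j"] by simp
  qed
  have pf: "2 ^ l * fact l * pfaffian (mat (2 * l) (2 * l) (\<lambda>(i, j). A (p (N + i)) (p (N + j)))) =
     (\<Sum>q\<in>?Q. of_int (sign q) * (\<Prod>k<l. A (p (q (N + 2 * k))) (p (q (N + 2 * k + 1)))))" for p
  proof -
    have "2 ^ l * fact l * pfaffian (mat (2 * l) (2 * l) (\<lambda>(i, j). A (p (N + i)) (p (N + j)))) =
        wick 0 l (\<lambda>i j. A (p (N + i)) (p (N + j))) C"
      by (rule pfaffian_wick) (rule skew)
    also have "\<dots> = (\<Sum>q | q permutes {..<2 * l}. of_int (sign q) *
        (\<Prod>k<l. A (p (N + q (2 * k))) (p (N + q (2 * k + 1)))))"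
      by (simp add: wick_def)
    also have "\<dots> = (\<Sum>q\<in>?Q. of_int (sign q) * (\<Prod>k<l. A (p (q (N + 2 * k))) (p (q (N + 2 * k + 1)))))"
    proof (rule sum.reindex_bij_witness[of _ "map_permutation {N..<m} (\<lambda>x. x - N)"
          "map_permutation {..<2 * l} ((+) N)"])
      have bij: "bij_betw ((+) N) {..<2 * l} {N..<m}"
        by (rule bij_betwI[where g = "\<lambda>x. x - N"]) (auto simp: m_def)
      fix q assume "q \<in> {q. q permutes {..<2 * l}}"
      then have q: "q permutes {..<2 * l}" by simp
      show "map_permutation {N..<m} (\<lambda>x. x - N) (map_permutation {..<2 * l} ((+) N) q) = q"
        by (rule map_permutation_compose_inv[OF bij q]) simp
      show "map_permutation {..<2 * l} ((+) N) q \<in> ?Q"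
        using map_permutation_permutes[OF bij q] by simp
      have app: "map_permutation {..<2 * l} ((+) N) q (N + x) = N + q x" if "x < 2 * l" for x
        using map_permutation_apply[of "(+) N" "{..<2 * l}" x q] that by simp
      have "(\<Prod>k<l. A (p (map_permutation {..<2 * l} ((+) N) q (N + 2 * k)))
                (p (map_permutation {..<2 * l} ((+) N) q (N + 2 * k + 1)))) =
            (\<Prod>k<l. A (p (N + q (2 * k))) (p (N + q (2 * k + 1))))"
        using app[of "2 * k" for k] app[of "2 * k + 1" for k] by (intro prod.cong) auto
      then show "of_int (sign (map_permutation {..<2 * l} ((+) N) q)) *
             (\<Prod>k<l. A (p (map_permutation {..<2 * l} ((+) N) q (N + 2 * k)))
                (p (map_permutation {..<2 * l} ((+) N) q (N + 2 * k + 1)))) =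
            of_int (sign q) * (\<Prod>k<l. A (p (N + q (2 * k))) (p (N + q (2 * k + 1))))"
        using sign_map_permutation[of "(+) N" "{..<2 * l}" q] q by simp
    next
      have bij': "bij_betw (\<lambda>x. x - N) {N..<m} {..<2 * l}"
        by (rule bij_betwI[where g = "\<lambda>x. N + x"]) (auto simp: m_def)
      fix q assume "q \<in> ?Q"
      then have q: "q permutes {N..<m}" by simp
      show "map_permutation {..<2 * l} ((+) N) (map_permutation {N..<m} (\<lambda>x. x - N) q) = q"
        by (rule map_permutation_compose_inv[OF bij' q]) simp
      show "map_permutation {N..<m} (\<lambda>x. x - N) q \<in> {q. q permutes {..<2 * l}}"
        using map_permutation_permutes[OF bij' q] by simp
    qed
    finally show ?thesis .
  qed
  have "2 ^ l * fact l * (\<Sum>p\<in>?K. of_int (sign p) * Determinant.det (mat N N (\<lambda>(r, c). C r (p c))) *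
      pfaffian (mat (2 * l) (2 * l) (\<lambda>(i, j). A (p (N + i)) (p (N + j))))) =
    (\<Sum>p\<in>?K. of_int (sign p) * Determinant.det (mat N N (\<lambda>(r, c). C r (p c))) *
      (2 ^ l * fact l * pfaffian (mat (2 * l) (2 * l) (\<lambda>(i, j). A (p (N + i)) (p (N + j))))))"
    by (simp add: sum_distrib_left algebra_simps)
  also have "\<dots> = (\<Sum>p\<in>?K. \<Sum>\<sigma>\<in>?D. \<Sum>q\<in>?Q. t (p \<circ> \<sigma> \<circ> q))"
  proof (rule sum.cong[OF refl])
    fix p assume "p \<in> ?K"
    then have p: "p permutes {..<m}" by simp
    have "Determinant.det (mat N N (\<lambda>(r, c). C r (p c))) =
        (\<Sum>\<sigma>\<in>?D. of_int (sign \<sigma>) * (\<Prod>i<N. C i (p (\<sigma> i))))"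
      unfolding Determinant.det_def
      by (simp add: atLeast0LessThan permutes_in_image[unfolded lessThan_iff])
    moreover have "t (p \<circ> \<sigma> \<circ> q) = of_int (sign p) * (of_int (sign \<sigma>) * (\<Prod>i<N. C i (p (\<sigma> i)))) *
          (of_int (sign q) * (\<Prod>k<l. A (p (q (N + 2 * k))) (p (q (N + 2 * k + 1)))))"
      if "\<sigma> \<in> ?D" "q \<in> ?Q" for \<sigma> q
    proof -
      have \<sigma>: "\<sigma> permutes {..<N}" and q: "q permutes {N..<m}" using that by auto
      have "sign (p \<circ> \<sigma> \<circ> q) = sign p * sign \<sigma> * sign q"
        using p subN[OF \<sigma>] subQ[OF q] permutes_compose[OF subN[OF \<sigma>] p]
        by (simp only: permutes_sign_compose[OF finite_lessThan[of m]])
      then show ?thesis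
        unfolding t_def using split1[OF \<sigma> q] split2[OF \<sigma> q]
        by (simp add: mult_ac del: comp_apply)
    qed
    ultimately show "of_int (sign p) * Determinant.det (mat N N (\<lambda>(r, c). C r (p c))) *
      (2 ^ l * fact l * pfaffian (mat (2 * l) (2 * l) (\<lambda>(i, j). A (p (N + i)) (p (N + j))))) =
      (\<Sum>\<sigma>\<in>?D. \<Sum>q\<in>?Q. t (p \<circ> \<sigma> \<circ> q))"
      unfolding pf by (simp add: sum_distrib_left sum_distrib_right mult.assoc sum.swap[of _ ?Q ?D])
  qed
  also have "\<dots> = (\<Sum>(p, \<sigma>, q)\<in>?K \<times> ?D \<times> ?Q. t (p \<circ> \<sigma> \<circ> q))"
    by (simp add: sum.cartesian_product)
  also have "\<dots> = (\<Sum>r\<in>?S. t r)"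
  proof (rule sum.reindex_bij_witness[of _ "\<lambda>r. let s = sorting {..<N} r; s' = sorting {N..<m} r in
        (r \<circ> s \<circ> s', inv_into UNIV s, inv_into UNIV s')" "\<lambda>(p, \<sigma>, q). p \<circ> \<sigma> \<circ> q"])
    fix r assume "r \<in> ?S"
    then have r: "r permutes {..<m}" by simp
    have inj: "inj_on r I" for I using permutes_inj[OF r] by (auto simp: inj_on_def)
    define s where "s = sorting {..<N} r"
    define s' where "s' = sorting {N..<m} r"
    have s: "s permutes {..<N}" "strict_mono_on {..<N} (r \<circ> s)"
      using sorting[OF finite_lessThan inj] by (simp_all add: s_def)
    have s': "s' permutes {N..<m}" "strict_mono_on {N..<m} (r \<circ> s')"
      using sorting[OF finite_atLeastLessThan inj] by (simp_all add: s'_def)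
    have "strict_mono_on {..<N} (r \<circ> s \<circ> s')" "strict_mono_on {N..<m} (r \<circ> s \<circ> s')"
      using s(2) s'(2) split1[OF s(1) s'(1), of _ r] split2[OF s(1) s'(1), of _ r]
      by (auto simp: strict_mono_on_def)
    moreover have "r \<circ> s \<circ> s' permutes {..<m}"
      by (intro permutes_compose r subN s subQ s')
    ultimately show "(let s = sorting {..<N} r; s' = sorting {N..<m} r in
        (r \<circ> s \<circ> s', inv_into UNIV s, inv_into UNIV s')) \<in> ?K \<times> ?D \<times> ?Q"
      unfolding s_def[symmetric] s'_def[symmetric] Let_def
      using permutes_inv[OF s(1)] permutes_inv[OF s'(1)] by simp
    have "(r \<circ> s \<circ> s') \<circ> inv_into UNIV s \<circ> inv_into UNIV s' = r"
    proof
      fix x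
      have iv: "inv_into UNIV s permutes {..<N}" "inv_into UNIV s' permutes {N..<m}"
        using permutes_inv[OF s(1)] permutes_inv[OF s'(1)] by auto
      show "((r \<circ> s \<circ> s') \<circ> inv_into UNIV s \<circ> inv_into UNIV s') x = r x"
      proof (cases "x < N")
        case True
        have "inv_into UNIV s x < N" using permutes_in_image[OF iv(1), of x] True by simp
        then show ?thesis
          using split1[OF iv True, of "r \<circ> s \<circ> s'"] split1[OF s(1) s'(1), of _ r]
            permutes_inverses[OF s(1)] by simp
      next
        case False
        then have "N \<le> inv_into UNIV s' x"
          using permutes_in_image[OF iv(2), of x] permutes_not_in[OF iv(2), of x] by (cases "x < m") auto
        then have a: "s (s' (inv_into UNIV s' x)) = s x" "inv_into UNIV s (inv_into UNIV s' x) = inv_into UNIV s' x"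
          using permutes_inverses[OF s'(1)] permutes_not_in[OF iv(1), of "inv_into UNIV s' x"] by auto
        have "s x = x" using permutes_not_in[OF s(1), of x] False by simp
        then show ?thesis using a by simp
      qed
    qed
    then show "(case (let s = sorting {..<N} r; s' = sorting {N..<m} r in
        (r \<circ> s \<circ> s', inv_into UNIV s, inv_into UNIV s')) of (p, \<sigma>, q) \<Rightarrow> p \<circ> \<sigma> \<circ> q) = r"
      unfolding s_def[symmetric] s'_def[symmetric] Let_def by simp
  next
    fix x assume "x \<in> ?K \<times> ?D \<times> ?Q"
    then obtain p \<sigma> q where x: "x = (p, \<sigma>, q)" "p \<in> ?K" "\<sigma> permutes {..<N}" "q permutes {N..<m}" by auto
    define r where "r = p \<circ> \<sigma> \<circ> q"
    have r: "r permutes {..<m}"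
      unfolding r_def using x permutes_compose[OF subQ permutes_compose[OF subN]]
      by (simp add: comp_assoc)
    then show "(case x of (p, \<sigma>, q) \<Rightarrow> p \<circ> \<sigma> \<circ> q) \<in> ?S" by (simp add: x r_def)
    have inj: "inj_on r I" for I using permutes_inj[OF r] by (auto simp: inj_on_def)
    have iv: "inv_into UNIV \<sigma> permutes {..<N}" "inv_into UNIV q permutes {N..<m}"
      using permutes_inv x by auto
    have "sorting {..<N} r = inv_into UNIV \<sigma>"
    proof (rule sorting_eq[OF finite_lessThan inj iv(1)])
      have "(r \<circ> inv_into UNIV \<sigma>) i = p i" if "i < N" for i
        using split1[OF x(3,4), of "inv_into UNIV \<sigma> i" p] that permutes_in_image[OF iv(1), of i]
          permutes_inverses[OF x(3)] by (simp add: r_def)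
      then show "strict_mono_on {..<N} (r \<circ> inv_into UNIV \<sigma>)"
        using x(2) by (auto simp: strict_mono_on_def simp del: comp_apply)
    qed
    moreover have "sorting {N..<m} r = inv_into UNIV q"
    proof (rule sorting_eq[OF finite_atLeastLessThan inj iv(2)])
      have "(r \<circ> inv_into UNIV q) i = p i" if "N \<le> i" "i < m" for i
        using permutes_not_in[OF x(3), of i] that permutes_inverses[OF x(4)] by (simp add: r_def)
      then show "strict_mono_on {N..<m} (r \<circ> inv_into UNIV q)"
        using x(2) by (auto simp: strict_mono_on_def simp del: comp_apply)
    qed
    moreover have "r \<circ> inv_into UNIV \<sigma> \<circ> inv_into UNIV q = p"
    proof
      fix i show "(r \<circ> inv_into UNIV \<sigma> \<circ> inv_into UNIV q) i = p i"
      proof (cases "i < N")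
        case True
        then have "inv_into UNIV q i = i" "inv_into UNIV \<sigma> i < N"
          using permutes_not_in[OF iv(2), of i] permutes_in_image[OF iv(1), of i] by auto
        then show ?thesis
          using split1[OF x(3,4), of "inv_into UNIV \<sigma> i" p] permutes_inverses[OF x(3)]
          by (simp add: r_def)
      next
        case False
        then have "N \<le> inv_into UNIV q i"
          using permutes_in_image[OF iv(2), of i] permutes_not_in[OF iv(2), of i] by (cases "i < m") auto
        then have "inv_into UNIV \<sigma> (inv_into UNIV q i) = inv_into UNIV q i"
          using permutes_not_in[OF iv(1), of "inv_into UNIV q i"] by auto
        then show ?thesis
          using permutes_inverses[OF x(4)] permutes_not_in[OF x(3), of i] False by (simp add: r_def)
      qed
    qed
    ultimately show "(let s = sorting {..<N} (case x of (p, \<sigma>, q) \<Rightarrow> p \<circ> \<sigma> \<circ> q);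
          s' = sorting {N..<m} (case x of (p, \<sigma>, q) \<Rightarrow> p \<circ> \<sigma> \<circ> q) in
        ((case x of (p, \<sigma>, q) \<Rightarrow> p \<circ> \<sigma> \<circ> q) \<circ> s \<circ> s', inv_into UNIV s, inv_into UNIV s')) = x"
      using permutes_inv_inv[OF x(3)] permutes_inv_inv[OF x(4)]
      by (simp add: x(1) r_def Let_def)
    show "t (case x of (p, \<sigma>, q) \<Rightarrow> p \<circ> \<sigma> \<circ> q) = (case x of (p, \<sigma>, q) \<Rightarrow> t (p \<circ> \<sigma> \<circ> q))"
      by (simp add: x)
  qed
  finally show ?thesis by (simp add: wick_def t_def m_def)
qed

lemma wick_cong:
  assumes "\<And>a b. a < N + 2 * l \<Longrightarrow> b < N + 2 * l \<Longrightarrow> M a b = M' a b"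
    and "\<And>i a. i < N \<Longrightarrow> a < N + 2 * l \<Longrightarrow> C i a = C' i a"
  shows "wick N l M C = wick N l M' C'"
  unfolding wick_def
proof (intro sum.cong refl arg_cong2[where f = "(*)"] prod.cong)
  fix p i assume p: "p \<in> {p. p permutes {..<N + 2 * l}}"
  have in_range: "p x < N + 2 * l" if "x < N + 2 * l" for x
    using p permutes_in_image[of p "{..<N + 2 * l}" x] that by simp
  show "i \<in> {..<N} \<Longrightarrow> C i (p i) = C' i (p i)"
    using assms(2) in_range by simp
  show "i \<in> {..<l} \<Longrightarrow> M (p (N + 2 * i)) (p (N + 2 * i + 1)) = M' (p (N + 2 * i)) (p (N + 2 * i + 1))"
    using assms(1) in_range by simp
qed

lemma wick_permute:
  assumes "\<rho> permutes {..<N + 2 * l}"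
  shows "wick N l (\<lambda>a b. M (\<rho> a) (\<rho> b)) (\<lambda>i a. C i (\<rho> a)) = of_int (sign \<rho>) * wick N l M C"
proof -
  have "wick N l M C = (\<Sum>p | p permutes {..<N + 2 * l}. of_int (sign (\<rho> \<circ> p)) *
     ((\<Prod>i<N. C i (\<rho> (p i))) * (\<Prod>k<l. M (\<rho> (p (N + 2 * k))) (\<rho> (p (N + 2 * k + 1))))))"
    unfolding wick_def by (subst setum_permutations_compose_left[OF assms]) simp
  also have "\<dots> = of_int (sign \<rho>) * wick N l (\<lambda>a b. M (\<rho> a) (\<rho> b)) (\<lambda>i a. C i (\<rho> a))"
    unfolding wick_def sum_distrib_left
    using permutes_sign_compose[OF finite_lessThan assms] by (intro sum.cong) (auto simp: mult_ac)
  finally show ?thesis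
    by (simp add: mult.assoc[symmetric] of_int_mult[symmetric] del: of_int_mult)
qed

text \<open>The perturbation \<open>d\<close> of \<open>wick_perturb\<close> is nonzero at one pair of positions at most.\<close>

lemma prod_add_sparse:
  fixes a d :: "'k \<Rightarrow> 'a::comm_ring_1"
  assumes "finite K" and "\<And>k k'. k \<in> K \<Longrightarrow> k' \<in> K \<Longrightarrow> k \<noteq> k' \<Longrightarrow> d k * d k' = 0"
  shows "(\<Prod>k\<in>K. a k + d k) = (\<Prod>k\<in>K. a k) + (\<Sum>k\<in>K. d k * (\<Prod>k'\<in>K - {k}. a k'))"
  using assms
proof (induction K rule: finite_induct)
  case empty
  then show ?case by simp
next
  case (insert x K)
  have IH: "(\<Prod>k\<in>K. a k + d k) = (\<Prod>k\<in>K. a k) + (\<Sum>k\<in>K. d k * (\<Prod>k'\<in>K - {k}. a k'))"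
    using insert by auto
  have z: "d x * (\<Sum>k\<in>K. d k * (\<Prod>k'\<in>K - {k}. a k')) = 0"
    unfolding sum_distrib_left mult.assoc[symmetric]
    using insert by (intro sum.neutral) (metis insert_iff mult_zero_left)
  have "(\<Sum>k\<in>K. d k * (\<Prod>k'\<in>insert x K - {k}. a k')) =
      a x * (\<Sum>k\<in>K. d k * (\<Prod>k'\<in>K - {k}. a k'))"
    unfolding sum_distrib_left
  proof (rule sum.cong[OF refl])
    fix k assume "k \<in> K"
    then have "insert x K - {k} = insert x (K - {k})" using insert.hyps by auto
    then show "d k * (\<Prod>k'\<in>insert x K - {k}. a k') = a x * (d k * (\<Prod>k'\<in>K - {k}. a k'))"
      using insert.hyps by (simp add: mult_ac)
  qed
  moreover have "insert x K - {x} = K" using insert.hyps by auto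
  ultimately show ?case
    using insert.hyps IH z by (simp add: algebra_simps)
qed

text \<open>Adding \<open>\<beta>\<close> and \<open>- \<beta>\<close> to the entries of \<open>M\<close> at the last two indices affects the terms where some pair of positions
  is mapped to the last two indices. There are \<open>l + 1\<close> such pairs with two orientations each, and the
  remaining positions then contribute the sum for the matrix without its last two rows and columns.\<close>

lemma wick_perturb:
  fixes \<beta> :: "'a::comm_ring_1"
  defines "E \<equiv> \<lambda>N l a b. if a = N + 2 * l \<and> b = N + 2 * l + 1 then 1
      else if a = N + 2 * l + 1 \<and> b = N + 2 * l then - 1 else (0::'a)"
  shows "wick N (Suc l) (\<lambda>a b. M a b + \<beta> * E N l a b) C =
    wick N (Suc l) M C + 2 * of_nat (Suc l) * \<beta> * wick N l M C"
proof -
  let ?m = "N + 2 * Suc l" and ?i = "N + 2 * l" and ?j = "N + 2 * l + 1"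
  let ?S = "{p. p permutes {..<?m}}" and ?T = "{p. p permutes {..<N + 2 * l}}"
  define c where "c p = of_int (sign p) * (\<Prod>i<N. C i (p i))" for p
  define M1 where "M1 p k = M (p (N + 2 * k)) (p (N + 2 * k + 1))" for p k
  define d where "d p k = \<beta> * E N l (p (N + 2 * k)) (p (N + 2 * k + 1))" for p k
  define h where "h k p = c p * (d p k * (\<Prod>k'\<in>{..<Suc l} - {k}. M1 p k'))" for k p
  have W: "wick N l M C = (\<Sum>p\<in>?T. c p * (\<Prod>k<l. M1 p k))"
    "wick N (Suc l) M C = (\<Sum>p\<in>?S. c p * (\<Prod>k<Suc l. M1 p k))"
    by (simp_all add: wick_def c_def M1_def mult.assoc)
  have "wick N (Suc l) (\<lambda>a b. M a b + \<beta> * E N l a b) C =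
      (\<Sum>p\<in>?S. c p * (\<Prod>k<Suc l. M1 p k + d p k))"
    by (simp only: wick_def c_def M1_def d_def mult.assoc)
  also have "\<dots> = (\<Sum>p\<in>?S. c p * (\<Prod>k<Suc l. M1 p k) + (\<Sum>k<Suc l. h k p))"
  proof (rule sum.cong[OF refl])
    fix p assume "p \<in> ?S"
    then have inj: "inj p" using permutes_inj by blast
    have "d p k * d p k' = 0" if "k \<noteq> k'" for k k'
    proof (rule ccontr)
      assume "\<not> ?thesis"
      then have "E N l (p (N + 2 * k)) (p (N + 2 * k + 1)) \<noteq> 0"
          "E N l (p (N + 2 * k')) (p (N + 2 * k' + 1)) \<noteq> 0"
        by (auto simp: d_def)
      then have "p (N + 2 * k) = p (N + 2 * k') \<or> p (N + 2 * k) = p (N + 2 * k' + 1)"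
        unfolding E_def by (auto split: if_splits)
      then show False using inj that by (auto simp: inj_eq)
    qed
    then show "c p * (\<Prod>k<Suc l. M1 p k + d p k) = c p * (\<Prod>k<Suc l. M1 p k) + (\<Sum>k<Suc l. h k p)"
      by (subst prod_add_sparse) (simp_all add: h_def sum_distrib_left algebra_simps del: sum.lessThan_Suc prod.lessThan_Suc)
  qed
  also have "\<dots> = wick N (Suc l) M C + (\<Sum>k<Suc l. \<Sum>p\<in>?S. h k p)"
    unfolding W sum.distrib by (subst (2) sum.swap) simp
  also have "(\<Sum>k<Suc l. \<Sum>p\<in>?S. h k p) = (\<Sum>k<Suc l. \<Sum>p\<in>?S. h l p)"
  proof (rule sum.cong[OF refl])
    fix k assume k: "k \<in> {..<Suc l}"
    show "(\<Sum>p\<in>?S. h k p) = (\<Sum>p\<in>?S. h l p)"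
    proof (cases "k = l")
      case False
      \<comment> \<open>exchanging the \<open>k\<close>-th and the last pair of positions is an even permutation\<close>
      define g where "g = transpose (N + 2 * k) (N + 2 * l) \<circ> transpose (N + 2 * k + 1) (N + 2 * l + 1)"
      have tp: "transpose (N + 2 * k) (N + 2 * l) permutes {..<?m}"
        "transpose (N + 2 * k + 1) (N + 2 * l + 1) permutes {..<?m}"
        using k by (intro permutes_swap_id; simp)+
      have g: "g permutes {..<?m}"
        unfolding g_def by (rule permutes_compose[OF tp(2,1)])
      have sg: "sign g = 1"
        unfolding g_def permutes_sign_compose[OF finite_lessThan tp] using False by (simp add: sign_swap_id)
      define \<tau> where "\<tau> = transpose k l"
      have gv: "g (N + 2 * k') = N + 2 * \<tau> k'" "g (N + 2 * k' + 1) = N + 2 * \<tau> k' + 1" for k'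
        using False unfolding g_def \<tau>_def by (auto simp: transpose_def)
      have gs: "g i = i" if "i < N" for i using that by (auto simp: g_def transpose_def)
      have "(\<Sum>p\<in>?S. h k p) = (\<Sum>p\<in>?S. h k (p \<circ> g))"
        by (rule sum_permutations_compose_right[OF g])
      also have "\<dots> = (\<Sum>p\<in>?S. h l p)"
      proof (rule sum.cong[OF refl])
        fix p assume "p \<in> ?S"
        then have "sign (p \<circ> g) = sign p"
          using permutes_sign_compose[OF finite_lessThan _ g] sg by simp
        then have "c (p \<circ> g) = c p" using gs by (simp add: c_def)
        moreover have "d (p \<circ> g) k = d p l"
          using gv by (simp add: d_def \<tau>_def)
        moreover have "(\<Prod>k'\<in>{..<Suc l} - {k}. M1 (p \<circ> g) k') = (\<Prod>k'\<in>{..<Suc l} - {l}. M1 p k')"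
          by (rule prod.reindex_bij_witness[of _ \<tau> \<tau>])
            (use k gv in \<open>auto simp: M1_def \<tau>_def transpose_def split: if_splits\<close>)
        ultimately show "h k (p \<circ> g) = h l p" by (simp add: h_def)
      qed
      finally show ?thesis .
    qed simp
  qed
  also have "\<dots> = of_nat (Suc l) * (\<Sum>p\<in>?S. h l p)" by simp
  also have "(\<Sum>p\<in>?S. h l p) = 2 * (\<beta> * wick N l M C)"
  proof -
    let ?\<tau> = "transpose ?i ?j"
    have fix1: "p ?i = ?i" "p ?j = ?j" if "p \<in> ?T" for p
      using that permutes_not_in[of p] by auto
    have TS: "?T \<subseteq> ?S" using permutes_subset[of _ "{..<N + 2 * l}" "{..<?m}"] by auto
    have tau: "?\<tau> permutes {..<?m}" by (rule permutes_swap_id) auto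
    have TS2: "(\<lambda>p. p \<circ> ?\<tau>) ` ?T \<subseteq> ?S" using TS permutes_compose[OF tau] by auto
    have disj: "?T \<inter> (\<lambda>p. p \<circ> ?\<tau>) ` ?T = {}"
    proof -
      have "p \<circ> ?\<tau> \<notin> ?T" if "p \<in> ?T" for p
        using fix1(1)[of "p \<circ> ?\<tau>"] fix1(2)[OF that] by auto
      then show ?thesis by blast
    qed
    have zero: "h l p = 0" if p: "p \<in> ?S - (?T \<union> (\<lambda>p. p \<circ> ?\<tau>) ` ?T)" for p
    proof (rule ccontr)
      assume "h l p \<noteq> 0"
      then have "E N l (p ?i) (p ?j) \<noteq> 0" by (auto simp: h_def d_def)
      then have cs: "p ?i = ?i \<and> p ?j = ?j \<or> p ?i = ?j \<and> p ?j = ?i"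
        unfolding E_def by (auto split: if_splits)
      have inT: "q \<in> ?T" if "q permutes {..<?m}" "q ?i = ?i" "q ?j = ?j" for q
      proof -
        have "q permutes {..<N + 2 * l}"
          using that(1) by (rule permutes_superset) (use that in \<open>auto simp: less_Suc_eq\<close>)
        then show ?thesis by simp
      qed
      from cs show False
      proof
        assume "p ?i = ?i \<and> p ?j = ?j" then show False using inT p by blast
      next
        assume a: "p ?i = ?j \<and> p ?j = ?i"
        have "p \<circ> ?\<tau> \<in> ?T"
          by (rule inT) (use a p permutes_compose[OF tau] in auto)
        moreover have "p = (p \<circ> ?\<tau>) \<circ> ?\<tau>" by (simp add: comp_assoc)
        ultimately show False using p by (metis (no_types, lifting) DiffD2 UnI2 imageI)
      qed
    qed
    have hT: "h l p = \<beta> * (c p * (\<Prod>k<l. M1 p k))" if "p \<in> ?T" for p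
    proof -
      have "{..<Suc l} - {l} = {..<l}" by auto
      then show ?thesis using fix1[OF that] by (simp add: h_def d_def E_def mult_ac)
    qed
    have hT2: "h l (p \<circ> ?\<tau>) = \<beta> * (c p * (\<Prod>k<l. M1 p k))" if "p \<in> ?T" for p
    proof -
      have "{..<Suc l} - {l} = {..<l}" by auto
      moreover have "sign (p \<circ> ?\<tau>) = - sign p"
        using permutes_sign_compose[OF finite_lessThan _ tau, of p] that TS by (auto simp: sign_swap_id)
      then have "c (p \<circ> ?\<tau>) = - c p" by (simp add: c_def transpose_def)
      moreover have "M1 (p \<circ> ?\<tau>) k = M1 p k" if "k < l" for k
        using that by (simp add: M1_def transpose_def)
      moreover have "d (p \<circ> ?\<tau>) l = - \<beta>" using fix1[OF that] by (simp add: d_def E_def)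
      ultimately show ?thesis by (simp add: h_def mult_ac)
    qed
    have injt: "inj_on (\<lambda>p. p \<circ> ?\<tau>) ?T"
      by (rule inj_on_inverseI[where g = "\<lambda>p. p \<circ> ?\<tau>"]) (simp add: comp_assoc)
    have "(\<Sum>p\<in>?S. h l p) = (\<Sum>p\<in>?T \<union> (\<lambda>p. p \<circ> ?\<tau>) ` ?T. h l p)"
      by (rule sum.mono_neutral_right) (use TS TS2 zero in \<open>auto simp: finite_permutations\<close>)
    also have "\<dots> = (\<Sum>p\<in>?T. h l p) + (\<Sum>p\<in>?T. h l (p \<circ> ?\<tau>))"
      using disj injt by (subst sum.union_disjoint) (auto simp: finite_permutations sum.reindex)
    also have "\<dots> = 2 * (\<beta> * wick N l M C)"
      unfolding W using hT hT2 by (simp add: sum_distrib_left)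
    finally show ?thesis .
  qed
  finally show ?thesis by (simp add: algebra_simps)
qed

section \<open>The Clifford relation\<close>

definition skew_gram :: "('v \<Rightarrow> 'v \<Rightarrow> complex) \<Rightarrow> 'v list \<Rightarrow> nat \<Rightarrow> nat \<Rightarrow> complex" where
  "skew_gram B vs a b = (if a < b then B (vs ! a) (vs ! b) else if b < a then - B (vs ! b) (vs ! a) else 0)"

text \<open>The factor \<open>2\<^sup>l l!\<close> is divided out. Thus \<open>N = 0\<close> gives the Pfaffian of the skew matrix that agrees with
  the Gram matrix above the diagonal; for vectors in \<open>\<complex>\<^sup>N\<close> with coordinate functions \<open>c\<close>, the index \<open>N\<close> gives
  the sum over shuffles of the signed products of a determinant and a Pfaffian. The value 0 on lists
  shorter than \<open>N\<close> makes the relation \<open>wick_list_swap\<close> hold for lists of length \<open>N\<close> as well.\<close>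

definition wick_list ::
  "('v \<Rightarrow> 'v \<Rightarrow> complex) \<Rightarrow> (nat \<Rightarrow> 'v \<Rightarrow> complex) \<Rightarrow> nat \<Rightarrow> 'v list \<Rightarrow> complex" where
  "wick_list B c N vs = (if N \<le> length vs then
     (let l = (length vs - N) div 2 in
       wick N l (skew_gram B vs) (\<lambda>i a. c i (vs ! a)) / (2 ^ l * fact l)) else 0)"

lemma skew_gram_skew: "skew_gram B vs b a = - skew_gram B vs a b"
  by (simp add: skew_gram_def)

text \<open>The relation of the Clifford algebra, up to a factor 2. Exchanging two neighbours amounts to
  exchanging two rows and two columns of the Gram matrix, except for the entry at which these meet:
  it is \<open>B a b\<close> before and after the exchange, whereas skew symmetry asks for a change of sign. The
  discrepancy \<open>2 B a b\<close> is the perturbation of \<open>wick_perturb\<close>.\<close>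

lemma wick_list_swap:
  assumes sym: "\<And>x y. B x y = B y x" and even: "even (length xs + length ys + N)"
  shows "wick_list B c N (xs @ a # b # ys) + wick_list B c N (xs @ b # a # ys) =
    2 * B a b * wick_list B c N (xs @ ys)"
proof (cases "N \<le> length xs + length ys")
  case True
  define l where "l = (length xs + length ys - N) div 2"
  have len: "length xs + length ys = N + 2 * l" using even True unfolding l_def by presburger
  define i where "i = length xs"
  have i: "i \<le> N + 2 * l" using len i_def by simp
  let ?v = "xs @ a # b # ys" and ?w = "xs @ b # a # ys" and ?u = "xs @ ys"
  let ?m = "N + 2 * Suc l"
  \<comment> \<open>the square of a cycle, hence even, moves the places of \<open>a\<close> and \<open>b\<close> to the end\<close>
  define cyc where "cyc k = (if k < i \<or> ?m \<le> k then k else if Suc k = ?m then i else Suc k)" for k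
  define cyc' where "cyc' k = (if k < i \<or> ?m \<le> k then k else if k = i then ?m - 1 else k - 1)" for k
  have inv: "cyc' (cyc k) = k" "cyc (cyc' k) = k" for k
    using i by (auto simp: cyc_def cyc'_def)
  have cyc: "cyc permutes {..<?m}"
    unfolding permutes_def
  proof (intro conjI allI impI)
    fix k assume "k \<notin> {..<?m}" then show "cyc k = k" by (simp add: cyc_def)
  next
    fix y show "\<exists>!k. cyc k = y" using inv by metis
  qed
  define \<rho> where "\<rho> = cyc \<circ> cyc"
  have \<rho>: "\<rho> permutes {..<?m}" unfolding \<rho>_def by (rule permutes_compose[OF cyc cyc])
  have sg: "sign \<rho> = 1" unfolding \<rho>_def permutes_sign_compose[OF finite_lessThan cyc cyc] by simp
  define \<tau> where "\<tau> = transpose (N + 2 * l) (N + 2 * l + 1)"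
  have \<tau>: "\<tau> permutes {..<?m}" unfolding \<tau>_def by (rule permutes_swap_id) auto
  have sgt: "sign \<tau> = - 1" by (simp add: \<tau>_def sign_swap_id)
  have \<rho>v: "\<rho> k = (if k < i then k else k + 2)" if "k < N + 2 * l" for k
    using that i by (auto simp: \<rho>_def cyc_def)
  have \<rho>i: "\<rho> (N + 2 * l) = i" "\<rho> (Suc (N + 2 * l)) = Suc i"
    using i by (auto simp: \<rho>_def cyc_def)
  have \<tau>v: "\<tau> k = k" if "k < N + 2 * l" for k using that by (simp add: \<tau>_def transpose_def)
  have \<tau>i: "\<tau> (N + 2 * l) = Suc (N + 2 * l)" "\<tau> (Suc (N + 2 * l)) = N + 2 * l"
    by (simp_all add: \<tau>_def)
  have low: "?v ! k = ?u ! k" "?w ! k = ?u ! k" if "k < i" for k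
    using that by (simp_all add: i_def nth_append)
  have high: "?v ! Suc (Suc k) = ?u ! k" "?w ! Suc (Suc k) = ?u ! k" if "\<not> k < i" for k
    using that by (simp_all add: i_def nth_append Suc_diff_le)
  have nthi: "?v ! i = a" "?v ! Suc i = b" "?w ! i = b" "?w ! Suc i = a"
    by (simp_all add: i_def nth_append)
  define E where "E p q = (if p = N + 2 * l \<and> q = N + 2 * l + 1 then 1
      else if p = N + 2 * l + 1 \<and> q = N + 2 * l then - 1 else (0::complex))" for p q
  let ?M = "\<lambda>p q. skew_gram B ?v (\<rho> (\<tau> p)) (\<rho> (\<tau> q))"
  let ?C = "\<lambda>k p. c k (?v ! \<rho> (\<tau> p))"
  have cases3: "p < N + 2 * l \<or> p = N + 2 * l \<or> p = Suc (N + 2 * l)" if "p < ?m" for p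
    using that by auto
  \<comment> \<open>\<open>?w\<close> arises from \<open>?v\<close> by \<open>\<tau>\<close>, up to the entry in the last two rows and columns\<close>
  have "wick N (Suc l) (skew_gram B ?w) (\<lambda>i a. c i (?w ! a)) =
      wick N (Suc l) (\<lambda>p q. skew_gram B ?w (\<rho> p) (\<rho> q)) (\<lambda>k p. c k (?w ! \<rho> p))"
    using wick_permute[OF \<rho>, of "skew_gram B ?w" "\<lambda>i a. c i (?w ! a)"] sg by simp
  also have "\<dots> = wick N (Suc l) (\<lambda>p q. ?M p q + 2 * B a b * E p q) ?C"
  proof (rule wick_cong)
    fix p q assume pq: "p < ?m" "q < ?m"
    show "skew_gram B ?w (\<rho> p) (\<rho> q) = ?M p q + 2 * B a b * E p q"
      using cases3[OF pq(1)] cases3[OF pq(2)]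
      by (elim disjE)
        (auto simp: \<tau>v \<tau>i \<rho>i low high nthi skew_gram_def E_def \<rho>v \<rho>v sym[of b a])
  next
    fix k p assume "k < N" "p < ?m"
    show "c k (?w ! \<rho> p) = ?C k p"
      using cases3[OF \<open>p < ?m\<close>] by (elim disjE) (auto simp: \<rho>v \<tau>v \<tau>i \<rho>i low high nthi)
  qed
  also have "\<dots> = wick N (Suc l) ?M ?C + 2 * of_nat (Suc l) * (2 * B a b) * wick N l ?M ?C"
    unfolding E_def by (rule wick_perturb)
  also have "wick N (Suc l) ?M ?C = - wick N (Suc l) (skew_gram B ?v) (\<lambda>i a. c i (?v ! a))"
    using wick_permute[OF \<tau>, of "\<lambda>p q. skew_gram B ?v (\<rho> p) (\<rho> q)" "\<lambda>k p. c k (?v ! \<rho> p)"]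
      wick_permute[OF \<rho>, of "skew_gram B ?v" "\<lambda>i a. c i (?v ! a)"] sg sgt by simp
  also have "wick N l ?M ?C = wick N l (skew_gram B ?u) (\<lambda>i a. c i (?u ! a))"
    by (rule wick_cong) (auto simp: skew_gram_def \<tau>v low high \<rho>v)
  finally have main: "wick N (Suc l) (skew_gram B ?v) (\<lambda>i a. c i (?v ! a)) +
      wick N (Suc l) (skew_gram B ?w) (\<lambda>i a. c i (?w ! a)) =
      2 * of_nat (Suc l) * (2 * B a b) * wick N l (skew_gram B ?u) (\<lambda>i a. c i (?u ! a))"
    by simp
  have lens: "(length ?v - N) div 2 = Suc l" "(length ?w - N) div 2 = Suc l" "(length ?u - N) div 2 = l"
    "N \<le> length ?v" "N \<le> length ?w" "N \<le> length ?u"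
    using len by auto
  have pos: "(of_nat (Suc l) :: complex) \<noteq> 0" "(fact l :: complex) \<noteq> 0" by (simp_all del: of_nat_Suc)
  have "wick_list B c N ?v + wick_list B c N ?w =
     (wick N (Suc l) (skew_gram B ?v) (\<lambda>i a. c i (?v ! a)) +
      wick N (Suc l) (skew_gram B ?w) (\<lambda>i a. c i (?w ! a))) / (2 * of_nat (Suc l) * (2 ^ l * fact l))"
    unfolding wick_list_def Let_def lens using lens
    by (simp add: add_divide_distrib mult_ac del: of_nat_Suc)
  also have "\<dots> = 2 * B a b * wick_list B c N ?u"
    unfolding main wick_list_def Let_def lens using lens pos
    by (simp add: field_simps del: of_nat_Suc)
  finally show ?thesis .
next
  case False
  let ?v = "xs @ a # b # ys" and ?w = "xs @ b # a # ys"
  have u: "wick_list B c N (xs @ ys) = 0" using False by (simp add: wick_list_def)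
  show ?thesis
  proof (cases "N = length xs + length ys + 2")
    case True
    define \<tau> where "\<tau> = transpose (length xs) (Suc (length xs))"
    have \<tau>: "\<tau> permutes {..<N + 2 * 0}" unfolding \<tau>_def by (rule permutes_swap_id) (auto simp: True)
    have "?w ! k = ?v ! \<tau> k" for k
      by (auto simp: \<tau>_def transpose_def nth_append nth_Cons')
    then have "wick N 0 (skew_gram B ?w) (\<lambda>i a. c i (?w ! a)) =
        wick N 0 (\<lambda>p q. skew_gram B ?v (\<tau> p) (\<tau> q)) (\<lambda>i a. c i (?v ! \<tau> a))"
      by (simp add: wick_def)
    also have "\<dots> = - wick N 0 (skew_gram B ?v) (\<lambda>i a. c i (?v ! a))"
      using wick_permute[OF \<tau>, of "skew_gram B ?v" "\<lambda>i a. c i (?v ! a)"]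
      by (simp add: \<tau>_def sign_swap_id)
    finally show ?thesis unfolding u by (simp add: wick_list_def True)
  next
    case F2: False
    then have "\<not> N \<le> length xs + length ys + 2" using False even by presburger
    then show ?thesis by (simp add: wick_list_def)
  qed
qed

lemma wick_list_double:
  assumes sym: "\<And>x y. B x y = B y x" and even: "even (length xs + length ys + N)"
  shows "wick_list B c N (xs @ a # a # ys) = B a a * wick_list B c N (xs @ ys)"
  using wick_list_swap[OF assms, where a = a and b = a and c = c] by simp

lemma wick_list_0_cong:
  assumes "length vs = length ws"
    and "\<And>a b. a < b \<Longrightarrow> b < length vs \<Longrightarrow> B (vs ! a) (vs ! b) = B (ws ! a) (ws ! b)"
    and "even (length vs)"
  shows "wick_list B c 0 vs = wick_list B c 0 ws"
  unfolding wick_list_def Let_def using assms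
  by (auto simp: skew_gram_def intro!: wick_cong)

text \<open>The Gram matrix does not change when \<open>x\<close> and \<open>y\<close> are exchanged, so the two terms on the left of the
  Clifford relation are equal.\<close>

lemma wick_list_0_pair:
  assumes sym: "\<And>x y. B x y = B y x" and even: "even (length xs)"
    and orth: "\<And>z. z \<in> set xs \<Longrightarrow> B z x = B z y"
  shows "wick_list B c 0 (xs @ [x, y]) = B x y * wick_list B c 0 xs"
proof -
  have "wick_list B c 0 (xs @ [x, y]) = wick_list B c 0 (xs @ [y, x])"
  proof (rule wick_list_0_cong)
    fix a b assume ab: "a < b" "b < length (xs @ [x, y])"
    show "B ((xs @ [x, y]) ! a) ((xs @ [x, y]) ! b) = B ((xs @ [y, x]) ! a) ((xs @ [y, x]) ! b)"
    proof (cases "b < length xs")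
      case True
      then show ?thesis using ab by (simp add: nth_append)
    next
      case False
      then have "b = length xs \<or> b = Suc (length xs)" using ab by auto
      then show ?thesis
        using ab orth[of "xs ! a"] sym by (auto simp: nth_append nth_Cons' less_Suc_eq)
    qed
  qed (use even in auto)
  with wick_list_swap[where B = B, OF sym, where xs = xs and ys = "[]" and N = 0 and a = x and b = y and c = c] even show ?thesis by simp
qed

lemma wick_list_0_zero:
  assumes "even (length vs)" "i < length vs"
    and zero: "\<And>j. j < length vs \<Longrightarrow> B (vs ! i) (vs ! j) = 0 \<and> B (vs ! j) (vs ! i) = 0"
  shows "wick_list B c 0 vs = 0"
proof -
  define l where "l = length vs div 2"
  have l: "length vs = 2 * l" using assms by (simp add: l_def)
  have "wick 0 l (skew_gram B vs) (\<lambda>i a. c i (vs ! a)) = 0"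
    unfolding wick_def
  proof (rule sum.neutral, rule ballI)
    fix p assume "p \<in> {p. p permutes {..<0 + 2 * l}}"
    then have p: "p permutes {..<2 * l}" by simp
    obtain x where x: "p x = i" using surjD[OF permutes_surj[OF p], of i] by auto
    have "x < 2 * l" using permutes_in_image[OF p, of x] assms x l by simp
    define k where "k = x div 2"
    have k: "k < l" "x = 2 * k \<or> x = 2 * k + 1" using \<open>x < 2 * l\<close> by (auto simp: k_def)
    have "p (2 * k) < 2 * l" "p (2 * k + 1) < 2 * l"
      using permutes_in_image[OF p, of "2 * k"] permutes_in_image[OF p, of "2 * k + 1"] k by auto
    then have "skew_gram B vs (p (2 * k)) (p (2 * k + 1)) = 0"
      using k(2) x zero l by (auto simp: skew_gram_def)
    then have "(\<Prod>k<l. skew_gram B vs (p (0 + 2 * k)) (p (0 + 2 * k + 1))) = 0"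
      using k(1) by (intro prod_zero) auto
    then show "of_int (sign p) * ((\<Prod>i<0. c i (vs ! p i)) *
        (\<Prod>k<l. skew_gram B vs (p (0 + 2 * k)) (p (0 + 2 * k + 1)))) = 0" by simp
  qed
  then show ?thesis by (simp add: wick_list_def l_def)
qed

lemma wick_list_det:
  assumes "length vs = N"
  shows "wick_list B c N vs = Determinant.det (mat N N (\<lambda>(i, a). c i (vs ! a)))"
  using assms by (simp add: wick_list_def wick_def Determinant.det_def atLeast0LessThan
      permutes_in_image[unfolded lessThan_iff])

text \<open>Bubble sort: a property that survives exchanges of neighbours depends on the multiset only. It is
  confined to one length \<open>L\<close> because the exchange is justified by an induction on the length.\<close>

lemma mset_adjacent_swaps:
  assumes swap: "\<And>xs a b ys. Q (xs @ a # b # ys) \<Longrightarrow> length (xs @ a # b # ys) = L \<Longrightarrow> Q (xs @ b # a # ys)"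
    and "mset vs = mset ws" "length vs = L" "Q vs"
  shows "Q ws"
proof -
  have "Q (ps @ vs) \<Longrightarrow> length (ps @ vs) = L \<Longrightarrow> mset vs = mset ws \<Longrightarrow> Q (ps @ ws)" for ps
  proof (induction ws arbitrary: ps vs)
    case Nil
    then show ?case by simp
  next
    case (Cons w ws)
    then have "w \<in> set vs" by (metis list.set_intros(1) mset_eq_setD)
    then obtain us ts where vs: "vs = us @ w # ts" by (meson split_list)
    have "Q (ps @ us @ w # ts) \<Longrightarrow> length (ps @ us @ w # ts) = L \<Longrightarrow> Q (ps @ w # us @ ts)" for ts
    proof (induction us arbitrary: ts rule: rev_induct)
      case (snoc u us)
      have "Q ((ps @ us) @ w # u # ts)"
        using swap[of "ps @ us" u w ts] snoc.prems by simp
      then show ?case using snoc.IH[of "u # ts"] snoc.prems by simp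
    qed simp
    then have "Q ((ps @ [w]) @ us @ ts)" using Cons.prems vs by simp
    moreover have "mset (us @ ts) = mset ws" using Cons.prems vs by simp
    moreover have "length ((ps @ [w]) @ us @ ts) = L" using Cons.prems vs by simp
    ultimately have "Q ((ps @ [w]) @ ws)"
      using Cons.IH[of "ps @ [w]" "us @ ts"] by blast
    then show ?case by simp
  qed
  from this[of "[]"] assms show ?thesis by simp
qed

section \<open>Values on basis vectors\<close>

definition bil :: "nat \<Rightarrow> complex vec \<Rightarrow> complex vec \<Rightarrow> complex" where
  "bil n v w = (\<Sum>r<n div 2. v $ (2 * r) * w $ (2 * r + 1) + v $ (2 * r + 1) * w $ (2 * r))"

lemma bil_sym: "bil n v w = bil n w v"
  by (simp add: bil_def algebra_simps)

definition partner :: "nat \<Rightarrow> nat" where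
  "partner k = (if even k then k + 1 else k - 1)"

lemma partner_simps [simp]:
  "partner (2 * r) = Suc (2 * r)" "partner (Suc (2 * r)) = 2 * r" "partner (partner k) = k" "partner k \<noteq> k"
  "partner k div 2 = k div 2"
  "partner 0 = Suc 0" "partner (Suc 0) = 0" "k \<noteq> partner k"
  by (auto simp: partner_def elim!: oddE evenE)

lemma partner_less: "even n \<Longrightarrow> k < n \<Longrightarrow> partner k < n"
  by (auto simp: partner_def elim!: evenE)

lemma bil_unit_vec:
  assumes "even n" "b < n" "v \<in> carrier_vec n"
  shows "bil n v (unit_vec n b) = v $ partner b"
proof -
  have "bil n v (unit_vec n b) = (\<Sum>r<n div 2. if r = b div 2 then v $ partner b else 0)"
    unfolding bil_def
  proof (rule sum.cong[OF refl])
    fix r assume "r \<in> {..<n div 2}"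
    then have r: "2 * r < n" "Suc (2 * r) < n" by auto
    have "b = 2 * (b div 2) \<or> b = Suc (2 * (b div 2))" by presburger
    then obtain k where "b = 2 * k \<or> b = Suc (2 * k)" by blast
    moreover have "2 * x \<noteq> Suc (2 * y)" "Suc (2 * x) \<noteq> 2 * y" for x y :: nat by presburger+
    ultimately show "v $ (2 * r) * unit_vec n b $ (2 * r + 1) + v $ (2 * r + 1) * unit_vec n b $ (2 * r) =
        (if r = b div 2 then v $ partner b else 0)"
      using r assms by (auto simp: unit_vec_def)
  qed
  also have "\<dots> = v $ partner b"
    using div_less_mono[of b n 2] assms by (auto simp: sum.delta elim!: evenE)
  finally show ?thesis .
qed

lemma bil_unit_unit:
  assumes "even n" "a < n" "b < n"
  shows "bil n (unit_vec n a) (unit_vec n b) = of_bool (a = partner b)"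
  using bil_unit_vec[OF assms(1,3), of "unit_vec n a"] assms partner_less[OF assms(1,3)]
  by (simp add: unit_vec_def)

text \<open>In terms of the Clifford algebra of the quadratic form, this is the trace of the product of the
  vectors on one of the two half-spin modules, of dimension \<open>2\<^bsup>n div 2 - 1\<^esup>\<close>: the Pfaffian is the trace on
  the whole spin module, the other term accounts for the difference of the two halves. The trace is
  an integer on basis vectors because these act by creation and annihilation operators; the proof
  below only uses the Clifford relation.\<close>

definition half_spin :: "nat \<Rightarrow> complex vec list \<Rightarrow> complex" where
  "half_spin n vs = 2 ^ (n div 2) / 2 ^ (length vs div 2 + 1) *
     (wick_list (bil n) (\<lambda>i v. v $ i) 0 vs - wick_list (bil n) (\<lambda>i v. v $ i) n vs)"

lemma half_spin_swap:
  assumes "even n" "even (length xs + length ys)"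
  shows "half_spin n (xs @ a # b # ys) + half_spin n (xs @ b # a # ys) = bil n a b * half_spin n (xs @ ys)"
proof -
  let ?w = "wick_list (bil n) (\<lambda>i v. v $ i)"
  have s: "?w N (xs @ a # b # ys) + ?w N (xs @ b # a # ys) = 2 * bil n a b * ?w N (xs @ ys)"
    if "N = 0 \<or> N = n" for N
    by (rule wick_list_swap) (use assms that in \<open>auto simp: bil_sym\<close>)
  have "half_spin n (xs @ a # b # ys) + half_spin n (xs @ b # a # ys) =
     2 ^ (n div 2) / 2 ^ (length (xs @ ys) div 2 + 2) *
     ((?w 0 (xs @ a # b # ys) + ?w 0 (xs @ b # a # ys)) - (?w n (xs @ a # b # ys) + ?w n (xs @ b # a # ys)))"
    using assms by (simp add: half_spin_def algebra_simps)
  also have "\<dots> = bil n a b * half_spin n (xs @ ys)"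
    unfolding s[of 0, simplified] s[of n, simplified] by (simp add: half_spin_def field_simps)
  finally show ?thesis .
qed

text \<open>In an order that lists partners next to each other, \<open>wick_list_0_pair\<close> splits off one pair after
  the other.\<close>

lemma ex_pairing_order:
  assumes n: "even n" and "distinct ws" "set ws \<subseteq> {..<n}" "partner ` set ws \<subseteq> set ws"
  shows "\<exists>ws'. mset ws' = mset ws \<and> even (length ws) \<and>
    wick_list (bil n) c 0 (map (unit_vec n) ws') = 1"
  using assms(2-)
proof (induction "length ws" arbitrary: ws rule: less_induct)
  case less
  show ?case
  proof (cases ws)
    case Nil
    then show ?thesis by (simp add: wick_list_def wick_def)
  next
    case (Cons a rest)
    define us where "us = filter (\<lambda>k. k \<noteq> a \<and> k \<noteq> partner a) ws"
    have mem: "a \<in> set ws" "partner a \<in> set ws" using less.prems Cons by auto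
    have ms: "mset ws = mset (us @ [partner a, a])"
    proof -
      have "distinct (us @ [partner a, a])" using less.prems by (auto simp: us_def)
      moreover have "set (us @ [partner a, a]) = set ws" using mem by (auto simp: us_def)
      ultimately show ?thesis using less.prems set_eq_iff_mset_eq_distinct by metis
    qed
    then have len: "length ws = length us + 2" by (metis length_append mset_eq_length length_Cons list.size(3) numeral_2_eq_2)
    have "partner ` set us \<subseteq> set us"
      using less.prems by (auto simp: us_def) (metis partner_simps(3))+
    moreover have "distinct us" "set us \<subseteq> {..<n}" using less.prems by (auto simp: us_def)
    ultimately obtain us' where us': "mset us' = mset us" "even (length us)"
      "wick_list (bil n) c 0 (map (unit_vec n) us') = 1"
      using less.hyps[of us] len by auto
    have in_us: "set us' = set us" using us'(1) by (rule mset_eq_setD)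
    have lenu: "length us' = length us" using us'(1) by (rule mset_eq_length)
    have lt: "a < n" "partner a < n" using mem less.prems by auto
    have "wick_list (bil n) c 0 (map (unit_vec n) us' @ [unit_vec n (partner a), unit_vec n a]) =
       bil n (unit_vec n (partner a)) (unit_vec n a) * wick_list (bil n) c 0 (map (unit_vec n) us')"
    proof (rule wick_list_0_pair[OF bil_sym])
      show "even (length (map (unit_vec n) us'))" using us' lenu by simp
      fix z :: "complex vec" assume "z \<in> set (map (unit_vec n) us')"
      then obtain k where k: "z = unit_vec n k" "k \<in> set us" using in_us by auto
      then have "k < n" "k \<noteq> a" "k \<noteq> partner a" using less.prems by (auto simp: us_def)
      then show "bil n z (unit_vec n (partner a)) = bil n z (unit_vec n a)"
        using k lt n by (simp add: bil_unit_unit)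
    qed
    also have "\<dots> = 1" using us' lt n by (simp add: bil_unit_unit)
    finally have "wick_list (bil n) c 0 (map (unit_vec n) (us' @ [partner a, a])) = 1" by simp
    moreover have "mset (us' @ [partner a, a]) = mset ws" using ms us' by simp
    moreover have "even (length ws)" using len us' by simp
    ultimately show ?thesis by blast
  qed
qed

lemma wick_list_0_upt:
  "2 * k \<le> n \<Longrightarrow> even n \<Longrightarrow> wick_list (bil n) c 0 (map (unit_vec n) [0..<2 * k]) = 1"
proof (induction k)
  case 0
  then show ?case by (simp add: wick_list_def wick_def)
next
  case (Suc k)
  have "wick_list (bil n) c 0 (map (unit_vec n) [0..<2 * k] @ [unit_vec n (2 * k), unit_vec n (Suc (2 * k))]) =
     bil n (unit_vec n (2 * k)) (unit_vec n (Suc (2 * k))) * wick_list (bil n) c 0 (map (unit_vec n) [0..<2 * k])"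
  proof (rule wick_list_0_pair[OF bil_sym])
    fix z :: "complex vec" assume "z \<in> set (map (unit_vec n) [0..<2 * k])"
    then obtain j where "z = unit_vec n j" "j < 2 * k" by auto
    then show "bil n z (unit_vec n (2 * k)) = bil n z (unit_vec n (Suc (2 * k)))"
      using Suc.prems by (simp add: bil_unit_unit)
  qed simp
  then show ?case using Suc by (simp add: bil_unit_unit)
qed

text \<open>By the Clifford relation, the order of the vectors is immaterial modulo integers. A repeated basis
  vector can be doubled at the front, where it gives 0 since basis vectors are isotropic; a basis
  vector without its partner is orthogonal to all others, and both terms vanish. What remains is a set
  of pairs of partners: if there are fewer than \<open>n div 2\<close> pairs, only the Pfaffian contributes, and its
  value 1 in a suitable order is multiplied by a nonnegative power of 2; if all basis vectors occur,
  Pfaffian and determinant cancel.\<close>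

lemma half_spin_integral:
  assumes n: "even n" "n > 0" and "even (length ws)" "set ws \<subseteq> {..<n}"
  shows "half_spin n (map (unit_vec n) ws) \<in> \<int>"
  using assms(3-)
proof (induction "length ws" arbitrary: ws rule: less_induct)
  case less
  let ?e = "unit_vec n :: nat \<Rightarrow> complex vec"
  let ?w = "wick_list (bil n) (\<lambda>i v. v $ i)"
  define Q where "Q us \<longleftrightarrow> set us \<subseteq> {..<n} \<and> half_spin n (map ?e us) \<in> \<int>" for us
  have reorder: "half_spin n (map ?e ws) \<in> \<int>" if "mset us = mset ws" "half_spin n (map ?e us) \<in> \<int>" for us
  proof -
    have "Q us" using that less.prems by (auto simp: Q_def dest: mset_eq_setD)
    moreover have "Q (xs @ b # a # ys)" if q: "Q (xs @ a # b # ys)" "length (xs @ a # b # ys) = length ws" for xs a b ys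
    proof -
      have ev: "even (length (xs @ ys))" "length (xs @ ys) < length ws"
        using q(2)[symmetric] less.prems(1) by auto
      have "half_spin n (map ?e (xs @ ys)) \<in> \<int>"
        by (rule less.hyps[OF ev(2) ev(1)]) (use q in \<open>auto simp: Q_def\<close>)
      moreover have "half_spin n (map ?e xs @ ?e b # ?e a # map ?e ys) =
          bil n (?e a) (?e b) * half_spin n (map ?e xs @ map ?e ys) -
          half_spin n (map ?e xs @ ?e a # ?e b # map ?e ys)"
        using half_spin_swap[OF n(1), of "map ?e xs" "map ?e ys" "?e a" "?e b"] ev
        by (simp add: eq_diff_eq add.commute)
      moreover have "bil n (?e a) (?e b) \<in> \<int>" using q n by (simp add: Q_def bil_unit_unit)
      ultimately show ?thesis using q by (auto simp: Q_def)
    qed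
    ultimately have "Q ws" using mset_adjacent_swaps[of Q "length ws" us ws] that(1) by (metis mset_eq_length)
    then show ?thesis by (simp add: Q_def)
  qed
  show ?case
  proof (cases "distinct ws")
    case False
    then obtain xs ys zs a where ws: "ws = xs @ [a] @ ys @ [a] @ zs" using not_distinct_decomp by blast
    let ?us = "[] @ a # a # (xs @ ys @ zs)"
    have "half_spin n (map ?e ?us) = 0"
      using half_spin_swap[OF n(1), of "[]" "map ?e (xs @ ys @ zs)" "?e a" "?e a"] less.prems ws n
      by (simp add: bil_unit_unit)
    then show ?thesis using reorder[of ?us] ws by simp
  next
    case True
    show ?thesis
    proof (cases "partner ` set ws \<subseteq> set ws")
      case False
      then obtain a where a: "a \<in> set ws" "partner a \<notin> set ws" by auto
      then obtain i where i: "i < length ws" "ws ! i = a" by (auto simp: in_set_conv_nth)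
      have "?w 0 (map ?e ws) = 0"
      proof (rule wick_list_0_zero)
        show "i < length (map ?e ws)" using i by simp
        show "even (length (map ?e ws))" using less.prems by simp
        fix j assume "j < length (map ?e ws)"
        then have j: "j < length ws" "ws ! j \<in> set ws" by auto
        have "bil n (?e a) (?e (ws ! j)) = 0"
        proof -
          have "ws ! j < n" "a < n" using a j less.prems by blast+
          moreover have "a \<noteq> partner (ws ! j)" using a(2) j(2) by (metis partner_simps(3))
          ultimately show ?thesis using n by (simp add: bil_unit_unit)
        qed
        then show "bil n (map ?e ws ! i) (map ?e ws ! j) = 0 \<and> bil n (map ?e ws ! j) (map ?e ws ! i) = 0"
          using i j bil_sym by simp
      qed
      moreover have "?w n (map ?e ws) = 0"
      proof -
        have "set ws \<subseteq> {..<n} - {partner a}" using less.prems a by auto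
        then have "card (set ws) \<le> card ({..<n} - {partner a})" by (intro card_mono) auto
        also have "\<dots> < n" using partner_less[OF n(1), of a] a less.prems n by auto
        finally show ?thesis using True by (simp add: wick_list_def distinct_card)
      qed
      ultimately show ?thesis by (simp add: half_spin_def)
    next
      case closed: True
      show ?thesis
      proof (cases "length ws = n")
        case full: True
        have "set ws = {..<n}"
          using less.prems True full by (intro card_subset_eq) (auto simp: distinct_card)
        then have ms: "mset [0..<n] = mset ws"
          using True set_eq_iff_mset_eq_distinct[of "[0..<n]" ws] by (simp add: atLeast0LessThan)
        have "?w 0 (map ?e [0..<n]) = 1" using wick_list_0_upt[of "n div 2" n] n by simp
        moreover have "?w n (map ?e [0..<n]) = 1"
        proof -
          have "mat n n (\<lambda>(i, a). map ?e [0..<n] ! a $ i) = 1\<^sub>m n"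
            by (rule eq_matI) (auto simp: unit_vec_def)
          then show ?thesis by (subst wick_list_det) auto
        qed
        ultimately show ?thesis using reorder[of "[0..<n]"] ms by (simp add: half_spin_def)
      next
        case False
        have "length ws < n"
          using less.prems True False card_mono[of "{..<n}" "set ws"] by (simp add: distinct_card)
        obtain us where us: "mset us = mset ws" "?w 0 (map ?e us) = 1"
          using ex_pairing_order[OF n(1) True less.prems(2) closed] by blast
        have len: "length us = length ws" using us(1) by (rule mset_eq_length)
        have "half_spin n (map ?e us) = 2 ^ (n div 2) / 2 ^ (length ws div 2 + 1)"
          using \<open>length ws < n\<close> us len by (simp add: half_spin_def wick_list_def)
        also have "\<dots> = 2 ^ (n div 2 - (length ws div 2 + 1))"
          using \<open>length ws < n\<close> less.prems n by (subst power_diff) auto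
        finally have "half_spin n (map ?e us) \<in> \<int>" by simp
        then show ?thesis using reorder us by blast
      qed
    qed
  qed
qed

text \<open>A vector with \<open>bil n v v = 2\<close> that occurs twice in succession can be dropped at the cost of a factor 2,
  which cancels the change of the power of 2 in front. The empty list is left, which is too short for
  the determinant and has Pfaffian 1.\<close>

lemma half_spin_pairs:
  assumes n: "even n" "0 < n"
    and pair: "\<And>k. k < \<mu> \<Longrightarrow> v (2 * k) = v (Suc (2 * k)) \<and> bil n (v (2 * k)) (v (2 * k)) = 2"
  shows "half_spin n (map v [0..<2 * \<mu>]) = 2 ^ (n div 2 - 1)"
proof -
  let ?w = "wick_list (bil n) (\<lambda>i v. v $ i)"
  have step: "?w N (map v [0..<2 * k]) = 2 ^ k * ?w N []" if "even N" "k \<le> \<mu>" for N k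
    using \<open>k \<le> \<mu>\<close>
  proof (induction k)
    case (Suc k)
    have "?w N (map v [0..<2 * Suc k]) = ?w N (map v [0..<2 * k] @ v (2 * k) # v (2 * k) # [])"
    proof -
      have "[0..<2 * Suc k] = [0..<2 * k] @ [2 * k, Suc (2 * k)]" by simp
      moreover have "v (Suc (2 * k)) = v (2 * k)" using pair[of k] Suc.prems by simp
      ultimately show ?thesis by (simp only: map_append list.map)
    qed
    also have "\<dots> = bil n (v (2 * k)) (v (2 * k)) * ?w N (map v [0..<2 * k] @ [])"
      by (rule wick_list_double) (use \<open>even N\<close> in \<open>auto simp: bil_sym\<close>)
    also have "\<dots> = 2 * (2 ^ k * ?w N [])"
    proof -
      have "bil n (v (2 * k)) (v (2 * k)) = 2" using pair[of k] Suc.prems Suc_le_eq by blast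
      moreover have "?w N (map v [0..<2 * k]) = 2 ^ k * ?w N []" using Suc by simp
      ultimately show ?thesis by (simp only: append_Nil2)
    qed
    finally show ?case by simp
  qed simp
  have "?w n (map v [0..<2 * \<mu>]) = 0" "?w 0 (map v [0..<2 * \<mu>]) = 2 ^ \<mu>"
    using step[of n \<mu>] step[of 0 \<mu>] n by (simp_all add: wick_list_def wick_def)
  then have "half_spin n (map v [0..<2 * \<mu>]) = 2 ^ (n div 2) / 2 ^ 1"
    by (simp add: half_spin_def)
  also have "\<dots> = 2 ^ (n div 2 - 1)" using n by (subst power_diff) auto
  finally show ?thesis .
qed

section \<open>Polynomials as linear combinations of monomials\<close>

type_synonym mono = "nat \<times> nat \<Rightarrow>\<^sub>0 nat"

abbreviation "coef \<equiv> Poly_Mapping.lookup"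
abbreviation "keys \<equiv> Poly_Mapping.keys"

lemma keys_add_mono: "keys (a + b) = keys a \<union> keys b" for a b :: mono
  by (auto simp: in_keys_iff lookup_add)

text \<open>Both the evaluation at a point and the sums of coefficients studied later are of this form.\<close>

definition lin :: "(mono \<Rightarrow> complex) \<Rightarrow> mpol \<Rightarrow> complex" where
  "lin h f = (\<Sum>a\<in>keys f. coef f a * h a)"

lemma lin_superset: "finite K \<Longrightarrow> keys f \<subseteq> K \<Longrightarrow> lin h f = (\<Sum>a\<in>K. coef f a * h a)"
  unfolding lin_def by (rule sum.mono_neutral_left) (auto simp: in_keys_iff)

lemma lin_zero [simp]: "lin h 0 = 0"
  by (simp add: lin_def)

lemma lin_single [simp]: "lin h (Poly_Mapping.single a c) = c * h a"
  by (simp add: lin_def)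

lemma lin_add: "lin h (f + g) = lin h f + lin h g"
proof -
  have "keys (f + g) \<subseteq> keys f \<union> keys g" by (rule Poly_Mapping.keys_add)
  then show ?thesis
    by (simp add: lin_superset[of "keys f \<union> keys g"] lookup_add algebra_simps sum.distrib)
qed

lemma lin_sum: "lin h (\<Sum>i\<in>I. F i) = (\<Sum>i\<in>I. lin h (F i))"
  by (induction I rule: infinite_finite_induct) (simp_all add: lin_add)

lemma lin_uminus: "lin h (- f) = - lin h f"
  by (simp add: lin_def keys_def[symmetric] sum_negf)

lemma lin_diff: "lin h (f - g) = lin h f - lin h g"
  using lin_add[of h f "- g"] by (simp add: lin_uminus)

lemma mpol_eq_sum: "f = (\<Sum>a\<in>keys f. Poly_Mapping.single a (coef f a))" for f :: mpol
  by (rule poly_mapping_eqI) (simp add: lookup_sum lookup_single when_def sum.delta in_keys_iff)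

lemma lin_mult: "lin h (f * g) = (\<Sum>a\<in>keys f. \<Sum>b\<in>keys g. coef f a * coef g b * h (a + b))"
proof -
  have "f * g = (\<Sum>a\<in>keys f. Poly_Mapping.single a (coef f a)) * (\<Sum>b\<in>keys g. Poly_Mapping.single b (coef g b))"
    by (rule arg_cong2[where f = "(*)"]; rule mpol_eq_sum)
  also have "\<dots> = (\<Sum>a\<in>keys f. \<Sum>b\<in>keys g. Poly_Mapping.single (a + b) (coef f a * coef g b))"
    by (simp only: sum_product mult_single)
  finally show ?thesis by (simp only: lin_sum lin_single)
qed

lemma lin_mult_hom:
  assumes "\<And>a b. h (a + b) = h a * h b"
  shows "lin h (f * g) = lin h f * lin h g"
  unfolding lin_mult assms by (simp add: lin_def sum_product mult_ac)

definition meval :: "(nat \<times> nat \<Rightarrow> complex) \<Rightarrow> mono \<Rightarrow> complex" where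
  "meval x a = (\<Prod>p\<in>keys a. x p ^ coef a p)"

lemma meval_superset: "finite K \<Longrightarrow> keys a \<subseteq> K \<Longrightarrow> meval x a = (\<Prod>p\<in>K. x p ^ coef a p)"
  unfolding meval_def by (rule prod.mono_neutral_left) (auto simp: in_keys_iff)

lemma meval_add: "meval x (a + b) = meval x a * meval x b"
  by (simp add: meval_superset[of "keys a \<union> keys b"] keys_add_mono lookup_add power_add prod.distrib)

lemma meval_zero [simp]: "meval x 0 = 1"
  by (simp add: meval_def)

lemma meval_single [simp]: "meval x (Poly_Mapping.single p e) = x p ^ e"
  by (simp add: meval_def)

definition coords :: "(nat \<Rightarrow> complex vec) \<Rightarrow> nat \<times> nat \<Rightarrow> complex" where
  "coords v = (\<lambda>(i, k). v i $ k)"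

lemma eval_pol_lin: "eval_pol f v = lin (meval (coords v)) f"
  by (simp add: eval_pol_def lin_def meval_def coords_def case_prod_beta)

lemma eval_pol_add: "eval_pol (f + g) v = eval_pol f v + eval_pol g v"
  and eval_pol_diff: "eval_pol (f - g) v = eval_pol f v - eval_pol g v"
  and eval_pol_uminus: "eval_pol (- f) v = - eval_pol f v"
  and eval_pol_sum: "eval_pol (\<Sum>i\<in>I. F i) v = (\<Sum>i\<in>I. eval_pol (F i) v)"
  and eval_pol_mult: "eval_pol (f * g) v = eval_pol f v * eval_pol g v"
  and eval_pol_coord: "eval_pol (coord i k) v = v i $ k"
  and eval_pol_const: "eval_pol (const_pol c) v = c"
  by (simp_all add: eval_pol_lin lin_add lin_diff lin_uminus lin_sum lin_mult_hom[OF meval_add]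
      coord_def const_pol_def coords_def)

lemma const_pol_1: "const_pol 1 = 1"
  by (simp add: const_pol_def)

lemma eval_pol_one: "eval_pol 1 v = 1"
  using eval_pol_const[of 1] by (simp add: const_pol_1)

lemma eval_pol_prod: "eval_pol (\<Prod>i\<in>I. F i) v = (\<Prod>i\<in>I. eval_pol (F i) v)"
  by (induction I rule: infinite_finite_induct) (simp_all add: eval_pol_one eval_pol_mult)

lemma eval_pol_sign: "eval_pol (of_int (sign p)) v = of_int (sign p)"
  by (cases p rule: sign_cases) (simp_all add: eval_pol_one eval_pol_uminus)

lemmas eval_pol_simps = eval_pol_add eval_pol_diff eval_pol_uminus eval_pol_sum eval_pol_mult
  eval_pol_coord eval_pol_const eval_pol_one eval_pol_prod eval_pol_sign

text \<open>The degree of a monomial in the coordinates of the \<open>i\<close>-th vector.\<close>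

definition rowdeg :: "mono \<Rightarrow> nat \<Rightarrow> nat" where
  "rowdeg a i = (\<Sum>p\<in>{p \<in> keys a. fst p = i}. coef a p)"

lemma rowdeg_superset: "finite K \<Longrightarrow> keys a \<subseteq> K \<Longrightarrow> rowdeg a i = (\<Sum>p\<in>{p \<in> K. fst p = i}. coef a p)"
  unfolding rowdeg_def by (rule sum.mono_neutral_left) (auto simp: in_keys_iff)

lemma rowdeg_add: "rowdeg (a + b) i = rowdeg a i + rowdeg b i"
  by (simp add: rowdeg_superset[of "keys a \<union> keys b"] keys_add_mono lookup_add sum.distrib)

lemma rowdeg_zero [simp]: "rowdeg 0 i = 0"
  by (simp add: rowdeg_def)

lemma rowdeg_single: "rowdeg (Poly_Mapping.single p e) i = (if fst p = i then e else 0)"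
  by (subst rowdeg_superset[of "{p}"]) (auto simp: Collect_conv_if)

lemma rowdeg_pos_iff: "0 < rowdeg a i \<longleftrightarrow> (\<exists>k. (i, k) \<in> keys a)"
proof -
  have "rowdeg a i = 0 \<longleftrightarrow> (\<forall>k. (i, k) \<notin> keys a)"
    unfolding rowdeg_def by (subst sum_eq_0_iff) (auto simp: in_keys_iff)
  then show ?thesis by auto
qed

lemma degree_rowdeg:
  assumes "\<And>i. m \<le> i \<Longrightarrow> rowdeg a i = 0"
  shows "(\<Sum>p\<in>keys a. coef a p) = (\<Sum>i<m. rowdeg a i)"
proof -
  have "fst ` keys a \<subseteq> {..<m}"
  proof clarify
    fix i k assume "(i, k) \<in> keys a"
    then have "0 < rowdeg a i" using rowdeg_pos_iff by blast
    then show "fst (i, k) < m" using assms[of i] by (cases "i < m") auto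
  qed
  then show ?thesis unfolding rowdeg_def by (subst sum.group) auto
qed

lemma rowdeg_1D:
  assumes "rowdeg a i = 1"
  obtains k where "\<And>l. coef a (i, l) = of_bool (l = k)"
proof -
  let ?K = "{p \<in> keys a. fst p = i}"
  obtain k where k: "(i, k) \<in> keys a" using assms rowdeg_pos_iff[of a i] by auto
  have "coef a (i, k) + (\<Sum>p\<in>?K - {(i, k)}. coef a p) = 1"
    using assms sum.remove[of ?K "(i, k)" "coef a"] k by (simp add: rowdeg_def)
  moreover have "coef a (i, k) \<noteq> 0" using k by (simp add: in_keys_iff)
  ultimately have one: "coef a (i, k) = 1" and "(\<Sum>p\<in>?K - {(i, k)}. coef a p) = 0" by linarith+
  then have zero: "\<forall>p\<in>?K - {(i, k)}. coef a p = 0" by (subst (asm) sum_eq_0_iff) auto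
  have "coef a (i, l) = of_bool (l = k)" for l
  proof (cases "l = k \<or> (i, l) \<notin> keys a")
    case True
    then show ?thesis using one k by (auto simp: in_keys_iff)
  next
    case False
    then show ?thesis using zero by auto
  qed
  then show ?thesis by (rule that)
qed

definition multihom :: "nat \<Rightarrow> (nat \<Rightarrow> nat) \<Rightarrow> mpol set" where
  "multihom n d = {f. \<forall>a\<in>keys f. keys a \<subseteq> UNIV \<times> {..<n} \<and> rowdeg a = d}"

lemma multihom_add: "f \<in> multihom n d \<Longrightarrow> g \<in> multihom n d \<Longrightarrow> f + g \<in> multihom n d"
  using Poly_Mapping.keys_add[of f g] by (auto simp: multihom_def)

lemma multihom_uminus: "f \<in> multihom n d \<Longrightarrow> - f \<in> multihom n d"
  by (simp add: multihom_def)

lemma multihom_diff: "f \<in> multihom n d \<Longrightarrow> g \<in> multihom n d \<Longrightarrow> f - g \<in> multihom n d"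
  using multihom_add[of f n d "- g"] multihom_uminus[of g] by simp

lemma multihom_0: "0 \<in> multihom n d"
  by (simp add: multihom_def)

lemma multihom_sum: "(\<And>i. i \<in> I \<Longrightarrow> F i \<in> multihom n d) \<Longrightarrow> (\<Sum>i\<in>I. F i) \<in> multihom n d"
  by (induction I rule: infinite_finite_induct) (auto simp: multihom_add multihom_0)

lemma multihom_mult:
  assumes "f \<in> multihom n d" "g \<in> multihom n e"
  shows "f * g \<in> multihom n (\<lambda>i. d i + e i)"
  unfolding multihom_def
proof (intro CollectI ballI)
  fix a assume "a \<in> keys (f * g)"
  then obtain b c where "a = b + c" "b \<in> keys f" "c \<in> keys g"
    using Poly_Mapping.keys_mult[of f g] by auto
  then show "keys a \<subseteq> UNIV \<times> {..<n} \<and> rowdeg a = (\<lambda>i. d i + e i)"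
    using assms by (auto simp: multihom_def keys_add_mono rowdeg_add fun_eq_iff)
qed

lemma multihom_const: "const_pol c \<in> multihom n (\<lambda>_. 0)"
  by (auto simp: multihom_def const_pol_def fun_eq_iff)

lemma multihom_const_mult: "f \<in> multihom n d \<Longrightarrow> const_pol c * f \<in> multihom n d"
  using multihom_mult[OF multihom_const] by simp

lemma multihom_sign_mult: "f \<in> multihom n d \<Longrightarrow> of_int (sign p) * f \<in> multihom n d"
  by (cases p rule: sign_cases) (simp_all add: multihom_uminus)

lemma multihom_prod:
  "(\<And>j. j \<in> I \<Longrightarrow> F j \<in> multihom n (d j)) \<Longrightarrow> (\<Prod>j\<in>I. F j) \<in> multihom n (\<lambda>i. \<Sum>j\<in>I. d j i)"
proof (induction I rule: infinite_finite_induct)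
  case (insert x I)
  then show ?case using multihom_mult[of "F x" n "d x" "\<Prod>j\<in>I. F j"] by simp
qed (simp_all add: multihom_const[of 1, unfolded const_pol_1])

lemma multihom_coord: "k < n \<Longrightarrow> coord j k \<in> multihom n (\<lambda>i. of_bool (i = j))"
  by (auto simp: multihom_def coord_def rowdeg_single fun_eq_iff split: if_splits)

text \<open>Doubling one variable in which two monomials differ multiplies them by different powers of 2, so a
  suitable combination of the relation with its doubled version eliminates one of them and keeps the
  other.\<close>

lemma monomials_independent:
  assumes "finite K" and "\<And>x. (\<Sum>a\<in>K. c a * meval x a) = 0"
  shows "\<forall>a\<in>K. c a = 0"
  using assms
proof (induction "card K" arbitrary: K c rule: less_induct)
  case less
  show ?case
  proof (cases "\<exists>a\<in>K. \<exists>b\<in>K. a \<noteq> b")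
    case False
    have "c a = 0" if "a \<in> K" for a
    proof -
      have "K = {a}" using False that by auto
      then show ?thesis using less.prems(2)[of "\<lambda>_. 1"] by (simp add: meval_def)
    qed
    then show ?thesis by blast
  next
    case True
    then obtain a b where ab: "a \<in> K" "b \<in> K" "a \<noteq> b" by blast
    then obtain p where p: "coef a p \<noteq> coef b p" using poly_mapping_eqI[of a b] by blast
    have scale: "meval (x(p := 2 * x p)) d = 2 ^ coef d p * meval x d" for x d
    proof -
      have K: "finite (insert p (keys d))" by simp
      have "meval (x(p := 2 * x p)) d = (\<Prod>q\<in>insert p (keys d). (if q = p then 2 ^ coef d p else 1) * x q ^ coef d q)"
        unfolding meval_superset[OF K subset_insertI] by (intro prod.cong) (auto simp: power_mult_distrib)
      also have "\<dots> = 2 ^ coef d p * meval x d"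
        unfolding prod.distrib meval_superset[OF K subset_insertI] by (simp add: prod.delta)
      finally show ?thesis .
    qed
    define c' where "c' d = c d * (2 ^ coef d p - 2 ^ coef a p)" for d
    have "(\<Sum>d\<in>K - {a}. c' d * meval x d) = 0" for x
    proof -
      have "(\<Sum>d\<in>K - {a}. c' d * meval x d) = (\<Sum>d\<in>K. c' d * meval x d)"
        using ab less.prems(1) by (intro sum.mono_neutral_left) (auto simp: c'_def)
      also have "\<dots> = (\<Sum>d\<in>K. c d * meval (x(p := 2 * x p)) d) - 2 ^ coef a p * (\<Sum>d\<in>K. c d * meval x d)"
        unfolding scale c'_def sum_distrib_left by (simp add: sum_subtractf[symmetric] algebra_simps)
      also have "\<dots> = 0" using less.prems(2) by simp
      finally show ?thesis .
    qed
    then have "\<forall>d\<in>K - {a}. c' d = 0"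
      using less.hyps[OF card_Diff1_less[OF less.prems(1) ab(1)]] less.prems(1) by blast
    then have "c' b = 0" using ab by blast
    moreover have "(2::complex) ^ coef b p \<noteq> 2 ^ coef a p"
    proof
      assume "(2::complex) ^ coef b p = 2 ^ coef a p"
      then have "norm ((2::complex) ^ coef b p) = norm ((2::complex) ^ coef a p)" by (rule arg_cong)
      then have "(2::real) ^ coef b p = 2 ^ coef a p" by (simp add: norm_power)
      then show False using p by simp
    qed
    ultimately have cb: "c b = 0" by (simp add: c'_def)
    have "(\<Sum>d\<in>K - {b}. c d * meval x d) = 0" for x
      using less.prems sum.remove[OF less.prems(1) ab(2), of "\<lambda>d. c d * meval x d"] cb by simp
    then have "\<forall>d\<in>K - {b}. c d = 0"
      using less.hyps[OF card_Diff1_less[OF less.prems(1) ab(2)]] less.prems(1) by blast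
    then show ?thesis using cb by blast
  qed
qed

section \<open>The values and the multidegree of \<open>f_tilde\<close>\<close>

lemma eval_pol_pfaffian:
  assumes "even d"
  shows "eval_pol (pfaffian (mat d d F)) v = pfaffian (mat d d (\<lambda>ij. eval_pol (F ij) v))"
proof -
  obtain l where l: "d = 2 * l" using assms by blast
  have "p (2 * k) < d" "p (Suc (2 * k)) < d" if "p permutes {..<2 * l}" "k < l" for p k
    using permutes_in_image[OF that(1), of "2 * k"] permutes_in_image[OF that(1), of "Suc (2 * k)"] that(2) l
    by auto
  then show ?thesis
    unfolding pfaffian_def Let_def
    by (auto simp: eval_pol_simps l intro!: sum.cong prod.cong)
qed

lemma eval_pol_det: "eval_pol (Determinant.det (mat d d F)) v = Determinant.det (mat d d (\<lambda>ij. eval_pol (F ij) v))"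
proof -
  have "p i < d" if "p permutes {0..<d}" "i < d" for p i
    using permutes_in_image[OF that(1), of i] that(2) by auto
  then show ?thesis
    unfolding Determinant.det_def by (auto simp: eval_pol_simps intro!: sum.cong prod.cong)
qed

lemma eval_bilin_pol: "eval_pol (bilin_pol n i j) v = bil n (v i) (v j)"
  by (simp add: bilin_pol_def bil_def eval_pol_simps)

lemma eval_pol_zero: "eval_pol 0 v = 0"
  by (simp add: eval_pol_lin)

lemma eval_pf_pol:
  assumes "even (length js)"
  shows "eval_pol (pf_pol n js) v =
    pfaffian (mat (length js) (length js) (\<lambda>(k, l). skew_gram (bil n) (map v js) k l))"
  unfolding pf_pol_def eval_pol_pfaffian[OF assms]
  by (rule arg_cong[where f = pfaffian], rule eq_matI)
    (auto simp: skew_gram_def eval_bilin_pol eval_pol_uminus eval_pol_zero)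

lemma eval_det_pol:
  assumes "length js = n"
  shows "eval_pol (det_pol n js) v = Determinant.det (mat n n (\<lambda>(r, c). v (js ! c) $ r))"
  unfolding det_pol_def eval_pol_det
  by (rule arg_cong[where f = Determinant.det], rule eq_matI) (auto simp: eval_pol_simps)

text \<open>Every value of \<open>f_tilde\<close> is a value of \<open>half_spin\<close>, so the Clifford relation applies to it.\<close>

lemma eval_f_tilde:
  assumes "even n" "even m" "n \<le> m"
  shows "eval_pol (f_tilde n m) v = half_spin n (map v [0..<m])"
proof -
  let ?vs = "map v [0..<m]"
  define l where "l = (m - n) div 2"
  have m: "m = n + 2 * l" using assms unfolding l_def by presburger
  let ?A = "skew_gram (bil n) ?vs" and ?C = "\<lambda>i a. ?vs ! a $ i"
  have fact_pos: "(2 ^ k * fact k :: complex) \<noteq> 0" for k by simp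
  have P: "eval_pol (pf_pol n [0..<m]) v = wick_list (bil n) (\<lambda>i v. v $ i) 0 ?vs"
  proof -
    have "2 ^ (m div 2) * fact (m div 2) * eval_pol (pf_pol n [0..<m]) v = wick 0 (m div 2) ?A ?C"
      using pfaffian_wick[of ?A "m div 2" ?C, OF skew_gram_skew] assms(2)
      by (simp add: eval_pf_pol)
    then show ?thesis using fact_pos[of "m div 2"] by (simp add: wick_list_def Let_def field_simps)
  qed
  let ?K = "{p. p permutes {..<m} \<and> strict_mono_on {..<n} p \<and> strict_mono_on {n..<m} p}"
  have E: "eval_pol (\<Sum>p\<in>?K. of_int (sign p) * det_pol n (map p [0..<n]) * pf_pol n (map p [n..<m])) v =
      wick_list (bil n) (\<lambda>i v. v $ i) n ?vs"
  proof -
    have "eval_pol (\<Sum>p\<in>?K. of_int (sign p) * det_pol n (map p [0..<n]) * pf_pol n (map p [n..<m])) v =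
      (\<Sum>p\<in>?K. of_int (sign p) * Determinant.det (mat n n (\<lambda>(r, c). ?C r (p c))) *
         pfaffian (mat (2 * l) (2 * l) (\<lambda>(i, j). ?A (p (n + i)) (p (n + j)))))"
      unfolding eval_pol_sum eval_pol_mult eval_pol_sign
    proof (intro sum.cong refl arg_cong2[where f = "(*)"])
      fix p assume p: "p \<in> ?K"
      then have lt: "p x < m" if "x < m" for x using permutes_in_image[of p "{..<m}" x] that by simp
      have "mat n n (\<lambda>(r, c). v (map p [0..<n] ! c) $ r) = mat n n (\<lambda>(r, c). ?C r (p c))"
        by (rule eq_matI) (use lt m in auto)
      then show "eval_pol (det_pol n (map p [0..<n])) v = Determinant.det (mat n n (\<lambda>(r, c). ?C r (p c)))"
        by (simp add: eval_det_pol)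
      have "skew_gram (bil n) (map v (map p [n..<m])) i j = ?A (p (n + i)) (p (n + j))"
        if "i < 2 * l" "j < 2 * l" for i j
      proof -
        have "p (n + i) < p (n + j) \<longleftrightarrow> i < j" "p (n + j) < p (n + i) \<longleftrightarrow> j < i"
          using strict_mono_on_less[of "{n..<m}" p "n + i" "n + j"] strict_mono_on_less[of "{n..<m}" p "n + j" "n + i"]
            p that m by auto
        then show ?thesis using that m lt by (simp add: skew_gram_def)
      qed
      then have "mat (2 * l) (2 * l) (\<lambda>(i, j). skew_gram (bil n) (map v (map p [n..<m])) i j) =
          mat (2 * l) (2 * l) (\<lambda>(i, j). ?A (p (n + i)) (p (n + j)))"
        by (intro eq_matI) auto
      then show "eval_pol (pf_pol n (map p [n..<m])) v =
          pfaffian (mat (2 * l) (2 * l) (\<lambda>(i, j). ?A (p (n + i)) (p (n + j))))"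
        by (simp add: eval_pf_pol m)
    qed
    also have "\<dots> = wick n l ?A ?C / (2 ^ l * fact l)"
      unfolding nonzero_eq_divide_eq[OF fact_pos] m
      by (subst mult.commute, rule wick_shuffle, rule skew_gram_skew)
    also have "\<dots> = wick_list (bil n) (\<lambda>i v. v $ i) n ?vs"
      using assms(3) unfolding wick_list_def Let_def l_def by simp
    finally show ?thesis .
  qed
  have "(2::complex) ^ (m div 2 - n div 2 + 1) = 2 ^ (m div 2 + 1) / 2 ^ (n div 2)"
    using power_diff[of "2::complex" "n div 2" "m div 2"] div_le_mono[OF assms(3), of 2] by simp
  then show ?thesis
    unfolding f_tilde_def eval_pol_mult eval_pol_diff P E eval_pol_const
    by (simp add: half_spin_def)
qed

text \<open>The multidegree of a polynomial that is linear in each entry of the list \<open>js\<close>.\<close>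

definition rows :: "nat list \<Rightarrow> nat \<Rightarrow> nat" where
  "rows js i = (\<Sum>x<length js. of_bool (i = js ! x))"

lemma rows_append: "rows (js @ ks) i = rows js i + rows ks i"
proof -
  have "rows (js @ ks) i = (\<Sum>x<length js. of_bool (i = (js @ ks) ! x)) +
      (\<Sum>x = length js..<length js + length ks. of_bool (i = (js @ ks) ! x))"
    unfolding rows_def using sum.atLeastLessThan_concat[of 0 "length js" "length js + length ks" "\<lambda>x. of_bool (i = (js @ ks) ! x) :: nat"]
    by (simp add: atLeast0LessThan del: sum_of_bool_eq)
  also have "(\<Sum>x = length js..<length js + length ks. of_bool (i = (js @ ks) ! x)) = rows ks i"
    unfolding rows_def
    using sum.shift_bounds_nat_ivl[of "\<lambda>x. of_bool (i = (js @ ks) ! x) :: nat" 0 "length js" "length ks"]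
    by (simp add: nth_append add.commute atLeast0LessThan del: sum_of_bool_eq)
  finally show ?thesis by (simp add: rows_def nth_append del: sum_of_bool_eq)
qed

lemma rows_permutation:
  assumes "p permutes {..<m}"
  shows "rows (map p [0..<m]) i = of_bool (i < m)"
proof -
  have "rows (map p [0..<m]) i = (\<Sum>x<m. of_bool (i = p x))"
    unfolding rows_def by (intro sum.cong) auto
  also have "\<dots> = (\<Sum>x<m. of_bool (i = x))"
    using sum.permute[OF assms, of "\<lambda>x. of_bool (i = x) :: nat"] by (simp only: comp_def)
  also have "\<dots> = of_bool (i < m)" by simp
  finally show ?thesis .
qed

lemma sum_pairs: "(\<Sum>k<l. g (2 * k) + g (2 * k + 1)) = (\<Sum>x<2 * l. g x)" for g :: "nat \<Rightarrow> 'a::comm_monoid_add"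
  by (induction l) (simp_all add: add.assoc)

lemma bilin_pol_multihom:
  assumes "even n"
  shows "bilin_pol n i j \<in> multihom n (\<lambda>x. of_bool (x = i) + of_bool (x = j))"
  unfolding bilin_pol_def
proof (rule multihom_sum)
  fix r assume "r \<in> {..<n div 2}"
  then have r: "2 * r < n" "2 * r + 1 < n" by auto
  show "coord i (2 * r) * coord j (2 * r + 1) + coord i (2 * r + 1) * coord j (2 * r)
      \<in> multihom n (\<lambda>x. of_bool (x = i) + of_bool (x = j))"
    using multihom_mult[OF multihom_coord[OF r(1)] multihom_coord[OF r(2)]]
      multihom_mult[OF multihom_coord[OF r(2)] multihom_coord[OF r(1)]]
    by (intro multihom_add)
qed

lemma pf_pol_multihom:
  assumes "even n" "even (length js)"
  shows "pf_pol n js \<in> multihom n (rows js)"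
proof -
  obtain l where l: "length js = 2 * l" using assms by blast
  show ?thesis
    unfolding pf_pol_def pfaffian_def Let_def
  proof (rule multihom_sum, rule multihom_sign_mult)
    let ?F = "\<lambda>(k, l). if k < l then bilin_pol n (js ! k) (js ! l)
               else if l < k then - bilin_pol n (js ! l) (js ! k) else 0"
    let ?M = "mat (length js) (length js) ?F"
    fix p assume "p \<in> {p. p permutes {..<2 * (dim_row ?M div 2)} \<and>
          (\<forall>k<dim_row ?M div 2. p (2 * k) < p (2 * k + 1)) \<and>
          strict_mono_on {..<dim_row ?M div 2} (\<lambda>k. p (2 * k))}"
    then have p: "p permutes {..<2 * l}" by (simp add: l)
    have lt: "p (2 * k) < 2 * l" "p (2 * k + 1) < 2 * l" if "k < l" for k
      using permutes_in_image[OF p, of "2 * k"] permutes_in_image[OF p, of "2 * k + 1"] that by auto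
    have "?M $$ (p (2 * k), p (2 * k + 1)) \<in>
        multihom n (\<lambda>x. of_bool (x = js ! p (2 * k)) + of_bool (x = js ! p (2 * k + 1)))"
      if "k < l" for k
      using lt[OF that] bilin_pol_multihom[OF assms(1), of "js ! p (2 * k)" "js ! p (2 * k + 1)"]
        bilin_pol_multihom[OF assms(1), of "js ! p (2 * k + 1)" "js ! p (2 * k)"]
      by (auto simp: l multihom_uminus multihom_0 add.commute)
    then have "(\<Prod>k<l. ?M $$ (p (2 * k), p (2 * k + 1))) \<in>
        multihom n (\<lambda>x. \<Sum>k<l. of_bool (x = js ! p (2 * k)) + of_bool (x = js ! p (2 * k + 1)))"
      by (intro multihom_prod) simp
    also have "(\<lambda>x. \<Sum>k<l. of_bool (x = js ! p (2 * k)) + of_bool (x = js ! p (2 * k + 1))) = rows js"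
    proof
      fix x
      have "(\<Sum>k<l. of_bool (x = js ! p (2 * k)) + of_bool (x = js ! p (2 * k + 1))) =
          (\<Sum>y<2 * l. of_bool (x = js ! p y) :: nat)"
        by (rule sum_pairs[of "\<lambda>y. of_bool (x = js ! p y)"])
      also have "\<dots> = rows js x"
        using sum.permute[OF p, of "\<lambda>y. of_bool (x = js ! y) :: nat"] by (simp add: rows_def l comp_def del: sum_of_bool_eq)
      finally show "(\<Sum>k<l. of_bool (x = js ! p (2 * k)) + of_bool (x = js ! p (2 * k + 1))) = rows js x" .
    qed
    finally show "(\<Prod>k<dim_row ?M div 2. ?M $$ (p (2 * k), p (2 * k + 1))) \<in> multihom n (rows js)"
      by (simp add: l)
  qed
qed

lemma det_pol_multihom:
  assumes "length js = n"
  shows "det_pol n js \<in> multihom n (rows js)"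
proof -
  have "(\<Sum>p | p permutes {0..<n}. of_int (sign p) * (\<Prod>i = 0..<n. mat n n (\<lambda>(r, c). coord (js ! c) r) $$ (i, p i)))
      \<in> multihom n (rows js)"
  proof (rule multihom_sum, rule multihom_sign_mult)
    fix p assume "p \<in> {p. p permutes {0..<n}}"
    then have p: "p permutes {0..<n}" by simp
    have "mat n n (\<lambda>(r, c). coord (js ! c) r) $$ (i, p i) \<in> multihom n (\<lambda>x. of_bool (x = js ! p i))"
      if "i \<in> {0..<n}" for i
      using that permutes_in_image[OF p, of i] by (simp add: multihom_coord)
    then have "(\<Prod>i = 0..<n. mat n n (\<lambda>(r, c). coord (js ! c) r) $$ (i, p i)) \<in>
        multihom n (\<lambda>x. \<Sum>i = 0..<n. of_bool (x = js ! p i))"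
      by (rule multihom_prod)
    also have "(\<lambda>x. \<Sum>i = 0..<n. of_bool (x = js ! p i)) = rows js"
      using sum.permute[OF p, of "\<lambda>y. of_bool (x = js ! y) :: nat" for x]
      by (auto simp: rows_def comp_def assms atLeast0LessThan fun_eq_iff simp del: sum_of_bool_eq)
    finally show "(\<Prod>i = 0..<n. mat n n (\<lambda>(r, c). coord (js ! c) r) $$ (i, p i)) \<in> multihom n (rows js)" .
  qed
  then show ?thesis by (simp add: det_pol_def Determinant.det_def)
qed

lemma f_tilde_multihom:
  assumes "even n" "even m" "n \<le> m"
  shows "f_tilde n m \<in> multihom n (\<lambda>i. of_bool (i < m))"
  unfolding f_tilde_def
proof (intro multihom_const_mult multihom_diff multihom_sum)
  have id: "rows [0..<m] = (\<lambda>i. of_bool (i < m))"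
    using rows_permutation[OF permutes_id] by (auto simp: fun_eq_iff)
  show "pf_pol n [0..<m] \<in> multihom n (\<lambda>i. of_bool (i < m))"
    using pf_pol_multihom[of n "[0..<m]"] assms id by simp
  fix p assume "p \<in> {p. p permutes {..<m} \<and> strict_mono_on {..<n} p \<and> strict_mono_on {n..<m} p}"
  then have p: "p permutes {..<m}" by simp
  have "[0..<m] = [0..<n] @ [n..<m]" using assms upt_add_eq_append[of 0 n "m - n"] by simp
  then have r: "rows (map p [0..<n]) i + rows (map p [n..<m]) i = of_bool (i < m)" for i
    using rows_permutation[OF p, of i] by (simp add: rows_append)
  have "of_int (sign p) * (det_pol n (map p [0..<n]) * pf_pol n (map p [n..<m])) \<in>
      multihom n (\<lambda>i. rows (map p [0..<n]) i + rows (map p [n..<m]) i)"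
    using assms by (intro multihom_sign_mult multihom_mult det_pol_multihom pf_pol_multihom) auto
  then show "of_int (sign p) * det_pol n (map p [0..<n]) * pf_pol n (map p [n..<m]) \<in>
      multihom n (\<lambda>i. of_bool (i < m))"
    unfolding r by (simp add: mult.assoc)
qed

section \<open>The special orthogonal group\<close>

lemma bil_polarize:
  assumes "v \<in> carrier_vec n" "w \<in> carrier_vec n"
  shows "bil n v w = quad_form n (v + w) - quad_form n v - quad_form n w"
proof -
  have "(v + w) $ (2 * r) = v $ (2 * r) + w $ (2 * r)"
    "(v + w) $ (2 * r + 1) = v $ (2 * r + 1) + w $ (2 * r + 1)" if "r < n div 2" for r
    using that assms by auto
  then show ?thesis
    unfolding bil_def quad_form_def sum_subtractf[symmetric]
    by (intro sum.cong) (simp_all add: algebra_simps)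
qed

lemma bil_preserved:
  assumes A: "A \<in> carrier_mat n n" and q: "\<And>v. v \<in> carrier_vec n \<Longrightarrow> quad_form n (A *\<^sub>v v) = quad_form n v"
    and v: "v \<in> carrier_vec n" "w \<in> carrier_vec n"
  shows "bil n (A *\<^sub>v v) (A *\<^sub>v w) = bil n v w"
proof -
  have "A *\<^sub>v v \<in> carrier_vec n" "A *\<^sub>v w \<in> carrier_vec n" using A v by auto
  then show ?thesis
    using q[OF v(1)] q[OF v(2)] q[of "v + w"] v mult_add_distrib_mat_vec[OF A v]
    by (simp add: bil_polarize)
qed

definition gram_mat :: "nat \<Rightarrow> complex mat" where
  "gram_mat n = mat n n (\<lambda>(i, j). of_bool (i = partner j))"

lemma gram_mat_carrier [simp]: "gram_mat n \<in> carrier_mat n n"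
  by (simp add: gram_mat_def)

lemma gram_mat_mult:
  assumes "even n" "A \<in> carrier_mat n n" "i < n" "j < n"
  shows "(gram_mat n * A) $$ (i, j) = A $$ (partner i, j)"
proof -
  have "(gram_mat n * A) $$ (i, j) = (\<Sum>k = 0..<n. of_bool (i = partner k) * A $$ (k, j))"
    using assms by (simp add: gram_mat_def scalar_prod_def)
  also have "\<dots> = (\<Sum>k = 0..<n. if k = partner i then A $$ (partner i, j) else 0)"
    by (intro sum.cong) auto
  also have "\<dots> = A $$ (partner i, j)"
    using partner_less[OF assms(1,3)] by simp
  finally show ?thesis .
qed

lemma gram_mat_square: "even n \<Longrightarrow> gram_mat n * gram_mat n = 1\<^sub>m n"
proof (rule eq_matI)
  fix i j assume "even n" "i < dim_row (1\<^sub>m n)" "j < dim_col (1\<^sub>m n)"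
  then show "(gram_mat n * gram_mat n) $$ (i, j) = 1\<^sub>m n $$ (i, j)"
    using partner_less[of n i] by (simp add: gram_mat_mult) (auto simp: gram_mat_def, (metis partner_simps(3))+)
qed (simp_all add: gram_mat_def)

text \<open>The matrix form of the invariance of the polar form; it provides an inverse of \<open>A\<close> and the square of
  its determinant.\<close>

lemma gram_preserved:
  assumes n: "even n" and A: "A \<in> carrier_mat n n" and q: "\<And>v. v \<in> carrier_vec n \<Longrightarrow> quad_form n (A *\<^sub>v v) = quad_form n v"
  shows "transpose_mat A * (gram_mat n * A) = gram_mat n"
proof (rule eq_matI)
  fix i j assume "i < dim_row (gram_mat n)" "j < dim_col (gram_mat n)"
  then have ij: "i < n" "j < n" by (simp_all add: gram_mat_def)
  have col: "A *\<^sub>v unit_vec n k = col A k" if "k < n" for k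
    using A that by (intro eq_vecI) (simp_all add: scalar_prod_right_unit)
  have GA: "gram_mat n * A \<in> carrier_mat n n" by (rule mult_carrier_mat[OF gram_mat_carrier A])
  have "(transpose_mat A * (gram_mat n * A)) $$ (i, j) = (\<Sum>k<n. A $$ (k, i) * (gram_mat n * A) $$ (k, j))"
  proof -
    define G where "G = gram_mat n * A"
    have "G \<in> carrier_mat n n" using GA by (simp add: G_def)
    then show ?thesis
      unfolding G_def[symmetric] using A ij by (simp add: scalar_prod_def atLeast0LessThan)
  qed
  also have "\<dots> = (\<Sum>k<2 * (n div 2). A $$ (k, i) * A $$ (partner k, j))"
    using n A ij by (intro sum.cong) (auto simp: gram_mat_mult)
  also have "\<dots> = bil n (col A i) (col A j)"
    unfolding bil_def sum_pairs[symmetric] using A ij by (intro sum.cong) auto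
  also have "\<dots> = bil n (unit_vec n i) (unit_vec n j)"
    using bil_preserved[OF A q, of "unit_vec n i" "unit_vec n j"] col ij by simp
  also have "\<dots> = gram_mat n $$ (i, j)"
    using n ij by (simp add: bil_unit_unit gram_mat_def)
  finally show "(transpose_mat A * (gram_mat n * A)) $$ (i, j) = gram_mat n $$ (i, j)" .
qed (use A in \<open>simp_all add: gram_mat_def\<close>)

lemma orthogonal_groupI:
  assumes n: "even n" and A: "A \<in> carrier_mat n n" and q: "\<And>v. v \<in> carrier_vec n \<Longrightarrow> quad_form n (A *\<^sub>v v) = quad_form n v"
  shows "A \<in> orthogonal_group n"
proof -
  let ?J = "gram_mat n"
  let ?B = "?J * transpose_mat A * ?J"
  have B: "?B \<in> carrier_mat n n" using A by (intro mult_carrier_mat[where n = n] gram_mat_carrier) auto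
  have T: "transpose_mat A \<in> carrier_mat n n" using A by simp
  have "?B * A = ?J * (transpose_mat A * (?J * A))"
    by (simp only: assoc_mult_mat[OF mult_carrier_mat[OF gram_mat_carrier T] gram_mat_carrier A]
        assoc_mult_mat[OF gram_mat_carrier T mult_carrier_mat[OF gram_mat_carrier A]])
  also have "\<dots> = ?J * ?J" using gram_preserved[OF n A q] by simp
  also have "\<dots> = 1\<^sub>m n" by (rule gram_mat_square[OF n])
  finally have BA: "?B * A = 1\<^sub>m n" .
  have AB: "A * ?B = 1\<^sub>m n" by (rule mat_mult_left_right_inverse[OF B A BA])
  have "invertible_mat A"
    unfolding invertible_mat_def inverts_mat_def using A B AB BA by (auto intro!: exI[of _ ?B])
  then show ?thesis using A q by (simp add: orthogonal_group_def)
qed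

lemma orthogonal_groupD:
  assumes "A \<in> orthogonal_group n"
  shows "A \<in> carrier_mat n n" "\<And>v. v \<in> carrier_vec n \<Longrightarrow> quad_form n (A *\<^sub>v v) = quad_form n v"
  using assms by (auto simp: orthogonal_group_def)

lemma orthogonal_det:
  assumes n: "even n" and A: "A \<in> orthogonal_group n"
  shows "Determinant.det A \<in> {1, - 1}"
proof -
  let ?J = "gram_mat n"
  note A' = orthogonal_groupD[OF A]
  have "Determinant.det ?J * Determinant.det ?J = 1"
    using det_mult[OF gram_mat_carrier gram_mat_carrier, of n] gram_mat_square[OF n] by (simp add: det_one)
  then have nz: "Determinant.det ?J \<noteq> 0" by auto
  have "Determinant.det (transpose_mat A * (?J * A)) = Determinant.det A * (Determinant.det ?J * Determinant.det A)"
    using A'(1) by (simp add: det_mult[where n = n] det_transpose mult_carrier_mat[where n = n])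
  then have "Determinant.det A * Determinant.det A = 1"
    using nz by (simp add: gram_preserved[OF n A'])
  then have "(Determinant.det A - 1) * (Determinant.det A + 1) = 0" by (simp add: algebra_simps)
  then show ?thesis by (auto simp: add_eq_0_iff2)
qed

lemma continuous_map_entry:
  assumes "i < n" "j < n"
  shows "continuous_map (mat_topology n) euclidean (\<lambda>A. A $$ (i, j))"
proof -
  have "continuous_map (mat_topology n) euclidean
      ((\<lambda>x. x (i, j)) \<circ> (\<lambda>A. restrict (\<lambda>p. A $$ p) ({..<n} \<times> {..<n})))"
    unfolding mat_topology_def
    by (rule continuous_map_pullback[OF continuous_map_product_projection]) (use assms in simp)
  then show ?thesis using assms by (simp add: comp_def)
qed

lemma continuous_map_det: "continuous_map (mat_topology n) euclidean Determinant.det"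
proof (rule continuous_map_eq)
  show "continuous_map (mat_topology n) euclidean
      (\<lambda>A. \<Sum>p | p permutes {0..<n}. of_int (sign p) * (\<Prod>i = 0..<n. A $$ (i, p i)))"
    unfolding continuous_map_atin limitin_canonical_iff
  proof (intro ballI tendsto_sum tendsto_mult tendsto_prod tendsto_const)
    fix A p i assume A: "A \<in> topspace (mat_topology n)" and p: "p \<in> {p. p permutes {0..<n}}" and "i \<in> {0..<n}"
    then have "i < n" "p i < n" using permutes_in_image[of p "{0..<n}" i] by auto
    then show "((\<lambda>A. A $$ (i, p i)) \<longlongrightarrow> A $$ (i, p i)) (atin (mat_topology n) A)"
      using continuous_map_entry A unfolding continuous_map_atin limitin_canonical_iff by blast
  qed
  fix A :: "complex mat" assume "A \<in> topspace (mat_topology n)"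
  then have "A \<in> carrier_mat n n" by (simp add: mat_topology_def topspace_pullback_topology)
  then show "(\<Sum>p | p permutes {0..<n}. of_int (sign p) * (\<Prod>i = 0..<n. A $$ (i, p i))) = Determinant.det A"
    by (simp add: Determinant.det_def)
qed

text \<open>The determinant is continuous and takes the values \<open>1\<close> and \<open>- 1\<close> only, hence it is constant on the
  component of the identity.\<close>

lemma special_orthogonal_group_det:
  assumes n: "even n" and A: "A \<in> special_orthogonal_group n"
  shows "A \<in> orthogonal_group n" "Determinant.det A = 1"
proof -
  obtain T where T: "connectedin (subtopology (mat_topology n) (orthogonal_group n)) T" "1\<^sub>m n \<in> T" "A \<in> T"
    using A by (auto simp: special_orthogonal_group_def connected_component_of_def)
  then have sub: "T \<subseteq> orthogonal_group n" by (auto simp: connectedin_subtopology)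
  then show "A \<in> orthogonal_group n" using T by blast
  have "connectedin (mat_topology n) T" using T by (simp add: connectedin_subtopology)
  then have conn: "connected (Determinant.det ` T)"
    using connectedin_continuous_map_image[OF continuous_map_det] by fastforce
  have "1 \<in> Determinant.det ` T" using T(2) by (metis det_one image_eqI)
  moreover have "Determinant.det ` T \<subseteq> {1} \<union> {- 1}" using sub orthogonal_det[OF n] by auto
  ultimately have "{- 1} \<inter> Determinant.det ` T = {}"
    using connected_closedD[OF conn, of "{1}" "{- 1}"] by auto
  then have "Determinant.det A \<noteq> - 1" using imageI[OF T(3), of Determinant.det] by auto
  then show "Determinant.det A = 1" using sub orthogonal_det[OF n, of A] T(3) by auto
qed

lemma bil_special_orthogonal:
  assumes "even n" "A \<in> special_orthogonal_group n" "v \<in> carrier_vec n" "w \<in> carrier_vec n"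
  shows "bil n (A *\<^sub>v v) (A *\<^sub>v w) = bil n v w"
  using bil_preserved[OF orthogonal_groupD[OF special_orthogonal_group_det(1)[OF assms(1,2)]]] assms by blast

definition swap_pairs :: "nat \<Rightarrow> nat \<Rightarrow> nat \<Rightarrow> nat" where
  "swap_pairs r s k = (if k div 2 \<in> {r, s} then partner k else k)"

text \<open>In the coordinates \<open>x\<^sub>r \<plusminus> y\<^sub>r\<close> the form is diagonal, and exchanging \<open>x\<^sub>r\<close> with \<open>y\<^sub>r\<close> is a reflection. The
  product of two such reflections, for \<open>r\<close> and \<open>s\<close>, is the rotation by \<open>\<pi>\<close> in the plane of the two
  coordinates \<open>x\<^sub>r - y\<^sub>r\<close> and \<open>x\<^sub>s - y\<^sub>s\<close>. The path consists of the rotations by \<open>\<theta>\<close>.\<close>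

definition swap_path :: "nat \<Rightarrow> nat \<Rightarrow> nat \<Rightarrow> real \<Rightarrow> complex mat" where
  "swap_path n r s \<theta> = mat n n (\<lambda>(i, j).
     let \<epsilon> = (if even i \<longleftrightarrow> even j then 1 else - 1) in
     if i div 2 \<noteq> r \<and> i div 2 \<noteq> s then of_bool (i = j)
     else if i div 2 = j div 2 then (1 + \<epsilon> * of_real (cos \<theta>)) / 2
     else if i div 2 = r \<and> j div 2 = s then - \<epsilon> * of_real (sin \<theta>) / 2
     else if i div 2 = s \<and> j div 2 = r then \<epsilon> * of_real (sin \<theta>) / 2
     else 0)"

lemma swap_path_carrier: "swap_path n r s \<theta> \<in> carrier_mat n n"
  by (simp add: swap_path_def)

lemma swap_path_apply:
  fixes \<theta> :: real
  assumes n: "even n" and rs: "r \<noteq> s" "r < n div 2" "s < n div 2" and v: "v \<in> carrier_vec n"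
  defines "w \<equiv> swap_path n r s \<theta> *\<^sub>v v"
  defines "c \<equiv> complex_of_real (cos \<theta>)" and "d \<equiv> complex_of_real (sin \<theta>)"
  shows "k < n \<Longrightarrow> k div 2 \<noteq> r \<Longrightarrow> k div 2 \<noteq> s \<Longrightarrow> w $ k = v $ k"
    and "w $ (2 * r) = ((1 + c) * v $ (2 * r) + (1 - c) * v $ Suc (2 * r)
      - d * v $ (2 * s) + d * v $ Suc (2 * s)) / 2"
    and "w $ Suc (2 * r) = ((1 - c) * v $ (2 * r) + (1 + c) * v $ Suc (2 * r)
      + d * v $ (2 * s) - d * v $ Suc (2 * s)) / 2"
    and "w $ (2 * s) = ((1 + c) * v $ (2 * s) + (1 - c) * v $ Suc (2 * s)
      + d * v $ (2 * r) - d * v $ Suc (2 * r)) / 2"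
    and "w $ Suc (2 * s) = ((1 - c) * v $ (2 * s) + (1 + c) * v $ Suc (2 * s)
      - d * v $ (2 * r) + d * v $ Suc (2 * r)) / 2"
proof -
  let ?A = "swap_path n r s \<theta>"
  have lt: "2 * r < n" "Suc (2 * r) < n" "2 * s < n" "Suc (2 * s) < n" using rs by auto
  have dot: "w $ k = (\<Sum>j<n. ?A $$ (k, j) * v $ j)" if "k < n" for k
    using that v carrier_matD[OF swap_path_carrier[of n r s \<theta>]]
    unfolding w_def by (simp add: scalar_prod_def atLeast0LessThan)
  have entry: "w $ k = (\<Sum>b<n div 2. ?A $$ (k, 2 * b) * v $ (2 * b) + ?A $$ (k, Suc (2 * b)) * v $ Suc (2 * b))"
    if "k < n" for k
  proof -
    have "w $ k = (\<Sum>j<2 * (n div 2). ?A $$ (k, j) * v $ j)"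
      using dot[OF that] n by simp
    then show ?thesis unfolding sum_pairs[symmetric] by simp
  qed
  have two: "(\<Sum>b<n div 2. f b) = f r + f s" if "\<And>b. b < n div 2 \<Longrightarrow> b \<noteq> r \<Longrightarrow> b \<noteq> s \<Longrightarrow> f b = 0" for f :: "nat \<Rightarrow> complex"
  proof -
    have "(\<Sum>b<n div 2. f b) = (\<Sum>b\<in>{r, s}. f b)"
      using that rs by (intro sum.mono_neutral_right) auto
    then show ?thesis using rs by simp
  qed
  have blt: "2 * b < n" "Suc (2 * b) < n" if "b < n div 2" for b using that by auto
  show "w $ k = v $ k" if k: "k < n" "k div 2 \<noteq> r" "k div 2 \<noteq> s"
  proof -
    have "w $ k = (\<Sum>j<n. ?A $$ (k, j) * v $ j)" by (rule dot[OF k(1)])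
    also have "\<dots> = (\<Sum>j<n. if j = k then v $ k else 0)"
      using k by (intro sum.cong) (auto simp: swap_path_def Let_def)
    finally show ?thesis using k by simp
  qed
  have row: "w $ k = (?A $$ (k, 2 * r) * v $ (2 * r) + ?A $$ (k, Suc (2 * r)) * v $ Suc (2 * r)) +
      (?A $$ (k, 2 * s) * v $ (2 * s) + ?A $$ (k, Suc (2 * s)) * v $ Suc (2 * s))"
    if "k < n" "k div 2 = r \<or> k div 2 = s" for k
    unfolding entry[OF that(1)]
  proof (rule two)
    fix b assume b: "b < n div 2" "b \<noteq> r" "b \<noteq> s"
    have "?A $$ (k, 2 * b) = 0" "?A $$ (k, Suc (2 * b)) = 0"
      using that blt[OF b(1)] b(2,3) by (auto simp: swap_path_def)
    then show "?A $$ (k, 2 * b) * v $ (2 * b) + ?A $$ (k, Suc (2 * b)) * v $ Suc (2 * b) = 0" by simp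
  qed
  have entry_same: "?A $$ (k, j) = (1 + (if even k \<longleftrightarrow> even j then 1 else - 1) * c) / 2"
    if "k < n" "j < n" "k div 2 = j div 2" "k div 2 = r \<or> k div 2 = s" for k j
    using that by (auto simp: swap_path_def c_def)
  have entry_rs: "?A $$ (k, j) = - (if even k \<longleftrightarrow> even j then 1 else - 1) * d / 2"
    if "k < n" "j < n" "k div 2 = r" "j div 2 = s" for k j
    using that rs by (auto simp: swap_path_def d_def)
  have entry_sr: "?A $$ (k, j) = (if even k \<longleftrightarrow> even j then 1 else - 1) * d / 2"
    if "k < n" "j < n" "k div 2 = s" "j div 2 = r" for k j
    using that rs by (auto simp: swap_path_def d_def)
  show "w $ (2 * r) = ((1 + c) * v $ (2 * r) + (1 - c) * v $ Suc (2 * r)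
      - d * v $ (2 * s) + d * v $ Suc (2 * s)) / 2"
    using lt rs by (subst row[OF lt(1)]) (simp_all add: entry_same entry_rs entry_sr field_simps)
  show "w $ Suc (2 * r) = ((1 - c) * v $ (2 * r) + (1 + c) * v $ Suc (2 * r)
      + d * v $ (2 * s) - d * v $ Suc (2 * s)) / 2"
    using lt rs by (subst row[OF lt(2)]) (simp_all add: entry_same entry_rs entry_sr field_simps)
  show "w $ (2 * s) = ((1 + c) * v $ (2 * s) + (1 - c) * v $ Suc (2 * s)
      + d * v $ (2 * r) - d * v $ Suc (2 * r)) / 2"
    using lt rs by (subst row[OF lt(3)]) (simp_all add: entry_same entry_rs entry_sr field_simps)
  show "w $ Suc (2 * s) = ((1 - c) * v $ (2 * s) + (1 + c) * v $ Suc (2 * s)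
      - d * v $ (2 * r) + d * v $ Suc (2 * r)) / 2"
    using lt rs by (subst row[OF lt(4)]) (simp_all add: entry_same entry_rs entry_sr field_simps)
qed

text \<open>With \<open>p = a - b\<close> and \<open>q = x - y\<close>, the four times larger form is \<open>(a + b)\<^sup>2 + (x + y)\<^sup>2 - p\<^sup>2 - q\<^sup>2\<close>, and the map
  rotates \<open>(p, q)\<close>.\<close>

lemma hyperbolic_rotation:
  fixes a b c d x y :: complex
  assumes "d * d = 1 - c * c"
  shows "((1 + c) * a + (1 - c) * b - d * x + d * y) * ((1 - c) * a + (1 + c) * b + d * x - d * y) +
    ((1 + c) * x + (1 - c) * y + d * a - d * b) * ((1 - c) * x + (1 + c) * y - d * a + d * b) =
    4 * (a * b + x * y)"
proof -
  define p where "p = a - b"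
  define q where "q = x - y"
  have "((1 + c) * a + (1 - c) * b - d * x + d * y) * ((1 - c) * a + (1 + c) * b + d * x - d * y) +
    ((1 + c) * x + (1 - c) * y + d * a - d * b) * ((1 - c) * x + (1 + c) * y - d * a + d * b) =
    (a + b) * (a + b) + (x + y) * (x + y) - (c * c + d * d) * (p * p + q * q)"
    unfolding p_def q_def by (simp add: algebra_simps)
  also have "\<dots> = 4 * (a * b + x * y)"
    unfolding assms p_def q_def by (simp add: algebra_simps)
  finally show ?thesis .
qed

lemma swap_path_orthogonal:
  assumes n: "even n" and rs: "r \<noteq> s" "r < n div 2" "s < n div 2"
  shows "swap_path n r s \<theta> \<in> orthogonal_group n"
proof (rule orthogonal_groupI[OF n swap_path_carrier])
  fix v :: "complex vec" assume v: "v \<in> carrier_vec n"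
  let ?w = "swap_path n r s \<theta> *\<^sub>v v"
  define c where "c = complex_of_real (cos \<theta>)"
  define d where "d = complex_of_real (sin \<theta>)"
  note app = swap_path_apply[OF n rs v, where \<theta> = \<theta>, folded c_def d_def]
  have cd: "d * d = 1 - c * c"
  proof -
    have "complex_of_real (cos \<theta> * cos \<theta> + sin \<theta> * sin \<theta>) = 1"
      by (simp only: sin_cos_squared_add3 of_real_1)
    then show ?thesis unfolding c_def d_def of_real_add of_real_mult by (simp add: eq_diff_eq add.commute)
  qed
  have split: "(\<Sum>b<n div 2. f b) = f r + f s + (\<Sum>b\<in>{..<n div 2} - {r} - {s}. f b)" for f :: "nat \<Rightarrow> complex"
    using rs by (subst sum.remove[of _ r], simp, simp, subst sum.remove[of _ s]) auto
  have rest: "(\<Sum>b\<in>{..<n div 2} - {r} - {s}. ?w $ (2 * b) * ?w $ (2 * b + 1)) =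
     (\<Sum>b\<in>{..<n div 2} - {r} - {s}. v $ (2 * b) * v $ (2 * b + 1))"
    using app(1) by (intro sum.cong) auto
  have "?w $ (2 * r) * ?w $ (2 * r + 1) + ?w $ (2 * s) * ?w $ (2 * s + 1) =
     v $ (2 * r) * v $ (2 * r + 1) + v $ (2 * s) * v $ (2 * s + 1)"
    unfolding Suc_eq_plus1[symmetric] app(2-) times_divide_times_eq add_divide_distrib[symmetric]
      hyperbolic_rotation[OF cd] by simp
  then show "quad_form n ?w = quad_form n v"
    unfolding quad_form_def split rest by simp
qed

lemma swap_path_continuous:
  "continuous_map euclidean (mat_topology n) (swap_path n r s)"
  unfolding mat_topology_def
proof (rule continuous_map_pullback')
  show "topspace euclidean \<subseteq> swap_path n r s -` carrier_mat n n"
    using swap_path_carrier by auto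
  have "continuous_on UNIV (\<lambda>\<theta>. swap_path n r s \<theta> $$ (i, j))" if "i < n" "j < n" for i j
  proof -
    have if_const: "continuous_on UNIV (\<lambda>\<theta>. if P then f \<theta> else g \<theta>)"
      if "continuous_on UNIV f" "continuous_on UNIV g" for P and f g :: "real \<Rightarrow> complex"
      using that by (cases P) simp_all
    show ?thesis
      using that unfolding swap_path_def Let_def
      by (simp only: index_mat split_conv) (intro if_const continuous_intros; simp)
  qed
  then show "continuous_map euclidean (product_topology (\<lambda>_. euclidean) ({..<n} \<times> {..<n}))
      ((\<lambda>A. restrict (\<lambda>p. A $$ p) ({..<n} \<times> {..<n})) \<circ> swap_path n r s)"
    by (auto simp: continuous_map_componentwise comp_def)
qed

lemma swap_pairs_special_orthogonal:
  assumes n: "even n" and rs: "r \<noteq> s" "r < n div 2" "s < n div 2"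
  obtains A where "A \<in> special_orthogonal_group n"
    "\<And>v. v \<in> carrier_vec n \<Longrightarrow> A *\<^sub>v v = vec n (\<lambda>k. v $ swap_pairs r s k)"
proof
  let ?X = "subtopology (mat_topology n) (orthogonal_group n)"
  have "continuous_map euclidean ?X (swap_path n r s)"
    using swap_path_continuous swap_path_orthogonal[OF n rs] by (auto simp: continuous_map_in_subtopology)
  then have "connectedin ?X (swap_path n r s ` UNIV)"
    by (rule connectedin_continuous_map_image) simp
  moreover have "swap_path n r s 0 = 1\<^sub>m n"
  proof (rule eq_matI)
    fix i j assume "i < dim_row (1\<^sub>m n)" "j < dim_col (1\<^sub>m n)"
    moreover have "(even i \<longleftrightarrow> even j) \<longleftrightarrow> i = j" if "i div 2 = j div 2" using that by presburger
    ultimately show "swap_path n r s 0 $$ (i, j) = 1\<^sub>m n $$ (i, j)"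
      by (cases "i = j"; cases "i div 2 = j div 2") (simp_all add: swap_path_def Let_def)
  qed (simp_all add: swap_path_def)
  then have "1\<^sub>m n \<in> swap_path n r s ` UNIV" by (metis rangeI)
  ultimately show "swap_path n r s pi \<in> special_orthogonal_group n"
    unfolding special_orthogonal_group_def connected_component_of_def by blast
  fix v :: "complex vec" assume v: "v \<in> carrier_vec n"
  show "swap_path n r s pi *\<^sub>v v = vec n (\<lambda>k. v $ swap_pairs r s k)"
  proof (rule eq_vecI)
    fix k assume "k < dim_vec (vec n (\<lambda>k. v $ swap_pairs r s k))"
    then have k: "k < n" by simp
    note app = swap_path_apply[OF n rs v, where \<theta> = pi]
    have "k = 2 * (k div 2) \<or> k = Suc (2 * (k div 2))" by presburger
    then obtain b where b: "k = 2 * b \<or> k = Suc (2 * b)" by blast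
    show "(swap_path n r s pi *\<^sub>v v) $ k = vec n (\<lambda>k. v $ swap_pairs r s k) $ k"
    proof (cases "k div 2 = r \<or> k div 2 = s")
      case True
      have "swap_pairs r s k = partner k" using True by (simp add: swap_pairs_def)
      then show ?thesis using True b k app(2-) by (elim disjE) simp_all
    next
      case False
      then show ?thesis using app(1)[OF k] k by (simp add: swap_pairs_def)
    qed
  qed (simp add: swap_path_def)
qed

section \<open>\<open>f_tilde\<close> is a multilinear integer invariant\<close>

lemma multihom_multilinear:
  assumes f: "f \<in> multihom n (\<lambda>i. of_bool (i < m))"
  shows "multilinear_pol n m f"
  unfolding multilinear_pol_def
proof (intro allI impI ballI)
  fix i and v :: "nat \<Rightarrow> complex vec" and u w :: "complex vec" and c d :: complex
  assume i: "i < m" and u: "u \<in> carrier_vec n" and w: "w \<in> carrier_vec n"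
  have "meval (coords (v(i := c \<cdot>\<^sub>v u + d \<cdot>\<^sub>v w))) a =
      c * meval (coords (v(i := u))) a + d * meval (coords (v(i := w))) a" if a: "a \<in> keys f" for a
  proof -
    have "rowdeg a i = 1" using f a i by (simp add: multihom_def)
    then obtain k where k: "\<And>l. coef a (i, l) = of_bool (l = k)" by (rule rowdeg_1D) blast
    have ka: "(i, k) \<in> keys a" by (simp add: in_keys_iff k)
    then have "k < n" using f a by (auto simp: multihom_def)
    define R where "R = (\<Prod>p\<in>keys a - {(i, k)}. coords v p ^ coef a p)"
    have "meval (coords (v(i := z))) a = z $ k * R" for z
    proof -
      have "(\<Prod>p\<in>keys a - {(i, k)}. coords (v(i := z)) p ^ coef a p) = R"
        unfolding R_def
      proof (intro prod.cong refl)
        fix p assume p: "p \<in> keys a - {(i, k)}"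
        then have "fst p \<noteq> i" using k[of "snd p"] by (cases p) (auto simp: in_keys_iff)
        then show "coords (v(i := z)) p ^ coef a p = coords v p ^ coef a p"
          by (simp add: coords_def case_prod_beta)
      qed
      then show ?thesis
        unfolding meval_def prod.remove[OF finite_keys ka] by (simp add: k coords_def)
    qed
    moreover have "(c \<cdot>\<^sub>v u + d \<cdot>\<^sub>v w) $ k = c * u $ k + d * w $ k" using \<open>k < n\<close> u w by simp
    ultimately show ?thesis by (simp only: distrib_right mult.assoc)
  qed
  then show "eval_pol f (v(i := c \<cdot>\<^sub>v u + d \<cdot>\<^sub>v w)) = c * eval_pol f (v(i := u)) + d * eval_pol f (v(i := w))"
    unfolding eval_pol_lin lin_def sum_distrib_left sum.distrib[symmetric]
    by (intro sum.cong refl) (simp only: distrib_left mult.left_commute)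
qed

lemma multihom_poly_ring:
  assumes f: "f \<in> multihom n (\<lambda>i. of_bool (i < m))"
  shows "f \<in> poly_ring n m"
  unfolding poly_ring_def
proof (intro CollectI ballI subsetI)
  fix a p assume a: "a \<in> keys f" and p: "p \<in> keys a"
  obtain i k where ik: "p = (i, k)" by (cases p)
  have "0 < rowdeg a i" using p ik rowdeg_pos_iff by blast
  then have "i < m" using f a by (auto simp: multihom_def split: if_splits)
  then show "p \<in> {..<m} \<times> {..<n}" using f a p ik by (auto simp: multihom_def)
qed

lemma total_degree_multihom:
  assumes f: "f \<in> multihom n (\<lambda>i. of_bool (i < m))"
  shows "total_degree f \<le> m"
proof -
  have "(\<Sum>p\<in>keys a. coef a p) = m" if "a \<in> keys f" for a
  proof -
    have r: "rowdeg a i = of_bool (i < m)" for i using f that by (simp add: multihom_def)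
    have "(\<Sum>p\<in>keys a. coef a p) = (\<Sum>i<m. rowdeg a i)"
      by (rule degree_rowdeg) (simp add: r)
    also have "\<dots> = (\<Sum>i<m. 1)" by (intro sum.cong) (auto simp: r)
    finally show ?thesis by simp
  qed
  then show ?thesis unfolding total_degree_def by (intro Max.boundedI) auto
qed

text \<open>The coefficients of a multilinear polynomial are its values on basis vectors.\<close>

lemma multihom_coef:
  assumes f: "f \<in> multihom n (\<lambda>i. of_bool (i < m))" and a: "a \<in> keys f"
  obtains w where "\<And>i. i < m \<Longrightarrow> w i < n" "coef f a = eval_pol f (\<lambda>i. unit_vec n (w i))"
proof -
  have ex: "\<exists>k<n. \<forall>l. coef b (i, l) = of_bool (l = k)" if b: "b \<in> keys f" and i: "i < m" for b i
  proof -
    have "rowdeg b i = 1" using f b i by (simp add: multihom_def)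
    then obtain k where k: "\<And>l. coef b (i, l) = of_bool (l = k)" by (rule rowdeg_1D) blast
    then have "(i, k) \<in> keys b" by (simp add: in_keys_iff)
    then have "k < n" using f b by (auto simp: multihom_def)
    then show ?thesis using k by blast
  qed
  from ex[OF a] obtain w where w: "\<And>i. i < m \<Longrightarrow> w i < n"
    "\<And>i l. i < m \<Longrightarrow> coef a (i, l) = of_bool (l = w i)" by metis
  have keys_lt: "i < m" if "(i, k) \<in> keys b" "b \<in> keys f" for i k b
    using multihom_poly_ring[OF f] that by (auto simp: poly_ring_def)
  let ?x = "coords (\<lambda>i. unit_vec n (w i))"
  have one: "meval ?x a = 1"
    unfolding meval_def
  proof (rule prod.neutral, rule ballI)
    fix p assume p: "p \<in> keys a"
    obtain i k where ik: "p = (i, k)" by (cases p)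
    then have "i < m" using keys_lt p a by blast
    then have "k = w i" using p w(2)[of i k] ik by (auto simp: in_keys_iff)
    then show "?x p ^ coef a p = 1" using w(1)[OF \<open>i < m\<close>] ik by (simp add: coords_def)
  qed
  have zero: "meval ?x b = 0" if b: "b \<in> keys f" "b \<noteq> a" for b
  proof -
    obtain p where p: "coef b p \<noteq> coef a p" using b(2) poly_mapping_eqI[of b a] by blast
    obtain i k where ik: "p = (i, k)" by (cases p)
    have "p \<in> keys a \<or> p \<in> keys b" using p by (auto simp: in_keys_iff)
    then have i: "i < m" using keys_lt a b(1) ik by blast
    obtain l where l: "l < n" "\<And>j. coef b (i, j) = of_bool (j = l)" using ex[OF b(1) i] by blast
    have "l \<noteq> w i" using p ik l(2) w(2)[OF i] by auto
    then have "?x (i, l) = 0" using l(1) w(1)[OF i] by (simp add: coords_def)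
    moreover have "(i, l) \<in> keys b" "coef b (i, l) = 1" by (simp_all add: in_keys_iff l(2))
    ultimately show ?thesis unfolding meval_def by (intro prod_zero) force+
  qed
  have "eval_pol f (\<lambda>i. unit_vec n (w i)) = (\<Sum>b\<in>keys f. if b = a then coef f a else 0)"
    unfolding eval_pol_lin lin_def by (intro sum.cong) (auto simp: one zero)
  also have "\<dots> = coef f a" using a by simp
  finally show ?thesis using that[OF w(1)] by simp
qed

lemma f_tilde_integral:
  assumes "even n" "even m" "0 < n" "n \<le> m"
  shows "f_tilde n m \<in> int_poly_ring n m"
proof -
  note mh = f_tilde_multihom[OF assms(1,2,4)]
  have "coef (f_tilde n m) a \<in> \<int>" for a
  proof (cases "a \<in> keys (f_tilde n m)")
    case True
    then obtain w where w: "\<And>i. i < m \<Longrightarrow> w i < n"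
      "coef (f_tilde n m) a = eval_pol (f_tilde n m) (\<lambda>i. unit_vec n (w i))"
      using multihom_coef[OF mh] by blast
    have "half_spin n (map (unit_vec n) (map w [0..<m])) \<in> \<int>"
      by (rule half_spin_integral) (use assms w in auto)
    then show ?thesis by (simp add: w(2) eval_f_tilde[OF assms(1,2,4)] comp_def)
  qed (simp add: in_keys_iff)
  then show ?thesis using multihom_poly_ring[OF mh] by (simp add: int_poly_ring_def)
qed

lemma eval_pf_pol_invariant:
  assumes n: "even n" and A: "A \<in> special_orthogonal_group n" and v: "v \<in> {..<m} \<rightarrow> carrier_vec n"
    and js: "set js \<subseteq> {..<m}" "even (length js)"
  shows "eval_pol (pf_pol n js) (\<lambda>i. A *\<^sub>v v i) = eval_pol (pf_pol n js) v"
proof -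
  have "v (js ! k) \<in> carrier_vec n" if "k < length js" for k
    using v js that by (auto simp: subset_iff)
  then have "skew_gram (bil n) (map (\<lambda>i. A *\<^sub>v v i) js) k l = skew_gram (bil n) (map v js) k l"
    if "k < length js" "l < length js" for k l
    using that bil_special_orthogonal[OF n A] by (simp add: skew_gram_def)
  then show ?thesis
    unfolding eval_pf_pol[OF js(2)] by (intro arg_cong[where f = pfaffian] eq_matI) auto
qed

lemma eval_det_pol_invariant:
  assumes n: "even n" and A: "A \<in> special_orthogonal_group n" and v: "v \<in> {..<m} \<rightarrow> carrier_vec n"
    and js: "set js \<subseteq> {..<m}" "length js = n"
  shows "eval_pol (det_pol n js) (\<lambda>i. A *\<^sub>v v i) = eval_pol (det_pol n js) v"
proof -
  let ?V = "mat n n (\<lambda>(r, c). v (js ! c) $ r)"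
  have vc: "v (js ! k) \<in> carrier_vec n" if "k < n" for k
    using v js that by (auto simp: subset_iff)
  have Ac: "A \<in> carrier_mat n n" using orthogonal_groupD(1) special_orthogonal_group_det(1)[OF n A] by blast
  have "mat n n (\<lambda>(r, c). (A *\<^sub>v v (js ! c)) $ r) = A * ?V"
  proof (rule eq_matI)
    fix r c assume "r < dim_row (A * ?V)" "c < dim_col (A * ?V)"
    then have rc: "r < n" "c < n" using Ac by auto
    have "col ?V c = v (js ! c)" using rc vc[OF rc(2)] by (intro eq_vecI) auto
    then show "mat n n (\<lambda>(r, c). (A *\<^sub>v v (js ! c)) $ r) $$ (r, c) = (A * ?V) $$ (r, c)"
      using rc Ac by simp
  qed (use Ac in auto)
  then show ?thesis
    using special_orthogonal_group_det(2)[OF n A] det_mult[OF Ac, of ?V]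
    by (simp add: eval_det_pol[OF js(2)])
qed

lemma f_tilde_invariant:
  assumes "even n" "even m" "n \<le> m"
  shows "f_tilde n m \<in> invariants n m"
  unfolding invariants_def
proof (intro CollectI conjI ballI)
  show "f_tilde n m \<in> poly_ring n m" by (rule multihom_poly_ring[OF f_tilde_multihom[OF assms]])
  fix A and v :: "nat \<Rightarrow> complex vec" assume A: "A \<in> special_orthogonal_group n" and v: "v \<in> {..<m} \<rightarrow> carrier_vec n"
  have "eval_pol (det_pol n (map p [0..<n])) (\<lambda>i. A *\<^sub>v v i) = eval_pol (det_pol n (map p [0..<n])) v"
    "eval_pol (pf_pol n (map p [n..<m])) (\<lambda>i. A *\<^sub>v v i) = eval_pol (pf_pol n (map p [n..<m])) v"
    if p: "p permutes {..<m}" for p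
  proof -
    have "p x < m" if "x < m" for x using permutes_in_image[OF p, of x] that by simp
    then show "eval_pol (det_pol n (map p [0..<n])) (\<lambda>i. A *\<^sub>v v i) = eval_pol (det_pol n (map p [0..<n])) v"
      "eval_pol (pf_pol n (map p [n..<m])) (\<lambda>i. A *\<^sub>v v i) = eval_pol (pf_pol n (map p [n..<m])) v"
      using assms by (auto intro!: eval_det_pol_invariant[OF assms(1) A v] eval_pf_pol_invariant[OF assms(1) A v])
  qed
  moreover have "eval_pol (pf_pol n [0..<m]) (\<lambda>i. A *\<^sub>v v i) = eval_pol (pf_pol n [0..<m]) v"
    by (rule eval_pf_pol_invariant[OF assms(1) A v]) (use assms in auto)
  ultimately show "eval_pol (f_tilde n m) (\<lambda>i. A *\<^sub>v v i) = eval_pol (f_tilde n m) v"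
    unfolding f_tilde_def eval_pol_mult eval_pol_diff eval_pol_sum eval_pol_const eval_pol_sign
    by (intro arg_cong2[where f = "(*)"] arg_cong2[where f = "(-)"] sum.cong refl) simp_all
qed

lemma poly_ring_add: "f \<in> poly_ring n m \<Longrightarrow> g \<in> poly_ring n m \<Longrightarrow> f + g \<in> poly_ring n m"
  using Poly_Mapping.keys_add[of f g] by (auto simp: poly_ring_def)

lemma poly_ring_uminus: "f \<in> poly_ring n m \<Longrightarrow> - f \<in> poly_ring n m"
  by (simp add: poly_ring_def)

lemma poly_ring_mult:
  assumes "f \<in> poly_ring n m" "g \<in> poly_ring n m"
  shows "f * g \<in> poly_ring n m"
  unfolding poly_ring_def
proof (intro CollectI ballI)
  fix a assume "a \<in> keys (f * g)"
  then obtain b c where "a = b + c" "b \<in> keys f" "c \<in> keys g"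
    using Poly_Mapping.keys_mult[of f g] by auto
  then show "keys a \<subseteq> {..<m} \<times> {..<n}"
    using assms by (auto simp: poly_ring_def keys_add_mono)
qed

lemma coef_lin: "coef f a = lin (\<lambda>b. of_bool (b = a)) f"
proof -
  have "lin (\<lambda>b. of_bool (b = a)) f = (\<Sum>b\<in>insert a (keys f). coef f b * of_bool (b = a))"
    by (rule lin_superset) auto
  also have "\<dots> = (\<Sum>b\<in>insert a (keys f). if b = a then coef f a else 0)"
    by (intro sum.cong) auto
  finally show ?thesis by simp
qed

lemma int_invariants_closed:
  assumes f: "f \<in> int_invariants n m" and g: "g \<in> int_invariants n m"
  shows "f + g \<in> int_invariants n m" "- f \<in> int_invariants n m" "f * g \<in> int_invariants n m"
proof -
  have ints: "coef (f * g) a \<in> \<int>" for a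
    using f g unfolding coef_lin[of "f * g"] lin_mult
    by (auto simp: int_invariants_def int_poly_ring_def intro!: Ints_sum)
  show "f + g \<in> int_invariants n m" "- f \<in> int_invariants n m"
    using f g by (auto simp: int_invariants_def int_poly_ring_def invariants_def poly_ring_add poly_ring_uminus
        lookup_add eval_pol_simps)
  show "f * g \<in> int_invariants n m"
    using f g ints by (auto simp: int_invariants_def int_poly_ring_def invariants_def poly_ring_mult eval_pol_simps)
qed

lemma one_int_invariant: "1 \<in> int_invariants n m"
  by (auto simp: int_invariants_def int_poly_ring_def invariants_def poly_ring_def eval_pol_simps lookup_one when_def)

section \<open>Powers of two dividing integer invariants\<close>

text \<open>The monomials with one factor from each row in \<open>S\<close> whose column is allowed by \<open>L\<close>. Such a monomial
  is a word in the letters \<open>x\<^sub>0, y\<^sub>0, x\<^sub>1, \<dots>\<close>.\<close>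

definition sqfree :: "(nat \<Rightarrow> nat set) \<Rightarrow> nat set \<Rightarrow> mono \<Rightarrow> bool" where
  "sqfree L S a \<longleftrightarrow> (\<forall>i. rowdeg a i = of_bool (i \<in> S)) \<and> (\<forall>(i, k)\<in>keys a. k \<in> L i)"

text \<open>The value of the part of \<open>f\<close> that is multilinear in the vectors of \<open>S\<close>, and of degree 0 in the others,
  when each vector \<open>i\<close> is the sum of the basis vectors numbered by \<open>L i\<close>. Working with coefficients
  avoids the decomposition into multihomogeneous components.\<close>

definition word_sum :: "(nat \<Rightarrow> nat set) \<Rightarrow> nat set \<Rightarrow> mpol \<Rightarrow> complex" where
  "word_sum L S = lin (\<lambda>a. of_bool (sqfree L S a))"

text \<open>A squarefree monomial determines how its rows are distributed among two factors.\<close>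

lemma sqfree_add:
  assumes "finite S"
  shows "(of_bool (sqfree L S (a + b)) :: complex) =
    (\<Sum>T\<in>Pow S. of_bool (sqfree L T a) * of_bool (sqfree L (S - T) b))"
proof -
  define T0 where "T0 = {i. rowdeg a i = 1}"
  have T0: "T = T0" if "sqfree L T a" for T
    using that by (auto simp: sqfree_def T0_def)
  have "(\<Sum>T\<in>Pow S. of_bool (sqfree L T a) * of_bool (sqfree L (S - T) b)) =
      (\<Sum>T\<in>Pow S. if T = T0 then of_bool (sqfree L T0 a \<and> sqfree L (S - T0) b) else (0::complex))"
  proof (rule sum.cong[OF refl])
    fix T
    show "of_bool (sqfree L T a) * of_bool (sqfree L (S - T) b) =
        (if T = T0 then of_bool (sqfree L T0 a \<and> sqfree L (S - T0) b) else (0::complex))"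
    proof (cases "T = T0")
      case False
      then have "\<not> sqfree L T a" using T0 by blast
      then show ?thesis using False by simp
    qed simp
  qed
  also have "\<dots> = of_bool (T0 \<subseteq> S \<and> sqfree L T0 a \<and> sqfree L (S - T0) b)"
    using assms by simp
  also have "(T0 \<subseteq> S \<and> sqfree L T0 a \<and> sqfree L (S - T0) b) \<longleftrightarrow> sqfree L S (a + b)"
  proof
    assume "T0 \<subseteq> S \<and> sqfree L T0 a \<and> sqfree L (S - T0) b"
    then show "sqfree L S (a + b)"
      by (auto simp: sqfree_def rowdeg_add keys_add_mono)
  next
    assume s: "sqfree L S (a + b)"
    then have deg: "rowdeg a i + rowdeg b i = of_bool (i \<in> S)" for i
      by (simp add: sqfree_def rowdeg_add)
    have "rowdeg a i = of_bool (i \<in> T0) \<and> rowdeg b i = of_bool (i \<in> S - T0) \<and> (i \<in> T0 \<longrightarrow> i \<in> S)" for i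
    proof (cases "i \<in> S")
      case True
      then have "rowdeg a i = 1 \<and> rowdeg b i = 0 \<or> rowdeg a i = 0 \<and> rowdeg b i = 1"
        using deg[of i] by (cases "rowdeg a i") auto
      then show ?thesis using True by (elim disjE) (simp_all add: T0_def)
    next
      case False
      then show ?thesis using deg[of i] by (simp add: T0_def)
    qed
    then show "T0 \<subseteq> S \<and> sqfree L T0 a \<and> sqfree L (S - T0) b"
      using s by (auto simp: sqfree_def keys_add_mono)
  qed
  finally show ?thesis by simp
qed

lemma word_sum_mult:
  assumes "finite S"
  shows "word_sum L S (f * g) = (\<Sum>T\<in>Pow S. word_sum L T f * word_sum L (S - T) g)"
proof -
  have "word_sum L S (f * g) = (\<Sum>a\<in>keys f. \<Sum>b\<in>keys g. \<Sum>T\<in>Pow S.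
      (coef f a * of_bool (sqfree L T a)) * (coef g b * of_bool (sqfree L (S - T) b)))"
    unfolding word_sum_def lin_mult sqfree_add[OF assms] sum_distrib_left by (simp only: mult_ac)
  also have "\<dots> = (\<Sum>T\<in>Pow S. \<Sum>a\<in>keys f. \<Sum>b\<in>keys g.
      (coef f a * of_bool (sqfree L T a)) * (coef g b * of_bool (sqfree L (S - T) b)))"
    by (subst (2) sum.swap, subst sum.swap) (rule refl)
  finally show ?thesis unfolding word_sum_def lin_def sum_product .
qed

lemma swap_pairs_invol [simp]: "swap_pairs r s (swap_pairs r s k) = k"
  by (simp add: swap_pairs_def)

lemma swap_pairs_div [simp]: "swap_pairs r s k div 2 = k div 2"
  by (simp add: swap_pairs_def)

definition swap_mono :: "nat \<Rightarrow> nat \<Rightarrow> mono \<Rightarrow> mono" where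
  "swap_mono r s = Poly_Mapping.map_key (\<lambda>(i, k). (i, swap_pairs r s k))"

lemma inj_swap: "inj (\<lambda>(i :: nat, k). (i, swap_pairs r s k))"
  by (rule inj_on_inverseI[where g = "\<lambda>(i, k). (i, swap_pairs r s k)"]) auto

lemma coef_swap_mono: "coef (swap_mono r s a) (i, k) = coef a (i, swap_pairs r s k)"
  unfolding swap_mono_def by (simp add: map_key.rep_eq[OF inj_swap])

lemma keys_swap_mono: "(i, k) \<in> keys (swap_mono r s a) \<longleftrightarrow> (i, swap_pairs r s k) \<in> keys a"
  by (simp add: in_keys_iff coef_swap_mono)

lemma swap_mono_invol [simp]: "swap_mono r s (swap_mono r s a) = a"
  by (rule poly_mapping_eqI) (auto simp: coef_swap_mono)

lemma rowdeg_swap_mono [simp]: "rowdeg (swap_mono r s a) i = rowdeg a i"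
  unfolding rowdeg_def
  by (rule sum.reindex_bij_witness[of _ "\<lambda>(i, k). (i, swap_pairs r s k)" "\<lambda>(i, k). (i, swap_pairs r s k)"])
    (auto simp: keys_swap_mono coef_swap_mono)

lemma meval_swap_mono: "meval x (swap_mono r s a) = meval (\<lambda>(i, k). x (i, swap_pairs r s k)) a"
  unfolding meval_def
  by (rule prod.reindex_bij_witness[of _ "\<lambda>(i, k). (i, swap_pairs r s k)" "\<lambda>(i, k). (i, swap_pairs r s k)"])
    (auto simp: keys_swap_mono coef_swap_mono)

text \<open>Invariance is a statement about values; it passes to coefficients because monomials are linearly
  independent functions.\<close>

lemma invariant_coef_swap:
  assumes n: "even n" and rs: "r \<noteq> s" "r < n div 2" "s < n div 2" and f: "f \<in> invariants n m"
  shows "coef f (swap_mono r s a) = coef f a"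
proof -
  obtain A where A: "A \<in> special_orthogonal_group n"
    "\<And>v. v \<in> carrier_vec n \<Longrightarrow> A *\<^sub>v v = vec n (\<lambda>k. v $ swap_pairs r s k)"
    using swap_pairs_special_orthogonal[OF n rs] by blast
  let ?\<sigma> = "swap_mono r s"
  define K where "K = keys f \<union> ?\<sigma> ` keys f"
  have finK: "finite K" by (simp add: K_def)
  have swlt: "swap_pairs r s k < n" if "k < n" for k
    using that partner_less[OF n that] by (simp add: swap_pairs_def)
  have "(\<Sum>b\<in>K. (coef f b - coef f (?\<sigma> b)) * meval x b) = 0" for x
  proof -
    define v where "v i = vec n (\<lambda>k. x (i, k))" for i
    have "eval_pol f (\<lambda>i. A *\<^sub>v v i) = eval_pol f v"
    proof -
      have "v \<in> {..<m} \<rightarrow> carrier_vec n" by (simp add: v_def)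
      then show ?thesis using f A(1) unfolding invariants_def by blast
    qed
    moreover have "eval_pol f v = (\<Sum>a\<in>keys f. coef f a * meval x a)"
      unfolding eval_pol_lin lin_def
    proof (intro sum.cong refl arg_cong2[where f = "(*)"])
      fix a assume "a \<in> keys f"
      then have "keys a \<subseteq> {..<m} \<times> {..<n}" using f by (auto simp: invariants_def poly_ring_def)
      then show "meval (coords v) a = meval x a"
        unfolding meval_def by (intro prod.cong) (auto simp: coords_def v_def)
    qed
    moreover have "eval_pol f (\<lambda>i. A *\<^sub>v v i) = (\<Sum>a\<in>keys f. coef f a * meval x (?\<sigma> a))"
      unfolding eval_pol_lin lin_def
    proof (intro sum.cong refl arg_cong2[where f = "(*)"])
      fix a assume "a \<in> keys f"
      then have "keys a \<subseteq> {..<m} \<times> {..<n}" using f by (auto simp: invariants_def poly_ring_def)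
      then show "meval (coords (\<lambda>i. A *\<^sub>v v i)) a = meval x (?\<sigma> a)"
      proof (subst meval_swap_mono, unfold meval_def, intro prod.cong refl)
        fix p assume "p \<in> keys a"
        then obtain i k where p: "p = (i, k)" "k < n" using \<open>keys a \<subseteq> {..<m} \<times> {..<n}\<close> by auto
        have "(A *\<^sub>v v i) $ k = x (i, swap_pairs r s k)"
          using A(2)[of "v i"] p(2) swlt[OF p(2)] by (simp add: v_def)
        then show "coords (\<lambda>i. A *\<^sub>v v i) p ^ coef a p = (case p of (i, k) \<Rightarrow> x (i, swap_pairs r s k)) ^ coef a p"
          by (simp add: p coords_def)
      qed
    qed
    moreover have "(\<Sum>a\<in>keys f. coef f a * meval x (?\<sigma> a)) = (\<Sum>b\<in>?\<sigma> ` keys f. coef f (?\<sigma> b) * meval x b)"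
      by (subst sum.reindex) (auto intro: inj_on_inverseI[where g = ?\<sigma>])
    moreover have "(\<Sum>b\<in>?\<sigma> ` keys f. coef f (?\<sigma> b) * meval x b) = (\<Sum>b\<in>K. coef f (?\<sigma> b) * meval x b)"
    proof (rule sum.mono_neutral_left[OF finK])
      show "\<forall>b\<in>K - ?\<sigma> ` keys f. coef f (?\<sigma> b) * meval x b = 0"
      proof
        fix b assume b: "b \<in> K - ?\<sigma> ` keys f"
        have "?\<sigma> b \<notin> keys f"
        proof
          assume "?\<sigma> b \<in> keys f"
          then have "?\<sigma> (?\<sigma> b) \<in> ?\<sigma> ` keys f" by (rule imageI)
          then show False using b by simp
        qed
        then show "coef f (?\<sigma> b) * meval x b = 0" by (simp add: in_keys_iff)
      qed
    qed (simp add: K_def)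
    moreover have "(\<Sum>a\<in>keys f. coef f a * meval x a) = (\<Sum>b\<in>K. coef f b * meval x b)"
      by (rule sum.mono_neutral_left[OF finK]) (auto simp: K_def in_keys_iff)
    ultimately show ?thesis by (simp add: left_diff_distrib sum_subtractf)
  qed
  then have zero: "\<forall>b\<in>K. coef f b - coef f (?\<sigma> b) = 0"
    by (rule monomials_independent[OF finK])
  show ?thesis
  proof (cases "a \<in> K")
    case True
    then show ?thesis using zero by simp
  next
    case False
    then have "a \<notin> keys f" "a \<notin> ?\<sigma> ` keys f" by (auto simp: K_def)
    moreover have "?\<sigma> a \<notin> keys f"
    proof
      assume "?\<sigma> a \<in> keys f"
      then have "?\<sigma> (?\<sigma> a) \<in> ?\<sigma> ` keys f" by (rule imageI)
      then show False using \<open>a \<notin> ?\<sigma> ` keys f\<close> by simp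
    qed
    ultimately show ?thesis by (simp add: in_keys_iff)
  qed
qed

text \<open>The test point: the vector \<open>i\<close> is \<open>x\<^sub>r + y\<^sub>r\<close> with \<open>r = i div 2 mod \<nu>\<close>. The vectors come in equal
  consecutive pairs, as \<open>half_spin_pairs\<close> requires, and every \<open>r < \<nu>\<close> occurs when there are \<open>2\<nu>\<close> vectors
  or more.\<close>

definition letters :: "nat \<Rightarrow> nat \<Rightarrow> nat set" where
  "letters \<nu> i = {2 * (i div 2 mod \<nu>), Suc (2 * (i div 2 mod \<nu>))}"

text \<open>The number of independent exchanges \<open>x\<^sub>r \<leftrightarrow> y\<^sub>r\<close> available for words on the vectors of \<open>T\<close>. Only an even
  number of exchanges belongs to the group; if some \<open>r\<close> does not occur, its exchange is invisible and
  adjusts the parity for free, otherwise one degree of freedom is lost.\<close>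

definition two_weight :: "nat \<Rightarrow> nat set \<Rightarrow> nat" where
  "two_weight \<nu> T = min (card ((\<lambda>i. i div 2 mod \<nu>) ` T)) (\<nu> - 1)"

text \<open>The sum of the coefficients over all words breaks up into free orbits of the exchanges. To get the
  exchanges for \<open>r\<close> one by one, each is combined with the exchange for an auxiliary index \<open>t\<close>.\<close>

lemma word_sum_dvd:
  assumes n: "even n" "4 \<le> n" and f: "f \<in> int_invariants n m" and T: "finite T"
  shows "\<exists>z. word_sum (letters (n div 2)) T f = of_int (2 ^ two_weight (n div 2) T * z)"
proof -
  define \<nu> where "\<nu> = n div 2"
  have \<nu>: "2 \<le> \<nu>" using n by (simp add: \<nu>_def)
  define \<rho> where "\<rho> i = i div 2 mod \<nu>" for i :: nat
  have \<rho>lt: "\<rho> i < \<nu>" for i using \<nu> by (simp add: \<rho>_def)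
  have inv: "f \<in> invariants n m" and int: "\<And>a. coef f a \<in> \<int>"
    using f by (auto simp: int_invariants_def int_poly_ring_def)
  \<comment> \<open>\<open>t\<close> is an index that does not occur in \<open>T\<close>, if there is one, and arbitrary otherwise\<close>
  have "\<exists>t<\<nu>. card (\<rho> ` T - {t}) = two_weight \<nu> T"
  proof (cases "card (\<rho> ` T) < \<nu>")
    case True
    have "\<not> {..<\<nu>} \<subseteq> \<rho> ` T"
      using True card_mono[of "\<rho> ` T" "{..<\<nu>}"] T by auto
    then obtain t where t: "t < \<nu>" "t \<notin> \<rho> ` T" by auto
    moreover have "two_weight \<nu> T = card (\<rho> ` T)"
      using True by (simp add: two_weight_def \<rho>_def[abs_def])
    ultimately show ?thesis by auto
  next
    case False
    have sub: "\<rho> ` T \<subseteq> {..<\<nu>}" using \<rho>lt by auto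
    then have "card (\<rho> ` T) \<le> \<nu>" using card_mono[OF _ sub] by simp
    then have c: "card (\<rho> ` T) = \<nu>" using False by simp
    then have "\<rho> ` T = {..<\<nu>}" using sub by (intro card_subset_eq) auto
    then have "card (\<rho> ` T - {0}) = \<nu> - 1" using \<nu> by simp
    also have "\<dots> = two_weight \<nu> T" using c by (simp add: two_weight_def \<rho>_def[abs_def])
    finally show ?thesis using \<nu> by (intro exI[of _ 0]) auto
  qed
  then obtain t where t: "t < \<nu>" "card (\<rho> ` T - {t}) = two_weight \<nu> T" by blast
  define R where "R = \<rho> ` T - {t}"
  have R: "r < \<nu>" "r \<noteq> t" if "r \<in> R" for r
    using that \<rho>lt by (auto simp: R_def)
  define pos where "pos r = (SOME i. i \<in> T \<and> \<rho> i = r)" for r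
  have pos: "pos r \<in> T" "\<rho> (pos r) = r" if "r \<in> R" for r
    using that someI_ex[of "\<lambda>i. i \<in> T \<and> \<rho> i = r"] by (auto simp: R_def pos_def)
  let ?W = "{a \<in> keys f. sqfree (letters \<nu>) T a}"
  have inv_coef: "coef f (swap_mono r t a) = coef f a" if "r \<in> R" for r a
    using invariant_coef_swap[OF n(1) R(2)[OF that] _ _ inv] R(1)[OF that] t(1) by (simp add: \<nu>_def)
  have letters_iff: "k \<in> letters \<nu> i \<longleftrightarrow> k div 2 = \<rho> i" for i k
  proof -
    have "k = 2 * x \<or> k = Suc (2 * x) \<longleftrightarrow> k div 2 = x" for x by presburger
    then show ?thesis by (simp add: letters_def \<rho>_def)
  qed
  have one_letter: "coef a (pos r, Suc (2 * r)) = 1 \<longleftrightarrow> coef a (pos r, 2 * r) \<noteq> 1"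
    if r: "r \<in> R" and a: "a \<in> ?W" for r a
  proof -
    have "rowdeg a (pos r) = 1" using a pos[OF r] by (simp add: sqfree_def)
    then obtain k where k: "\<And>l. coef a (pos r, l) = of_bool (l = k)" by (rule rowdeg_1D) blast
    then have "(pos r, k) \<in> keys a" by (simp add: in_keys_iff)
    then have "k \<in> letters \<nu> (pos r)" using a by (auto simp: sqfree_def)
    then have "k = 2 * r \<or> k = Suc (2 * r)"
      using pos(2)[OF r] by (auto simp: letters_def \<rho>_def)
    then show ?thesis by (auto simp: k)
  qed
  \<comment> \<open>the bit of \<open>r\<close> tells whether the vector \<open>pos r\<close> contributes \<open>x\<^sub>r\<close> or \<open>y\<^sub>r\<close>\<close>
  have "(\<Sum>a\<in>?W. coef f a) = 2 ^ card R * (\<Sum>a | a \<in> ?W \<and> (\<forall>r\<in>R. coef a (pos r, 2 * r) = 1). coef f a)"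
  proof (rule sum_halving[where \<tau> = "\<lambda>r. swap_mono r t"])
    show "finite R" using T by (simp add: R_def)
    show "finite ?W" by simp
    fix r a assume r: "r \<in> R" and a: "a \<in> ?W"
    show "coef f (swap_mono r t a) = coef f a" by (rule inv_coef[OF r])
    show "swap_mono r t (swap_mono r t a) = a" by simp
    have "k \<in> letters \<nu> i" if "(i, k) \<in> keys (swap_mono r t a)" for i k
    proof -
      have "(i, swap_pairs r t k) \<in> keys a" using that by (simp add: keys_swap_mono)
      then have "swap_pairs r t k \<in> letters \<nu> i" using a by (auto simp: sqfree_def)
      then show ?thesis by (simp add: letters_iff)
    qed
    then show "swap_mono r t a \<in> ?W"
      using a inv_coef[OF r, of a] by (auto simp: sqfree_def in_keys_iff)
    have "swap_pairs r t (2 * r) = Suc (2 * r)" by (simp add: swap_pairs_def)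
    then show "coef (swap_mono r t a) (pos r, 2 * r) = 1 \<longleftrightarrow> \<not> coef a (pos r, 2 * r) = 1"
      using one_letter[OF r a] by (simp add: coef_swap_mono)
    fix s assume s: "s \<in> R" "r \<noteq> s"
    have "swap_pairs r t (2 * s) = 2 * s" using R(2)[OF s(1)] s(2) by (simp add: swap_pairs_def)
    then show "coef (swap_mono r t a) (pos s, 2 * s) = 1 \<longleftrightarrow> coef a (pos s, 2 * s) = 1"
      by (simp add: coef_swap_mono)
  qed
  moreover have "(\<Sum>a | a \<in> ?W \<and> (\<forall>r\<in>R. coef a (pos r, 2 * r) = 1). coef f a) \<in> \<int>"
    using int by (intro Ints_sum)
  then obtain z where "(\<Sum>a | a \<in> ?W \<and> (\<forall>r\<in>R. coef a (pos r, 2 * r) = 1). coef f a) = of_int z"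
    by (elim Ints_cases)
  moreover have "word_sum (letters \<nu>) T f = (\<Sum>a\<in>?W. coef f a)"
    unfolding word_sum_def lin_def by (intro sum.mono_neutral_cong_right) (auto simp: of_bool_def)
  ultimately show ?thesis using t(2) unfolding \<nu>_def[symmetric] R_def[symmetric] by (intro exI[of _ z]) simp
qed

text \<open>Two complementary sets of vectors together contain all \<open>\<nu>\<close> indices. If one of them contains all
  indices and loses one for parity, the other one makes up for it, as it still contains an index and
  \<open>\<nu> \<ge> 2\<close>.\<close>

lemma two_weight_split:
  assumes \<nu>: "2 \<le> \<nu>" "\<nu> * 2 \<le> m" and T: "T \<subseteq> {..<m}" "T \<noteq> {}" "T \<noteq> {..<m}"
  shows "\<nu> \<le> two_weight \<nu> T + two_weight \<nu> ({..<m} - T)"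
proof -
  let ?\<rho> = "\<lambda>i. i div 2 mod \<nu>"
  let ?a = "card (?\<rho> ` T)" and ?b = "card (?\<rho> ` ({..<m} - T))"
  have fin: "finite T" using T(1) finite_subset by blast
  have "{..<\<nu>} \<subseteq> ?\<rho> ` {..<m}"
  proof
    fix r assume "r \<in> {..<\<nu>}"
    then show "r \<in> ?\<rho> ` {..<m}" using \<nu> by (intro image_eqI[where x = "2 * r"]) auto
  qed
  also have "\<dots> = ?\<rho> ` T \<union> ?\<rho> ` ({..<m} - T)" using T(1) by blast
  finally have "\<nu> \<le> card (?\<rho> ` T \<union> ?\<rho> ` ({..<m} - T))"
    using card_mono[of "?\<rho> ` T \<union> ?\<rho> ` ({..<m} - T)" "{..<\<nu>}"] fin by simp
  also have "\<dots> \<le> ?a + ?b" by (rule card_Un_le)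
  finally have ab: "\<nu> \<le> ?a + ?b" .
  have pos: "1 \<le> ?a" "1 \<le> ?b"
    using T fin by (auto simp: Suc_le_eq card_gt_0_iff)
  show ?thesis
    unfolding two_weight_def using ab pos \<nu>(1) by (auto simp: min_def)
qed

section \<open>Indecomposability\<close>

lemma word_sum_f_tilde:
  assumes n: "even n" "4 \<le> n" and m: "even m" "n \<le> m"
  shows "word_sum (letters (n div 2)) {..<m} (f_tilde n m) = 2 ^ (n div 2 - 1)"
proof -
  define \<nu> where "\<nu> = n div 2"
  have \<nu>: "2 \<le> \<nu>" "n = 2 * \<nu>" using n by (auto simp: \<nu>_def)
  define v where "v i = vec n (\<lambda>k. of_bool (k \<in> letters \<nu> i) :: complex)" for i
  note mh = f_tilde_multihom[OF n(1) m]
  have "meval (coords v) a = of_bool (sqfree (letters \<nu>) {..<m} a)" if a: "a \<in> keys (f_tilde n m)" for a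
  proof -
    have deg: "rowdeg a i = of_bool (i < m)" for i using mh a by (simp add: multihom_def)
    have coef: "coords v p = of_bool (snd p \<in> letters \<nu> (fst p))" if "p \<in> keys a" for p
    proof -
      obtain i k where ik: "p = (i, k)" by (cases p)
      then have "k < n" using mh a that by (auto simp: multihom_def)
      then show ?thesis by (simp add: ik coords_def v_def)
    qed
    show ?thesis
    proof (cases "\<forall>(i, k)\<in>keys a. k \<in> letters \<nu> i")
      case True
      then have "coords v p = 1" if "p \<in> keys a" for p using coef[OF that] that by auto
      then have "meval (coords v) a = 1" by (simp add: meval_def)
      then show ?thesis using True deg by (simp add: sqfree_def)
    next
      case False
      then obtain p where p: "p \<in> keys a" "snd p \<notin> letters \<nu> (fst p)" by auto
      then have "coords v p ^ coef a p = 0" using coef[OF p(1)] by (simp add: in_keys_iff)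
      then have "meval (coords v) a = 0" unfolding meval_def using p(1) by (intro prod_zero) auto
      then show ?thesis using False by (auto simp: sqfree_def)
    qed
  qed
  then have "word_sum (letters \<nu>) {..<m} (f_tilde n m) = eval_pol (f_tilde n m) v"
    unfolding word_sum_def eval_pol_lin lin_def by simp
  also have "\<dots> = half_spin n (map v [0..<2 * (m div 2)])"
    using m by (simp add: eval_f_tilde[OF n(1) m])
  also have "\<dots> = 2 ^ (n div 2 - 1)"
  proof (rule half_spin_pairs)
    show "even n" "0 < n" using n by auto
    have vi: "v i $ k = of_bool (k div 2 = i div 2 mod \<nu>)" if "k < n" for i k
    proof -
      have "k = 2 * x \<or> k = Suc (2 * x) \<longleftrightarrow> k div 2 = x" for x by presburger
      then show ?thesis using that by (simp add: v_def letters_def)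
    qed
    have blt: "2 * r < n" "Suc (2 * r) < n" if "r < n div 2" for r using that by auto
    fix k assume k: "k < m div 2"
    have "v (2 * k) = v (Suc (2 * k))" by (simp add: v_def letters_def)
    moreover have "bil n (v (2 * k)) (v (2 * k)) = (\<Sum>r<n div 2. if r = k mod \<nu> then 2 else 0)"
      unfolding bil_def using blt by (intro sum.cong) (auto simp: vi)
    then have "bil n (v (2 * k)) (v (2 * k)) = 2" using \<nu> by (simp add: \<nu>_def[symmetric])
    ultimately show "v (2 * k) = v (Suc (2 * k)) \<and> bil n (v (2 * k)) (v (2 * k)) = 2" by blast
  qed
  finally show ?thesis by (simp add: \<nu>_def)
qed

text \<open>Polynomials of degree less than \<open>m\<close> have no monomial that involves all \<open>m\<close> vectors. In a product, each
  distribution of the vectors among the two factors contributes a multiple of \<open>2\<^bsup>n div 2\<^esup>\<close>: by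
  \<open>two_weight_split\<close> if both factors receive vectors, and by the induction hypothesis otherwise.\<close>

lemma generated_word_sum:
  assumes n: "even n" "4 \<le> n" and m: "n \<le> m" and d: "d \<le> m"
    and f: "f \<in> generate_ring class_ring {g \<in> int_invariants n m. total_degree g < d}"
  shows "f \<in> int_invariants n m \<and> (\<exists>z. word_sum (letters (n div 2)) {..<m} f = of_int (2 ^ (n div 2) * z))"
  using f
proof (induction rule: generate_ring.induct)
  case one
  have "\<not> sqfree (letters (n div 2)) {..<m} 0" using n m by (auto simp: sqfree_def intro!: exI[of _ 0])
  then have "word_sum (letters (n div 2)) {..<m} 1 = 0" by (simp add: word_sum_def lin_def)
  then show ?case using one_int_invariant
    by (auto simp: class_ring_simps intro!: exI[of _ 0])
next
  case (incl g)
  have "\<not> sqfree (letters (n div 2)) {..<m} a" if a: "a \<in> keys g" for a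
  proof
    assume s: "sqfree (letters (n div 2)) {..<m} a"
    have "(\<Sum>p\<in>keys a. coef a p) = (\<Sum>i<m. rowdeg a i)"
      by (rule degree_rowdeg) (use s in \<open>simp add: sqfree_def\<close>)
    also have "\<dots> = (\<Sum>i<m. 1)" using s by (intro sum.cong) (auto simp: sqfree_def)
    finally have "(\<Sum>p\<in>keys a. coef a p) = m" by simp
    moreover have "(\<Sum>p\<in>keys a. coef a p) \<le> total_degree g"
      unfolding total_degree_def using a by (intro Max_ge) auto
    ultimately show False using incl d by simp
  qed
  then have "word_sum (letters (n div 2)) {..<m} g = 0" by (simp add: word_sum_def lin_def)
  then show ?case using incl by (auto intro!: exI[of _ 0])
next
  case (a_inv g)
  then obtain z where "word_sum (letters (n div 2)) {..<m} g = of_int (2 ^ (n div 2) * z)" by blast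
  then have "word_sum (letters (n div 2)) {..<m} (- g) = of_int (2 ^ (n div 2) * (- z))"
    by (simp add: word_sum_def lin_uminus)
  moreover have "- g \<in> int_invariants n m" using a_inv int_invariants_closed(2) by blast
  ultimately show ?case unfolding class_ring_simps by blast
next
  case (eng_add f g)
  then obtain y z where "word_sum (letters (n div 2)) {..<m} f = of_int (2 ^ (n div 2) * y)"
    "word_sum (letters (n div 2)) {..<m} g = of_int (2 ^ (n div 2) * z)" by blast
  then have "word_sum (letters (n div 2)) {..<m} (f + g) = of_int (2 ^ (n div 2) * (y + z))"
    by (simp add: word_sum_def lin_add distrib_left)
  moreover have "f + g \<in> int_invariants n m" using eng_add int_invariants_closed(1) by blast
  ultimately show ?case unfolding class_ring_simps by blast
next
  case (eng_mult f g)
  let ?L = "letters (n div 2)"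
  let ?D = "{c. \<exists>z. c = of_int (2 ^ (n div 2) * z)} :: complex set"
  have D_add: "x + y \<in> ?D" if "x \<in> ?D" "y \<in> ?D" for x y
    using that by (auto simp: distrib_left[symmetric] of_int_add[symmetric] simp del: of_int_add)
  have D_sum: "(\<Sum>x\<in>A. F x) \<in> ?D" if "\<And>x. x \<in> A \<Longrightarrow> F x \<in> ?D" for A :: "nat set set" and F
    using that
  proof (induction A rule: infinite_finite_induct)
    case (insert x A)
    then show ?case using D_add[of "F x" "\<Sum>x\<in>A. F x"] by simp
  qed (auto intro!: exI[of _ 0])
  have "word_sum ?L T f * word_sum ?L ({..<m} - T) g \<in> ?D" if "T \<in> Pow {..<m}" for T
  proof -
    have T: "T \<subseteq> {..<m}" "finite T" using that finite_subset by auto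
    obtain x where x: "word_sum ?L T f = of_int (2 ^ two_weight (n div 2) T * x)"
      using word_sum_dvd[OF n _ T(2)] eng_mult by blast
    obtain y where y: "word_sum ?L ({..<m} - T) g = of_int (2 ^ two_weight (n div 2) ({..<m} - T) * y)"
      using word_sum_dvd[OF n, of g m "{..<m} - T"] eng_mult by blast
    consider "T = {}" | "T = {..<m}" | "T \<noteq> {}" "T \<noteq> {..<m}" by blast
    then show ?thesis
    proof cases
      case 1
      then obtain z where "word_sum ?L ({..<m} - T) g = of_int (2 ^ (n div 2) * z)" using eng_mult by auto
      then show ?thesis using x by (auto intro!: exI[of _ "2 ^ two_weight (n div 2) T * x * z"])
    next
      case 2
      then obtain z where "word_sum ?L T f = of_int (2 ^ (n div 2) * z)" using eng_mult by auto
      then show ?thesis using y by (auto intro!: exI[of _ "z * (2 ^ two_weight (n div 2) ({..<m} - T) * y)"])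
    next
      case 3
      let ?e = "two_weight (n div 2) T" and ?e' = "two_weight (n div 2) ({..<m} - T)"
      have "n div 2 \<le> ?e + ?e'"
        by (rule two_weight_split[OF _ _ T(1) 3]) (use n m in auto)
      then have "(2::int) ^ (?e + ?e') = 2 ^ (n div 2) * 2 ^ (?e + ?e' - (n div 2))"
        by (simp add: power_add[symmetric])
      then have "(2 ^ ?e * x) * (2 ^ ?e' * y) = 2 ^ (n div 2) * (2 ^ (?e + ?e' - (n div 2)) * x * y)"
        by (simp add: power_add algebra_simps)
      then show ?thesis
        unfolding x y of_int_mult[symmetric]
        by (intro CollectI exI[of _ "2 ^ (?e + ?e' - (n div 2)) * x * y"]) (simp only:)
    qed
  qed
  then have "word_sum ?L {..<m} (f * g) \<in> ?D"
    unfolding word_sum_mult[OF finite_lessThan] by (rule D_sum)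
  moreover have "f * g \<in> int_invariants n m" using eng_mult int_invariants_closed(3) by blast
  ultimately show ?case unfolding class_ring_simps by blast
qed

theorem mainTheorem8:
  fixes n m :: nat
  assumes "even n" and "even m" and "4 \<le> n" and "n \<le> m"
  shows "multilinear_pol n m (f_tilde n m) \<and> indecomposable n m (f_tilde n m)"
proof
  note mh = f_tilde_multihom[OF assms(1,2,4)]
  show "multilinear_pol n m (f_tilde n m)" by (rule multihom_multilinear[OF mh])
  have inv: "f_tilde n m \<in> int_invariants n m"
    using f_tilde_invariant[OF assms(1,2,4)] f_tilde_integral[OF assms(1,2) _ assms(4)] assms(3)
    by (simp add: int_invariants_def)
  have "f_tilde n m \<notin> generate_ring class_ring {g \<in> int_invariants n m. total_degree g < total_degree (f_tilde n m)}"
  proof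
    assume "f_tilde n m \<in> generate_ring class_ring
      {g \<in> int_invariants n m. total_degree g < total_degree (f_tilde n m)}"
    then obtain z where "word_sum (letters (n div 2)) {..<m} (f_tilde n m) = of_int (2 ^ (n div 2) * z)"
      using generated_word_sum[OF assms(1,3,4) total_degree_multihom[OF mh]] by blast
    then have "of_int (2 ^ (n div 2 - 1)) = (of_int (2 ^ (n div 2) * z) :: complex)"
      using word_sum_f_tilde[OF assms(1,3,2,4)] by simp
    then have eq: "(2::int) ^ (n div 2 - 1) = 2 ^ (n div 2) * z" by (simp only: of_int_eq_iff)
    obtain j where j: "n div 2 = Suc j" using assms(3) by (cases "n div 2") auto
    have "(2::int) ^ j * 1 = 2 ^ j * (2 * z)" using eq by (simp add: j)
    then have "1 = 2 * z" by (simp only: mult_cancel_left) simp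
    then show False by presburger
  qed
  then show "indecomposable n m (f_tilde n m)" using inv by (simp add: indecomposable_def)
qed

end
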